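(* Any cell-probe data structure for dynamic connectivity on $n$ vertices satisfies the trade-offs $t_q\lg(t_u/t_q)=\Omega(\lg n)$ and $t_u\lg(t_q/t_u)=\Omega(\lg n)$, where $t_u$ is the (amortized expected) running time of \texttt{insert} and \texttt{delete} and $t_q$ that of \texttt{connected}. These bounds hold under amortization, nondeterministic queries, and Las Vegas randomization, or under Monte Carlo randomization with error probability $n^{-\Omega(1)}$. They hold even if the graph is always a disjoint union of paths.
   Context: Throughout, $\lg x$ denotes $\log_2(2+x)$. Dynamic connectivity: maintain an undirected graph on a fixed set of $n$ vertices under $\texttt{insert}(u,v)$ (add edge $(u,v)$), $\texttt{delete}(u,v)$ (remove edge $(u,v)$), and $\texttt{connected}(u,v)$ (test whether $u$ and $v$ are in the same connected component). Cell-probe model: memory consists of cells of $b=\Theta(\lg n)$ bits (at most $2^b$ cells); operations read and write cells, computation is free, no state is retained between operations, cost is the number of cells read or written. Nondeterministic queries: a query may spawn any number of threads; it answers ``yes'' iff at least one thread accepts; its running time is that of its longest thread; rejecting threads may not write cells, and all accepting threads write exactly the same values. Las Vegas randomization: some cells are initialized to uniformly random values at creation, after which computation is deterministic and always correct, with running times measured in expectation. Monte Carlo randomization: the same random initialization, deterministic (non-nondeterministic) operations, but each answer may be wrong with probability at most $n^{-c}$ for a constant $c>0$. *)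

theory Defs
  imports "HOL-Probability.Probability"
begin

definition lg :: "real \<Rightarrow> real" where
  "lg x = log 2 (2 + x)"


section \<open>Cell-probe programs\<close>

text \<open>
  Cells are addressed by numbers, and a cell of \<open>b\<close> bits holds a number below \<open>2 ^ b\<close>.
  A program is a decision tree: the next probe depends in an arbitrary way on the values read so
  far, so computation between probes is free, and programs start with no information other than
  the parameters of the operation, so no state survives outside memory.
\<close>

type_synonym memory = "nat \<Rightarrow> nat"

datatype 'a prog =
    Return 'a
  | Read nat "nat \<Rightarrow> 'a prog"
  | Write nat nat "'a prog"

primrec wf_prog :: "nat \<Rightarrow> 'a prog \<Rightarrow> bool" where
  "wf_prog b (Return x) \<longleftrightarrow> True"
| "wf_prog b (Read a k) \<longleftrightarrow> a < 2 ^ b \<and> (\<forall>v < 2 ^ b. wf_prog b (k v))"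
| "wf_prog b (Write a w p) \<longleftrightarrow> a < 2 ^ b \<and> w < 2 ^ b \<and> wf_prog b p"

primrec result :: "'a prog \<Rightarrow> memory \<Rightarrow> 'a" where
  "result (Return x) M = x"
| "result (Read a k) M = result (k (M a)) M"
| "result (Write a w p) M = result p (M(a := w))"

primrec probes :: "'a prog \<Rightarrow> memory \<Rightarrow> nat" where
  "probes (Return x) M = 0"
| "probes (Read a k) M = Suc (probes (k (M a)) M)"
| "probes (Write a w p) M = Suc (probes p (M(a := w)))"

text \<open>The cells written, each with the last value written to it.\<close>

primrec writes :: "'a prog \<Rightarrow> memory \<Rightarrow> (nat \<rightharpoonup> nat)" where
  "writes (Return x) M = Map.empty"
| "writes (Read a k) M = writes (k (M a)) M"
| "writes (Write a w p) M = [a \<mapsto> w] ++ writes p (M(a := w))"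

definition apply_writes :: "(nat \<rightharpoonup> nat) \<Rightarrow> memory \<Rightarrow> memory" where
  "apply_writes W M = (\<lambda>a. case W a of None \<Rightarrow> M a | Some w \<Rightarrow> w)"


section \<open>Deterministic and nondeterministic queries\<close>

text \<open>
  A nondeterministic query is given by its set of threads, which run independently on the memory
  at the start of the query; \<open>True\<close> means that the thread accepts. Spawning a thread after some
  probes amounts to having a thread that repeats these probes, so it is no restriction to
  spawn all threads at the start.
\<close>

datatype query =
    Deterministic "bool prog"
  | Nondeterministic "bool prog set"

primrec wf_query :: "nat \<Rightarrow> query \<Rightarrow> bool" where
  "wf_query b (Deterministic p) \<longleftrightarrow> wf_prog b p"
| "wf_query b (Nondeterministic T) \<longleftrightarrow> (\<forall>p\<in>T. wf_prog b p)"

primrec answer :: "query \<Rightarrow> memory \<Rightarrow> bool" where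
  "answer (Deterministic p) M \<longleftrightarrow> result p M"
| "answer (Nondeterministic T) M \<longleftrightarrow> (\<exists>p\<in>T. result p M)"

primrec writes_consistent :: "query \<Rightarrow> memory \<Rightarrow> bool" where
  "writes_consistent (Deterministic p) M \<longleftrightarrow> True"
| "writes_consistent (Nondeterministic T) M \<longleftrightarrow>
     (\<forall>p\<in>T. \<not> result p M \<longrightarrow> writes p M = Map.empty) \<and>
     (\<forall>p\<in>T. \<forall>q\<in>T. result p M \<and> result q M \<longrightarrow> writes p M = writes q M)"

text \<open>
  Under \<^const>\<open>writes_consistent\<close>, the choice of the accepting thread does not matter.
\<close>

primrec query_writes :: "query \<Rightarrow> memory \<Rightarrow> (nat \<rightharpoonup> nat)" where
  "query_writes (Deterministic p) M = writes p M"
| "query_writes (Nondeterministic T) M =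
     (if \<exists>p\<in>T. result p M then writes (SOME p. p \<in> T \<and> result p M) M else Map.empty)"

text \<open>
  The cost is an extended real because infinitely many threads may have unbounded running times.
\<close>

primrec query_cost :: "query \<Rightarrow> memory \<Rightarrow> ennreal" where
  "query_cost (Deterministic p) M = of_nat (probes p M)"
| "query_cost (Nondeterministic T) M = (SUP p\<in>T. of_nat (probes p M))"


section \<open>Dynamic connectivity\<close>

datatype operation = Insert nat nat | Delete nat nat | Connected nat nat

text \<open>
  A graph on the vertices \<open>0, \<dots>, n - 1\<close> is represented by its set of edges, an edge being a
  two-element set of vertices.
\<close>

type_synonym graph = "nat set set"

definition simple_graphs :: "nat \<Rightarrow> graph set" where
  "simple_graphs n = {E. \<forall>e\<in>E. \<exists>u v. u < n \<and> v < n \<and> u \<noteq> v \<and> e = {u, v}}"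

definition path_edges :: "nat list \<Rightarrow> graph" where
  "path_edges xs = {{xs ! i, xs ! Suc i} | i. Suc i < length xs}"

text \<open>
  Disjoint unions of paths: the \<open>n\<close> vertices are partitioned into lists of vertices, and the edges
  join consecutive elements of a list. An isolated vertex is a path without edges.
\<close>

definition path_unions :: "nat \<Rightarrow> graph set" where
  "path_unions n =
     {E. \<exists>ps. distinct (concat ps) \<and> set (concat ps) = {..<n} \<and> E = (\<Union>xs\<in>set ps. path_edges xs)}"

definition same_component :: "graph \<Rightarrow> nat \<Rightarrow> nat \<Rightarrow> bool" where
  "same_component E u v \<longleftrightarrow> (u, v) \<in> {(x, y). {x, y} \<in> E}\<^sup>*"

primrec graph_step :: "operation \<Rightarrow> graph \<Rightarrow> graph" where
  "graph_step (Insert u v) E = insert {u, v} E"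
| "graph_step (Delete u v) E = E - {{u, v}}"
| "graph_step (Connected u v) E = E"

primrec allowed :: "nat \<Rightarrow> graph \<Rightarrow> operation \<Rightarrow> bool" where
  "allowed n E (Insert u v) \<longleftrightarrow> u < n \<and> v < n \<and> u \<noteq> v \<and> {u, v} \<notin> E"
| "allowed n E (Delete u v) \<longleftrightarrow> u < n \<and> v < n \<and> {u, v} \<in> E"
| "allowed n E (Connected u v) \<longleftrightarrow> u < n \<and> v < n"

text \<open>
  Operation sequences which, started from the graph \<open>E\<close>, stay in the class \<open>\<G>\<close> of graphs.
\<close>

primrec admissible :: "nat \<Rightarrow> graph set \<Rightarrow> graph \<Rightarrow> operation list \<Rightarrow> bool" where
  "admissible n \<G> E [] \<longleftrightarrow> E \<in> \<G>"
| "admissible n \<G> E (x # xs) \<longleftrightarrow> E \<in> \<G> \<and> allowed n E x \<and> admissible n \<G> (graph_step x E) xs"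

definition is_query :: "operation \<Rightarrow> bool" where
  "is_query x \<longleftrightarrow> (\<exists>u v. x = Connected u v)"


section \<open>Data structures\<close>

record data_structure =
  random_cells :: "nat set"
  initial_contents :: memory
  insert_prog :: "nat \<Rightarrow> nat \<Rightarrow> unit prog"
  delete_prog :: "nat \<Rightarrow> nat \<Rightarrow> unit prog"
  connected_query :: "nat \<Rightarrow> nat \<Rightarrow> query"

definition wf_structure :: "nat \<Rightarrow> nat \<Rightarrow> data_structure \<Rightarrow> bool" where
  "wf_structure n b D \<longleftrightarrow>
     random_cells D \<subseteq> {..<2 ^ b} \<and>
     (\<forall>a < 2 ^ b. initial_contents D a < 2 ^ b) \<and>
     (\<forall>u < n. \<forall>v < n. wf_prog b (insert_prog D u v) \<and> wf_prog b (delete_prog D u v) \<and>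
        wf_query b (connected_query D u v))"

text \<open>
  The memory at creation: independent uniformly random values in the random cells, and fixed
  contents everywhere else.
\<close>

definition initial_memory :: "nat \<Rightarrow> data_structure \<Rightarrow> memory pmf" where
  "initial_memory b D =
     pmf_of_set {M. (\<forall>a\<in>random_cells D. M a < 2 ^ b) \<and>
                    (\<forall>a. a \<notin> random_cells D \<longrightarrow> M a = initial_contents D a)}"

primrec operation_writes :: "data_structure \<Rightarrow> operation \<Rightarrow> memory \<Rightarrow> (nat \<rightharpoonup> nat)" where
  "operation_writes D (Insert u v) M = writes (insert_prog D u v) M"
| "operation_writes D (Delete u v) M = writes (delete_prog D u v) M"
| "operation_writes D (Connected u v) M = query_writes (connected_query D u v) M"

primrec operation_cost :: "data_structure \<Rightarrow> operation \<Rightarrow> memory \<Rightarrow> ennreal" where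
  "operation_cost D (Insert u v) M = of_nat (probes (insert_prog D u v) M)"
| "operation_cost D (Delete u v) M = of_nat (probes (delete_prog D u v) M)"
| "operation_cost D (Connected u v) M = query_cost (connected_query D u v) M"

definition memory_step :: "data_structure \<Rightarrow> operation \<Rightarrow> memory \<Rightarrow> memory" where
  "memory_step D x M = apply_writes (operation_writes D x M) M"

primrec total_cost :: "data_structure \<Rightarrow> operation list \<Rightarrow> memory \<Rightarrow> ennreal" where
  "total_cost D [] M = 0"
| "total_cost D (x # xs) M = operation_cost D x M + total_cost D xs (memory_step D x M)"

text \<open>
  Every sequence of operations started at creation, with the graph without edges, has expected total
  cost at most \<open>tu\<close> per update plus \<open>tq\<close> per query.
\<close>

definition amortized_expected_time ::
  "nat \<Rightarrow> graph set \<Rightarrow> nat \<Rightarrow> data_structure \<Rightarrow> real \<Rightarrow> real \<Rightarrow> bool" where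
  "amortized_expected_time n \<G> b D tu tq \<longleftrightarrow>
     (\<forall>xs. admissible n \<G> {} xs \<longrightarrow>
        (\<integral>\<^sup>+ M. total_cost D xs M \<partial>measure_pmf (initial_memory b D))
          \<le> ennreal (real (length (filter (\<lambda>x. \<not> is_query x) xs)) * tu +
                      real (length (filter is_query xs)) * tq))"

text \<open>
  Las Vegas: every query made after an admissible sequence of operations is answered correctly,
  for all values of the random cells. Queries may be nondeterministic; a nondeterministic query
  only has to obey the rule on writes in the memory states that can actually arise.
\<close>

definition las_vegas_connectivity ::
  "nat \<Rightarrow> graph set \<Rightarrow> nat \<Rightarrow> data_structure \<Rightarrow> bool" where
  "las_vegas_connectivity n \<G> b D \<longleftrightarrow>
     wf_structure n b D \<and>
     (\<forall>M \<in> set_pmf (initial_memory b D). \<forall>xs u v.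
        admissible n \<G> {} (xs @ [Connected u v]) \<longrightarrow>
        writes_consistent (connected_query D u v) (fold (memory_step D) xs M) \<and>
        (answer (connected_query D u v) (fold (memory_step D) xs M) \<longleftrightarrow>
           same_component (fold graph_step xs {}) u v))"

text \<open>
  Monte Carlo: queries are deterministic, and in every admissible sequence of operations each
  answer is wrong with probability at most \<open>err\<close>.
\<close>

definition monte_carlo_connectivity ::
  "nat \<Rightarrow> graph set \<Rightarrow> nat \<Rightarrow> real \<Rightarrow> data_structure \<Rightarrow> bool" where
  "monte_carlo_connectivity n \<G> b err D \<longleftrightarrow>
     wf_structure n b D \<and>
     (\<forall>u < n. \<forall>v < n. \<exists>p. connected_query D u v = Deterministic p) \<and>
     (\<forall>xs u v. admissible n \<G> {} (xs @ [Connected u v]) \<longrightarrow>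
        measure_pmf.prob (initial_memory b D)
          {M. answer (connected_query D u v) (fold (memory_step D) xs M) \<noteq>
              same_component (fold graph_step xs {}) u v} \<le> err)"

end

theory Submission
  imports Defs
begin

text \<open>
  The vertices form a grid whose consecutive columns are joined by permutations of the rows. An
  operation sequence replaces these permutations by random ones in digit-reversed order and keeps
  verifying compositions of prefixes, so that the queries of every interval of an \<open>r\<close>-ary hierarchy
  of time intervals interleave with the updates of its older siblings, or, when the queries are the
  slow operations, the updates with the queries of the younger siblings. The verified compositions
  determine the permutations, so they must be transported by cells that are written in the first
  interval and read in the second. For verification this holds because the following advice makes
  different worlds distinguishable: for each cell, whether the first interval leaves it unchanged, or
  changes it to a given value, or whether the second interval does not read it. Advice is drawn at
  random, worlds correspond to disjoint events, and a Kraft inequality turns this into a lower bound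
  on the number of transferred cells, up to a term of order \<open>lg r\<close> per probe for the separation of
  cells read from cells written. Each probe is charged to one level only, while there are
  \<open>lg n / lg r\<close> levels; \<open>r\<close> is of the order of the ratio of the two running times.
\<close>

subsection \<open>Cells on which the outcome of a program depends\<close>

text \<open>A nondeterministic query certifies only a yes, by the few cells of one accepting thread;
  a no is a statement about all threads. Hence every query asked has to be true, and its target row
  is computed from the world itself. Two worlds then ask different queries and read different cells,
  so the cells read in one of them do not suffice to simulate the other. This is why the advice must
  also separate cells read from cells written, and why agreement is demanded on the cells read in
  either world. A slot is a whole permutation of m rows, because its log m! bits amount to about log
  m bits per edge; as m is a power of n, this matches the b bits of a cell up to a constant factor.
  The power is kept small compared with the error exponent, since a query counts as reliable only if
  all m candidate rows would be judged correctly, which costs a union bound. Digit reversal spreads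
  the slots of every interval evenly, so that between two consecutive slots updated in the first
  interval a prefix verified in the second one ends. The unknown slots can then be recovered one at
  a time.\<close>

primrec inputs :: "'a prog \<Rightarrow> memory \<Rightarrow> nat set" where
  "inputs (Return x) M = {}"
| "inputs (Read a k) M = insert a (inputs (k (M a)) M)"
| "inputs (Write a w p) M = inputs p (M(a := w)) - {a}"

text \<open>A read of a cell that the program has written itself returns a known value, so only the
  remaining reads can carry information from the initial memory.\<close>

lemma inputs_cong:
  "(\<And>a. a \<in> inputs p M \<Longrightarrow> M a = M' a) \<Longrightarrow> result p M' = result p M \<and> writes p M' = writes p M"
proof (induction p arbitrary: M M')
  case (Read a k)
  have a: "M a = M' a" using Read.prems by simp
  show ?case using Read.IH[of "k (M a)" M M'] Read.prems a by simp
next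
  case (Write a w p)
  show ?case using Write.IH[of "M(a := w)" "M'(a := w)"] Write.prems by (auto simp: fun_upd_def)
qed simp

lemma finite_inputs: "finite (inputs p M)"
  by (induction p arbitrary: M) auto

lemma finite_dom_writes: "finite (dom (writes p M))"
  by (induction p arbitrary: M) auto

text \<open>Each probe adds at most one cell to one of the two sets, so a running time pays for
  reads and writes together.\<close>

lemma card_inputs_writes: "card (inputs p M) + card (dom (writes p M)) \<le> probes p M"
proof (induction p arbitrary: M)
  case (Read a k)
  show ?case using Read.IH[of "k (M a)" M] card_insert_le_m1[of _ "inputs (k (M a)) M" a]
    by (simp add: card_insert_if finite_inputs)
next
  case (Write a w p)
  define N where "N = M(a := w)"
  have "card (inputs p N - {a}) \<le> card (inputs p N)"
    by (rule card_mono) (auto simp: finite_inputs)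
  moreover have "card (dom ([a \<mapsto> w] ++ writes p N)) \<le> Suc (card (dom (writes p N)))"
    by (simp add: card_insert_if finite_dom_writes)
  ultimately show ?case using Write.IH[of N]
    unfolding inputs.simps writes.simps probes.simps N_def[symmetric] by linarith
qed simp

section \<open>Memories and writes that respect the cell size\<close>

definition wf_memory :: "nat \<Rightarrow> memory \<Rightarrow> bool" where
  "wf_memory b M \<longleftrightarrow> (\<forall>a < 2 ^ b. M a < 2 ^ b)"

definition wf_writes :: "nat \<Rightarrow> (nat \<rightharpoonup> nat) \<Rightarrow> bool" where
  "wf_writes b W \<longleftrightarrow> dom W \<subseteq> {..<2 ^ b} \<and> ran W \<subseteq> {..<2 ^ b}"

lemma wf_writes_empty: "wf_writes b Map.empty"
  by (simp add: wf_writes_def)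

lemma wf_writes_add: "wf_writes b W \<Longrightarrow> a < 2 ^ b \<Longrightarrow> w < 2 ^ b \<Longrightarrow> wf_writes b ([a \<mapsto> w] ++ W)"
  unfolding wf_writes_def ran_def dom_def
  by (auto simp: map_add_Some_iff simp del: map_add_None split: if_splits)

lemma wf_memory_apply_writes: "wf_memory b M \<Longrightarrow> wf_writes b W \<Longrightarrow> wf_memory b (apply_writes W M)"
  unfolding wf_memory_def wf_writes_def apply_writes_def
  by (auto split: option.split simp: ran_def)

lemma wf_prog_inputs_writes:
  "wf_prog b p \<Longrightarrow> wf_memory b M \<Longrightarrow> inputs p M \<subseteq> {..<2 ^ b} \<and> wf_writes b (writes p M)"
proof (induction p arbitrary: M)
  case (Return x)
  then show ?case by (simp add: wf_writes_empty)
next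
  case (Read a k)
  then show ?case by (simp add: wf_memory_def)
next
  case (Write a w p)
  define N where "N = M(a := w)"
  have "wf_memory b N" using Write.prems by (simp add: wf_memory_def N_def)
  then have IH: "inputs p N \<subseteq> {..<2 ^ b}" "wf_writes b (writes p N)"
    using Write.IH[of N] Write.prems by simp_all
  have "wf_writes b ([a \<mapsto> w] ++ writes p N)"
    using IH Write.prems by (intro wf_writes_add) auto
  moreover have "inputs p N - {a} \<subseteq> {..<2 ^ b}" using IH(1) by auto
  ultimately show ?case unfolding inputs.simps writes.simps N_def by blast
qed

text \<open>A rejecting nondeterministic query gets the empty set, since rejection depends on all
  threads and is not certified by a few cells. The set therefore determines the outcome only for
  deterministic or accepting queries.\<close>

primrec query_inputs :: "query \<Rightarrow> memory \<Rightarrow> nat set" where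
  "query_inputs (Deterministic p) M = inputs p M"
| "query_inputs (Nondeterministic T) M =
     (if \<exists>p\<in>T. result p M then inputs (SOME p. p \<in> T \<and> result p M) M else {})"

lemma accepting_thread:
  assumes "\<exists>p\<in>T. result p M"
  shows "(SOME p. p \<in> T \<and> result p M) \<in> T" "result (SOME p. p \<in> T \<and> result p M) M"
proof -
  have "\<exists>p. p \<in> T \<and> result p M" using assms by auto
  from someI_ex[OF this]
  show "(SOME p. p \<in> T \<and> result p M) \<in> T" "result (SOME p. p \<in> T \<and> result p M) M" by auto
qed

text \<open>The thread chosen on \<open>M\<close> runs identically on \<open>M'\<close> and accepts
  there too. On \<open>M'\<close> another accepting thread may be the chosen one;
  \<open>writes_consistent q M'\<close> says that it writes the same values.\<close>

lemma query_inputs_cong: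
  assumes agree: "\<And>a. a \<in> query_inputs q M \<Longrightarrow> M a = M' a"
    and M: "(\<exists>p. q = Deterministic p) \<or> answer q M"
    and M': "writes_consistent q M'"
  shows "answer q M' = answer q M \<and> query_writes q M' = query_writes q M"
proof (cases q)
  case (Deterministic p)
  then show ?thesis using inputs_cong[of p M M'] agree by simp
next
  case (Nondeterministic T)
  then have ex: "\<exists>p\<in>T. result p M" using M by simp
  define p where "p = (SOME p. p \<in> T \<and> result p M)"
  note p = accepting_thread[OF ex, folded p_def]
  have *: "result p M' = result p M" "writes p M' = writes p M"
    using inputs_cong[of p M M'] agree ex by (auto simp: Nondeterministic p_def)
  have acc: "result p M'" using p * by simp
  with p(1) have ex': "\<exists>p\<in>T. result p M'" by blast
  define p' where "p' = (SOME p. p \<in> T \<and> result p M')"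
  note p' = accepting_thread[OF ex', folded p'_def]
  have "writes p' M' = writes p M'"
    using M' p(1) p' acc unfolding Nondeterministic writes_consistent.simps by blast
  then show ?thesis using ex ex' * by (simp add: Nondeterministic flip: p_def p'_def)
qed

lemma finite_query_inputs: "finite (query_inputs q M)"
  by (cases q) (auto simp: finite_inputs)

lemma finite_dom_query_writes: "finite (dom (query_writes q M))"
  by (cases q) (auto simp: finite_dom_writes)

lemma card_query_inputs_writes:
  "of_nat (card (query_inputs q M) + card (dom (query_writes q M))) \<le> query_cost q M"
proof (cases q)
  case (Deterministic p)
  then show ?thesis using card_inputs_writes[of p M] by (simp flip: of_nat_add)
next
  case (Nondeterministic T)
  show ?thesis
  proof (cases "\<exists>p\<in>T. result p M")
    case True
    define p where "p = (SOME p. p \<in> T \<and> result p M)"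
    note p = accepting_thread[OF True, folded p_def]
    have "(of_nat (card (inputs p M) + card (dom (writes p M))) :: ennreal) \<le> of_nat (probes p M)"
      using card_inputs_writes[of p M] of_nat_mono by blast
    also have "\<dots> \<le> (SUP p\<in>T. of_nat (probes p M))"
      using p by (intro SUP_upper)
    finally show ?thesis using True by (simp add: Nondeterministic flip: p_def)
  qed (use Nondeterministic in auto)
qed

lemma wf_query_inputs_writes:
  assumes "wf_query b q" "wf_memory b M"
  shows "query_inputs q M \<subseteq> {..<2 ^ b} \<and> wf_writes b (query_writes q M)"
proof (cases q)
  case (Deterministic p)
  then show ?thesis using wf_prog_inputs_writes[of b p M] assms by simp
next
  case (Nondeterministic T)
  show ?thesis
  proof (cases "\<exists>p\<in>T. result p M")
    case True
    define p where "p = (SOME p. p \<in> T \<and> result p M)"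
    note p = accepting_thread[OF True, folded p_def]
    show ?thesis using wf_prog_inputs_writes[of b p M] assms p True
      by (simp add: Nondeterministic flip: p_def)
  qed (use Nondeterministic in \<open>auto simp: wf_writes_empty\<close>)
qed

primrec operation_inputs :: "data_structure \<Rightarrow> operation \<Rightarrow> memory \<Rightarrow> nat set" where
  "operation_inputs D (Insert u v) M = inputs (insert_prog D u v) M"
| "operation_inputs D (Delete u v) M = inputs (delete_prog D u v) M"
| "operation_inputs D (Connected u v) M = query_inputs (connected_query D u v) M"

lemma update_writes_cong:
  assumes "\<And>a. a \<in> operation_inputs D x M \<Longrightarrow> M a = M' a" and "\<not> is_query x"
  shows "operation_writes D x M' = operation_writes D x M"
  using assms inputs_cong[of _ M M'] by (cases x) (auto simp: is_query_def)

lemma finite_operation_inputs: "finite (operation_inputs D x M)"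
  by (cases x) (auto simp: finite_inputs finite_query_inputs)

lemma finite_dom_operation_writes: "finite (dom (operation_writes D x M))"
  by (cases x) (auto simp: finite_dom_writes finite_dom_query_writes)

lemma card_operation_inputs_writes:
  "of_nat (card (operation_inputs D x M) + card (dom (operation_writes D x M))) \<le> operation_cost D x M"
proof (cases x)
  case (Connected u v)
  then show ?thesis using card_query_inputs_writes[of "connected_query D u v" M] by simp
qed (simp_all add: card_inputs_writes del: of_nat_add)

fun endpoints :: "operation \<Rightarrow> nat \<times> nat" where
  "endpoints (Insert u v) = (u, v)"
| "endpoints (Delete u v) = (u, v)"
| "endpoints (Connected u v) = (u, v)"

definition in_range :: "nat \<Rightarrow> operation \<Rightarrow> bool" where
  "in_range n x \<longleftrightarrow> fst (endpoints x) < n \<and> snd (endpoints x) < n"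

lemma wf_operation_inputs_writes:
  assumes "wf_structure n b D" "wf_memory b M" "in_range n x"
  shows "operation_inputs D x M \<subseteq> {..<2 ^ b} \<and> wf_writes b (operation_writes D x M)"
  using assms unfolding wf_structure_def in_range_def
  by (cases x) (simp_all add: wf_prog_inputs_writes wf_query_inputs_writes)

lemma wf_memory_step:
  "wf_structure n b D \<Longrightarrow> wf_memory b M \<Longrightarrow> in_range n x \<Longrightarrow> wf_memory b (memory_step D x M)"
  unfolding memory_step_def by (simp add: wf_memory_apply_writes wf_operation_inputs_writes)

lemma wf_memory_fold:
  assumes "wf_structure n b D"
  shows "\<lbrakk>wf_memory b M; \<And>x. x \<in> set xs \<Longrightarrow> in_range n x\<rbrakk> \<Longrightarrow> wf_memory b (fold (memory_step D) xs M)"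
  by (induction xs arbitrary: M) (auto intro!: wf_memory_step[OF assms])

lemma wf_memory_initial:
  assumes "wf_structure n b D" "M \<in> {M. (\<forall>a\<in>random_cells D. M a < 2 ^ b) \<and>
                    (\<forall>a. a \<notin> random_cells D \<longrightarrow> M a = initial_contents D a)}"
  shows "wf_memory b M"
  using assms unfolding wf_memory_def wf_structure_def by auto


subsection \<open>Cells on which the outcome of a sequence of operations depends\<close>

primrec sequence_inputs :: "data_structure \<Rightarrow> operation list \<Rightarrow> memory \<Rightarrow> nat set" where
  "sequence_inputs D [] M = {}"
| "sequence_inputs D (x # xs) M = operation_inputs D x M \<union>
     (sequence_inputs D xs (memory_step D x M) - dom (operation_writes D x M))"

lemma memory_step_outside: "a \<notin> dom (operation_writes D x M) \<Longrightarrow> memory_step D x M a = M a"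
  by (simp add: memory_step_def apply_writes_def domIff)

text \<open>The two sequences are images of one list and are not assumed to be equal. While they
  coincide they also write the same values, so agreement on the cells still to be read survives each
  step. The second premise turns agreement on the cells of one step into equality of the operations
  there, which drives the induction.\<close>

lemma lockstep:
  assumes "\<And>a. a \<in> sequence_inputs D (map f ls) M \<union> sequence_inputs D (map g ls) M' \<Longrightarrow> M a = M' a"
    and "\<And>k. \<lbrakk>k < length ls; map f (take k ls) = map g (take k ls);
          \<And>a. a \<in> operation_inputs D (f (ls ! k)) (fold (memory_step D) (map f (take k ls)) M) \<union>
                operation_inputs D (g (ls ! k)) (fold (memory_step D) (map g (take k ls)) M') \<Longrightarrow>
            fold (memory_step D) (map f (take k ls)) M a = fold (memory_step D) (map g (take k ls)) M' a\<rbrakk>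
          \<Longrightarrow> f (ls ! k) = g (ls ! k) \<and>
            operation_writes D (f (ls ! k)) (fold (memory_step D) (map f (take k ls)) M) =
            operation_writes D (g (ls ! k)) (fold (memory_step D) (map g (take k ls)) M')"
  shows "map f ls = map g ls"
  using assms
proof (induction ls arbitrary: M M')
  case (Cons l ls)
  have 0: "f l = g l \<and> operation_writes D (f l) M = operation_writes D (g l) M'"
    using Cons.prems(2)[of 0] Cons.prems(1) by (metis (no_types, lifting) Un_iff fold_simps(1) length_greater_0_conv list.map(1) list.distinct(1) list.simps(9) nth_Cons_0 sequence_inputs.simps(2) take0)
  let ?N = "memory_step D (f l) M" and ?N' = "memory_step D (g l) M'"
  have "map f ls = map g ls"
  proof (rule Cons.IH[of ?N ?N'])
    fix a assume a: "a \<in> sequence_inputs D (map f ls) ?N \<union> sequence_inputs D (map g ls) ?N'"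
    show "?N a = ?N' a"
    proof (cases "a \<in> dom (operation_writes D (f l) M)")
      case True
      then show ?thesis using 0 by (auto simp: memory_step_def apply_writes_def)
    next
      case False
      then have "a \<in> sequence_inputs D (map f (l # ls)) M \<union> sequence_inputs D (map g (l # ls)) M'"
        using a conjunct2[OF 0]
        by (metis (no_types, lifting) DiffI False UnCI UnE list.simps(9) sequence_inputs.simps(2))
      then have "M a = M' a" by (rule Cons.prems(1))
      then show ?thesis using False 0 by (metis memory_step_outside)
    qed
  next
    fix k
    assume k: "k < length ls" "map f (take k ls) = map g (take k ls)"
      "\<And>a. a \<in> operation_inputs D (f (ls ! k)) (fold (memory_step D) (map f (take k ls)) ?N) \<union>
                operation_inputs D (g (ls ! k)) (fold (memory_step D) (map g (take k ls)) ?N') \<Longrightarrow>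
            fold (memory_step D) (map f (take k ls)) ?N a = fold (memory_step D) (map g (take k ls)) ?N' a"
    then show "f (ls ! k) = g (ls ! k) \<and>
            operation_writes D (f (ls ! k)) (fold (memory_step D) (map f (take k ls)) ?N) =
            operation_writes D (g (ls ! k)) (fold (memory_step D) (map g (take k ls)) ?N')"
      using 0 by (intro Cons.prems(2)[of "Suc k", unfolded take_Suc_Cons list.map fold_simps nth_Cons_Suc])
        (simp_all del: map_eq_conv)
  qed
  then show ?case using 0 by simp
qed simp

section \<open>Reads and writes by position in a sequence\<close>

definition memory_at :: "data_structure \<Rightarrow> operation list \<Rightarrow> memory \<Rightarrow> nat \<Rightarrow> memory" where
  "memory_at D xs M k = fold (memory_step D) (take k xs) M"

definition inputs_at :: "data_structure \<Rightarrow> operation list \<Rightarrow> memory \<Rightarrow> nat \<Rightarrow> nat set" where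
  "inputs_at D xs M k = operation_inputs D (xs ! k) (memory_at D xs M k)"

definition written_at :: "data_structure \<Rightarrow> operation list \<Rightarrow> memory \<Rightarrow> nat \<Rightarrow> nat set" where
  "written_at D xs M k = dom (operation_writes D (xs ! k) (memory_at D xs M k))"

lemma memory_at_Suc:
  "k < length xs \<Longrightarrow> memory_at D xs M (Suc k) = memory_step D (xs ! k) (memory_at D xs M k)"
  by (simp add: memory_at_def take_Suc_conv_app_nth)

lemma finite_inputs_at: "finite (inputs_at D xs M k)"
  by (simp add: inputs_at_def finite_operation_inputs)

lemma finite_written_at: "finite (written_at D xs M k)"
  by (simp add: written_at_def finite_dom_operation_writes)

lemma sum_card_inputs_written:
  "of_nat (\<Sum>k<length xs. card (inputs_at D xs M k) + card (written_at D xs M k)) \<le> total_cost D xs M"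
proof (induction xs arbitrary: M)
  case (Cons x xs)
  have "(\<Sum>k<length (x # xs). card (inputs_at D (x # xs) M k) + card (written_at D (x # xs) M k)) =
      (card (operation_inputs D x M) + card (dom (operation_writes D x M))) +
      (\<Sum>k<length xs. card (inputs_at D xs (memory_step D x M) k) + card (written_at D xs (memory_step D x M) k))"
    unfolding length_Cons sum.lessThan_Suc_shift
    by (simp add: inputs_at_def written_at_def memory_at_def)
  then show ?case
    using add_mono[OF card_operation_inputs_writes[of D x M] Cons.IH[of "memory_step D x M"]]
    by (simp only: of_nat_add total_cost.simps)
qed simp

lemma memory_at_unchanged:
  assumes "p \<le> q" "q \<le> length xs" "\<And>k. p \<le> k \<Longrightarrow> k < q \<Longrightarrow> a \<notin> written_at D xs M k"
  shows "memory_at D xs M q a = memory_at D xs M p a"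
  using assms
proof (induction q)
  case (Suc q)
  show ?case
  proof (cases "p = Suc q")
    case False
    then have "memory_at D xs M q a = memory_at D xs M p a" using Suc by auto
    moreover have "a \<notin> written_at D xs M q" using Suc.prems False by auto
    ultimately show ?thesis using Suc.prems
      by (simp add: memory_at_Suc memory_step_outside written_at_def)
  qed simp
qed simp

lemma sequence_inputs_imp_read:
  assumes "a \<in> sequence_inputs D xs M"
  shows "\<exists>k<length xs. a \<in> inputs_at D xs M k \<and> (\<forall>i<k. a \<notin> written_at D xs M i)"
  using assms
proof (induction xs arbitrary: M)
  case (Cons x xs)
  show ?case
  proof (cases "a \<in> operation_inputs D x M")
    case True
    then show ?thesis by (auto simp: inputs_at_def memory_at_def intro!: exI[of _ 0])
  next
    case False
    then have a: "a \<in> sequence_inputs D xs (memory_step D x M)" "a \<notin> dom (operation_writes D x M)"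
      using Cons.prems by auto
    from Cons.IH[OF a(1)] obtain k where k: "k < length xs" "a \<in> inputs_at D xs (memory_step D x M) k"
      "\<forall>i<k. a \<notin> written_at D xs (memory_step D x M) i" by auto
    have "\<forall>i<Suc k. a \<notin> written_at D (x # xs) M i"
      using k a by (auto simp: less_Suc_eq_0_disj written_at_def memory_at_def)
    then show ?thesis using k by (intro exI[of _ "Suc k"]) (auto simp: inputs_at_def memory_at_def)
  qed
qed simp

section \<open>Flow of information from one interval into the next\<close>

definition interval_inputs :: "data_structure \<Rightarrow> operation list \<Rightarrow> memory \<Rightarrow> nat \<Rightarrow> nat \<Rightarrow> nat set" where
  "interval_inputs D xs M q e = sequence_inputs D (drop q (take e xs)) (memory_at D xs M q)"

text \<open>Contents are compared, not writes: a cell overwritten with its old value counts as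
  unchanged, so that one code of the advice can stand for "still the old content".\<close>

definition changed :: "data_structure \<Rightarrow> operation list \<Rightarrow> memory \<Rightarrow> nat \<Rightarrow> nat \<Rightarrow> nat set" where
  "changed D xs M p q = {a. memory_at D xs M q a \<noteq> memory_at D xs M p a}"

lemma memory_at_drop:
  assumes "q \<le> e" "e \<le> length xs" "k \<le> e - q"
  shows "memory_at D (drop q (take e xs)) (memory_at D xs M q) k = memory_at D xs M (q + k)"
proof -
  have "take (q + k) xs = take q xs @ take k (drop q (take e xs))"
    unfolding take_add drop_take take_take using assms by (simp add: min_absorb1)
  then show ?thesis by (simp add: memory_at_def)
qed

lemma interval_inputs_imp_read:
  assumes "a \<in> interval_inputs D xs M q e" "q \<le> e" "e \<le> length xs"
  shows "\<exists>k. q \<le> k \<and> k < e \<and> a \<in> inputs_at D xs M k \<and> (\<forall>i. q \<le> i \<and> i < k \<longrightarrow> a \<notin> written_at D xs M i)"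
proof -
  let ?ys = "drop q (take e xs)" and ?N = "memory_at D xs M q"
  from sequence_inputs_imp_read[OF assms(1)[unfolded interval_inputs_def]]
  obtain k where k: "k < e - q" "a \<in> inputs_at D ?ys ?N k" "\<forall>i<k. a \<notin> written_at D ?ys ?N i"
    using assms by auto
  have eq: "inputs_at D ?ys ?N i = inputs_at D xs M (q + i)" "written_at D ?ys ?N i = written_at D xs M (q + i)"
    if "i \<le> k" for i
    using that k assms by (auto simp: inputs_at_def written_at_def memory_at_drop)
  have "\<forall>i. q \<le> i \<and> i < q + k \<longrightarrow> a \<notin> written_at D xs M i"
  proof (intro allI impI)
    fix i assume i: "q \<le> i \<and> i < q + k"
    then have "a \<notin> written_at D ?ys ?N (i - q)" using k by auto
    then show "a \<notin> written_at D xs M i" using eq(2)[of "i - q"] i by auto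
  qed
  then show ?thesis using k eq(1)[of k] by (intro exI[of _ "q + k"]) auto
qed

lemma interval_inputs_subset:
  assumes "q \<le> e" "e \<le> length xs"
  shows "interval_inputs D xs M q e \<subseteq> (\<Union>k\<in>{q..<e}. inputs_at D xs M k)"
  using interval_inputs_imp_read[OF _ assms] by fastforce

lemma changed_subset:
  assumes "p \<le> q" "q \<le> length xs"
  shows "changed D xs M p q \<subseteq> (\<Union>k\<in>{p..<q}. written_at D xs M k)"
  using memory_at_unchanged[OF assms] unfolding changed_def by fastforce

lemma card_interval_inputs:
  assumes "q \<le> e" "e \<le> length xs"
  shows "card (interval_inputs D xs M q e) \<le> (\<Sum>k\<in>{q..<e}. card (inputs_at D xs M k))"
proof -
  have "card (interval_inputs D xs M q e) \<le> card (\<Union>k\<in>{q..<e}. inputs_at D xs M k)"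
    by (intro card_mono interval_inputs_subset assms) (auto simp: finite_inputs_at)
  then show ?thesis using card_UN_le[of "{q..<e}" "inputs_at D xs M"] by simp
qed

lemma card_changed:
  assumes "p \<le> q" "q \<le> length xs"
  shows "card (changed D xs M p q) \<le> (\<Sum>k\<in>{p..<q}. card (written_at D xs M k))"
proof -
  have "card (changed D xs M p q) \<le> card (\<Union>k\<in>{p..<q}. written_at D xs M k)"
    by (intro card_mono changed_subset assms) (auto simp: finite_written_at)
  then show ?thesis using card_UN_le[of "{p..<q}" "written_at D xs M"] by simp
qed

text \<open>The last write of a cell before a reading step, together with that step, is a point in
  the plane of pairs of times; the two intervals span a rectangle of such points.\<close>

definition transfers :: "data_structure \<Rightarrow> operation list \<Rightarrow> memory \<Rightarrow> nat \<Rightarrow> nat \<Rightarrow> nat \<Rightarrow> (nat \<times> nat) set" where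
  "transfers D xs M p q e = {(k, a). q \<le> k \<and> k < e \<and> a \<in> inputs_at D xs M k \<and>
     (\<exists>s. p \<le> s \<and> s < q \<and> a \<in> written_at D xs M s \<and> (\<forall>i. s < i \<and> i < k \<longrightarrow> a \<notin> written_at D xs M i))}"

lemma card_information_transfer:
  assumes "p \<le> q" "q \<le> e" "e \<le> length xs"
  shows "card (changed D xs M p q \<inter> interval_inputs D xs M q e) \<le> card (transfers D xs M p q e)"
proof -
  have sub: "transfers D xs M p q e \<subseteq> Sigma {q..<e} (inputs_at D xs M)"
    by (auto simp: transfers_def)
  have fin: "finite (transfers D xs M p q e)"
    by (rule finite_subset[OF sub]) (auto simp: finite_inputs_at)
  have "changed D xs M p q \<inter> interval_inputs D xs M q e \<subseteq> snd ` transfers D xs M p q e"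
  proof
    fix a assume a: "a \<in> changed D xs M p q \<inter> interval_inputs D xs M q e"
    from interval_inputs_imp_read[of a D xs M q e] a assms
    obtain k where k: "q \<le> k" "k < e" "a \<in> inputs_at D xs M k"
      "\<forall>i. q \<le> i \<and> i < k \<longrightarrow> a \<notin> written_at D xs M i" by auto
    let ?S = "{s. p \<le> s \<and> s < q \<and> a \<in> written_at D xs M s}"
    have "a \<in> (\<Union>k\<in>{p..<q}. written_at D xs M k)"
      using a assms by (intro subsetD[OF changed_subset]) auto
    then have S: "finite ?S" "?S \<noteq> {}" by auto
    \<comment> \<open>The last write in the first interval is also the last one before step
      \<open>k\<close>, because the second interval reads the cell before writing to it.\<close>
    define s where "s = Max ?S"
    have s: "s \<in> ?S" "\<And>i. i \<in> ?S \<Longrightarrow> i \<le> s" unfolding s_def using S Max_in Max_ge by blast+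
    have "a \<notin> written_at D xs M i" if "s < i" "i < k" for i
      using s(2)[of i] k(4) that s(1) by (cases "i < q") auto
    then have "(k, a) \<in> transfers D xs M p q e"
      unfolding transfers_def using k s(1) by blast
    then show "a \<in> snd ` transfers D xs M p q e" by force
  qed
  then have "card (changed D xs M p q \<inter> interval_inputs D xs M q e) \<le> card (snd ` transfers D xs M p q e)"
    by (intro card_mono) (auto intro: fin)
  also have "\<dots> \<le> card (transfers D xs M p q e)" by (rule card_image_le[OF fin])
  finally show ?thesis .
qed

text \<open>Each read is charged to at most one rectangle, since the last preceding write is unique.\<close>

lemma sum_card_transfers:
  assumes fin: "finite F"
    and le: "\<And>\<phi>. \<phi> \<in> F \<Longrightarrow> e \<phi> \<le> length xs"
    and disj: "\<And>\<phi> \<psi> s k. \<lbrakk>\<phi> \<in> F; \<psi> \<in> F; p \<phi> \<le> s; s < q \<phi>; q \<phi> \<le> k; k < e \<phi>;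
        p \<psi> \<le> s; s < q \<psi>; q \<psi> \<le> k; k < e \<psi>\<rbrakk> \<Longrightarrow> \<phi> = \<psi>"
  shows "(\<Sum>\<phi>\<in>F. card (transfers D xs M (p \<phi>) (q \<phi>) (e \<phi>))) \<le> (\<Sum>k<length xs. card (inputs_at D xs M k))"
proof -
  let ?T = "\<lambda>\<phi>. transfers D xs M (p \<phi>) (q \<phi>) (e \<phi>)"
  let ?S = "Sigma {..<length xs} (inputs_at D xs M)"
  have sub: "?T \<phi> \<subseteq> ?S" if "\<phi> \<in> F" for \<phi>
    using le[OF that] by (auto simp: transfers_def)
  have finS: "finite ?S" by (auto simp: finite_inputs_at)
  have "?T \<phi> \<inter> ?T \<psi> = {}" if F: "\<phi> \<in> F" "\<psi> \<in> F" and ne: "\<phi> \<noteq> \<psi>" for \<phi> \<psi>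
  proof (rule ccontr)
    assume "?T \<phi> \<inter> ?T \<psi> \<noteq> {}"
    then obtain k a where 1: "(k, a) \<in> ?T \<phi>" and 2: "(k, a) \<in> ?T \<psi>" by auto
    from 1 obtain s where s: "p \<phi> \<le> s" "s < q \<phi>" "a \<in> written_at D xs M s"
      "\<forall>i. s < i \<and> i < k \<longrightarrow> a \<notin> written_at D xs M i" "q \<phi> \<le> k" "k < e \<phi>"
      unfolding transfers_def by blast
    from 2 obtain s' where s': "p \<psi> \<le> s'" "s' < q \<psi>" "a \<in> written_at D xs M s'"
      "\<forall>i. s' < i \<and> i < k \<longrightarrow> a \<notin> written_at D xs M i" "q \<psi> \<le> k" "k < e \<psi>"
      unfolding transfers_def by blast
    have "s' < k" "s < k" using s s' by linarith+
    have "s = s'"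
    proof (rule ccontr)
      assume "s \<noteq> s'"
      then consider "s < s'" | "s' < s" by linarith
      then show False using s(3,4) s'(3,4) \<open>s < k\<close> \<open>s' < k\<close> by cases blast+
    qed
    then show False using disj[of \<phi> \<psi> s k] s s' F ne by blast
  qed
  then have "(\<Sum>\<phi>\<in>F. card (?T \<phi>)) = card (\<Union>\<phi>\<in>F. ?T \<phi>)"
    by (intro card_UN_disjoint[symmetric] ballI impI fin finite_subset[OF sub finS])
  also have "\<dots> \<le> card ?S" using sub finS by (intro card_mono) auto
  also have "\<dots> = (\<Sum>k<length xs. card (inputs_at D xs M k))" by (simp add: finite_inputs_at)
  finally show ?thesis .
qed

subsection \<open>A Kraft inequality for random advice\<close>

text \<open>If the coordinates are drawn independently with weights \<open>w\<close>, a box has as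
  probability the product of its one-dimensional sums, and disjoint boxes have total probability at
  most 1.\<close>

lemma kraft_boxes:
  fixes w :: "'i \<Rightarrow> 'v \<Rightarrow> real"
  assumes I: "finite I" and V: "\<And>i. i \<in> I \<Longrightarrow> finite (V i)"
    and w: "\<And>i v. i \<in> I \<Longrightarrow> v \<in> V i \<Longrightarrow> 0 \<le> w i v" "\<And>i. i \<in> I \<Longrightarrow> (\<Sum>v\<in>V i. w i v) \<le> 1"
    and Y: "finite Y" and B: "\<And>y i. y \<in> Y \<Longrightarrow> i \<in> I \<Longrightarrow> B y i \<subseteq> V i"
    and disj: "\<And>y y'. \<lbrakk>y \<in> Y; y' \<in> Y; y \<noteq> y'\<rbrakk> \<Longrightarrow> \<exists>i\<in>I. B y i \<inter> B y' i = {}"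
  shows "(\<Sum>y\<in>Y. \<Prod>i\<in>I. \<Sum>v\<in>B y i. w i v) \<le> 1"
proof -
  have finB: "finite (B y i)" if "y \<in> Y" "i \<in> I" for y i
    using B[OF that] V[OF that(2)] finite_subset by blast
  have "(\<Sum>y\<in>Y. \<Prod>i\<in>I. \<Sum>v\<in>B y i. w i v) = (\<Sum>y\<in>Y. \<Sum>g\<in>PiE I (B y). \<Prod>i\<in>I. w i (g i))"
    by (intro sum.cong refl prod_sum_PiE I finB)
  also have "\<dots> = (\<Sum>g\<in>(\<Union>y\<in>Y. PiE I (B y)). \<Prod>i\<in>I. w i (g i))"
  proof (rule sum.UNION_disjoint[symmetric, OF Y])
    show "\<forall>y\<in>Y. finite (PiE I (B y))" by (auto intro!: finite_PiE I finB)
    show "\<forall>y\<in>Y. \<forall>y'\<in>Y. y \<noteq> y' \<longrightarrow> PiE I (B y) \<inter> PiE I (B y') = {}"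
    proof (intro ballI impI)
      fix y y' assume y: "y \<in> Y" "y' \<in> Y" "y \<noteq> y'"
      obtain i where i: "i \<in> I" "B y i \<inter> B y' i = {}" using disj[OF y] by blast
      then show "PiE I (B y) \<inter> PiE I (B y') = {}"
        using PiE_mem[of _ I "B y" i] PiE_mem[of _ I "B y'" i] by blast
    qed
  qed
  also have "\<dots> \<le> (\<Sum>g\<in>PiE I V. \<Prod>i\<in>I. w i (g i))"
  proof (rule sum_mono2)
    show "finite (PiE I V)" by (intro finite_PiE I V)
    show "(\<Union>y\<in>Y. PiE I (B y)) \<subseteq> PiE I V" using B by (intro UN_least PiE_mono) auto
    show "0 \<le> (\<Prod>i\<in>I. w i (g i))" if "g \<in> PiE I V - (\<Union>y\<in>Y. PiE I (B y))" for g
      using that by (intro prod_nonneg w) (auto dest: PiE_mem)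
  qed
  also have "\<dots> = (\<Prod>i\<in>I. \<Sum>v\<in>V i. w i v)"
    by (rule prod_sum_PiE[symmetric, OF I V])
  also have "\<dots> \<le> 1" using w by (intro prod_le_1 conjI sum_nonneg) auto
  finally show ?thesis .
qed

text \<open>Jensen's inequality for the logarithm in the form \<open>ln y \<le> y - 1\<close>, taken
  at \<open>y = N / S * 2 powr (- cost x)\<close>; the right-hand sides then sum to at most
  0.\<close>

lemma sum_ge_of_kraft:
  fixes cost :: "'x \<Rightarrow> real"
  assumes X: "finite X" "X \<noteq> {}" and S: "(\<Sum>x\<in>X. 2 powr (- cost x)) \<le> S"
  shows "card X * log 2 (card X / S) \<le> (\<Sum>x\<in>X. cost x)"
proof -
  let ?N = "real (card X)"
  have N: "?N > 0" using X by (simp add: card_gt_0_iff)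
  have "0 < (\<Sum>x\<in>X. 2 powr (- cost x))" using X by (intro sum_pos) auto
  then have S0: "S > 0" using S by linarith
  have "ln (?N / S) - cost x * ln 2 \<le> ?N / S * 2 powr (- cost x) - 1" for x
  proof -
    have "ln (?N / S * 2 powr (- cost x)) \<le> ?N / S * 2 powr (- cost x) - 1"
      using N S0 by (intro ln_le_minus_one) simp
    moreover have "ln (?N / S * 2 powr (- cost x)) = ln (?N / S) + ln (2 powr (- cost x))"
      using N S0 by (intro ln_mult_pos) simp_all
    ultimately show ?thesis by simp
  qed
  then have "(\<Sum>x\<in>X. ln (?N / S) - cost x * ln 2) \<le> (\<Sum>x\<in>X. ?N / S * 2 powr (- cost x) - 1)"
    by (intro sum_mono)
  also have "\<dots> = ?N / S * (\<Sum>x\<in>X. 2 powr (- cost x)) - ?N"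
    by (simp add: sum_subtractf sum_distrib_left)
  also have "\<dots> \<le> ?N / S * S - ?N" using S S0 N by (intro diff_right_mono mult_left_mono) auto
  also have "\<dots> = 0" using S0 by simp
  finally have "?N * ln (?N / S) \<le> (\<Sum>x\<in>X. cost x) * ln 2"
    by (simp add: sum_subtractf sum_distrib_right)
  then show ?thesis by (simp add: log_def field_simps)
qed

text \<open>The value \<open>\<rho> x\<close> is the part of a world that is known in advance. Kraft
  holds among worlds with equal known part, and adding it up over the known parts gives
  \<open>S = card P\<close>; the logarithm is the entropy that remains.\<close>

lemma sum_cost_ge:
  fixes cost :: "'x \<Rightarrow> real"
  assumes X: "finite X" "X \<noteq> {}" and P: "\<rho> ` X \<subseteq> P" "finite P"
    and fib: "\<And>r. r \<in> P \<Longrightarrow> (\<Sum>x\<in>{x\<in>X. \<rho> x = r}. 2 powr (- cost x)) \<le> 1"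
  shows "card X * log 2 (card X / card P) \<le> (\<Sum>x\<in>X. cost x)"
proof (rule sum_ge_of_kraft[OF X])
  have "(\<Sum>x\<in>X. 2 powr (- cost x)) = (\<Sum>r\<in>P. \<Sum>x\<in>{x\<in>X. \<rho> x = r}. 2 powr (- cost x))"
    using sum.group[OF X(1) P(2) P(1), of "\<lambda>x. 2 powr (- cost x)"] by simp
  also have "\<dots> \<le> (\<Sum>r\<in>P. 1)" by (intro sum_mono fib)
  finally show "(\<Sum>x\<in>X. 2 powr (- cost x)) \<le> real (card P)" by simp
qed

text \<open>The constant rounds up 2 / ln 2: the natural logarithm costs at most 2 * y, and ln 2 is
  at least 2/3.\<close>

lemma neg_log_one_minus_le:
  fixes y :: real
  assumes "0 \<le> y" "y \<le> 1 / 2"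
  shows "- log 2 (1 - y) \<le> 3 * y"
proof -
  have "- y - 2 * y\<^sup>2 \<le> ln (1 - y)" by (rule ln_one_minus_pos_lower_bound[OF assms])
  moreover have "2 * y\<^sup>2 \<le> y" using assms mult_left_mono[of y "1/2" y] by (simp add: power2_eq_square)
  ultimately have "- ln (1 - y) \<le> 2 * y" by linarith
  also have "2 * y \<le> 3 * y * ln 2" using assms ln2_ge_two_thirds mult_left_mono[of "2/3" "ln 2" "3*y"] by simp
  finally show ?thesis by (simp add: log_def field_simps)
qed

text \<open>
  The advice says for each cell whether it is unchanged (code 0), must not be read (code 1), or
  changed to the value \<open>v\<close> (code \<open>v + 2\<close>), and for each query whether its answers are
  reliable (code 0) or which one is correct (code \<open>v + 1\<close>). Each world is compatible with a box of
  advice, and the boxes of different worlds are disjoint by \<open>sep\<close>.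
\<close>

lemma kraft_worlds:
  fixes p0 p1 :: real and content :: "'x \<Rightarrow> nat \<Rightarrow> nat" and bad :: "'x \<Rightarrow> nat set"
  assumes b: "b \<ge> 1" and m: "m \<ge> (2::nat)" and p: "0 < p0" "0 < p1" "p0 + p1 = 1 - 1 / 2 ^ b"
    and Y: "finite Y" and Q: "finite Q"
    and W: "\<And>y. y \<in> Y \<Longrightarrow> W y = {c. content y c \<noteq> old c}"
    and sub: "\<And>y. y \<in> Y \<Longrightarrow> W y \<subseteq> {..<2 ^ b}" "\<And>y. y \<in> Y \<Longrightarrow> R y \<subseteq> {..<2 ^ b}"
    and content: "\<And>y c. y \<in> Y \<Longrightarrow> c < 2 ^ b \<Longrightarrow> content y c < 2 ^ b"
    and bad: "\<And>y. y \<in> Y \<Longrightarrow> bad y \<subseteq> Q" "\<And>y k. y \<in> Y \<Longrightarrow> k \<in> bad y \<Longrightarrow> val y k < m"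
    and sep: "\<And>y y'. \<lbrakk>y \<in> Y; y' \<in> Y; \<And>c. c \<in> R y \<union> R y' \<Longrightarrow> content y c = content y' c;
        bad y = bad y'; \<And>k. k \<in> bad y \<Longrightarrow> val y k = val y' k\<rbrakk> \<Longrightarrow> y = y'"
  defines "cost \<equiv> \<lambda>y. 2 * real b * card (W y \<inter> R y) + (- log 2 p0) * card (R y) + (- log 2 p1) * card (W y)
     + 3 + 2 * log 2 m * card (bad y) + 3 / m * card Q"
  shows "(\<Sum>y\<in>Y. 2 powr (- cost y)) \<le> 1"
proof -
  let ?n = "2 ^ b :: nat"
  define I where "I = Inl ` {..<?n} \<union> Inr ` Q"
  define V where "V i = (case i of Inl c \<Rightarrow> {..<?n + 2} | Inr (k::nat) \<Rightarrow> {..m})" for i :: "nat + nat"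
  \<comment> \<open>The 2 ^ b value codes of a cell have total weight 2 ^ b / 2 ^ (2 * b) = 1 / 2 ^
    b, exactly what \<open>p0 + p1\<close> leaves. Likewise the m codes of weight 1 / m ^ 2 for a
    query complete 1 - 1 / m.\<close>
  define w where "w i v = (case i of Inl c \<Rightarrow> (if v = 0 then p0 else if v = 1 then p1 else 1 / 2 ^ (2 * b))
      | Inr (k::nat) \<Rightarrow> (if v = 0 then 1 - 1 / m else 1 / m ^ 2))" for i :: "nat + nat" and v :: nat
  \<comment> \<open>A cell neither read nor changed admits both 0 and 1 and is nearly free, which
    matters because there are 2 ^ b cells. The box of a read cell is a singleton and never contains
    1.\<close>
  define B where "B y i = (case i of
        Inl c \<Rightarrow> (if c \<in> R y then (if c \<in> W y then {content y c + 2} else {0})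
                  else (if c \<in> W y then {1} else {0, 1}))
      | Inr k \<Rightarrow> (if k \<in> bad y then {val y k + 1} else {0}))" for y and i :: "nat + nat"
  have kraft: "(\<Sum>y\<in>Y. \<Prod>i\<in>I. \<Sum>v\<in>B y i. w i v) \<le> 1"
  proof (rule kraft_boxes[where V = V])
    show "finite I" using Q by (simp add: I_def)
    show "finite (V i)" for i by (cases i) (auto simp: V_def)
    show "0 \<le> w i v" for i v using p m by (cases i) (auto simp: w_def)
    show "(\<Sum>v\<in>V i. w i v) \<le> 1" for i
    proof (cases i)
      case (Inl c)
      have V: "V i = insert 0 (insert 1 ((\<lambda>v. v + 2) ` {..<?n}))"
      proof -
        have "v \<in> (\<lambda>v. v + 2) ` {..<?n}" if "v \<noteq> 0" "v \<noteq> 1" "v < ?n + 2" for v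
          using that by (intro image_eqI[of _ _ "v - 2"]) auto
        then show ?thesis by (auto simp: V_def Inl)
      qed
      have "(\<Sum>v\<in>V i. w i v) = p0 + (p1 + (\<Sum>v<?n. w i (v + 2)))"
        unfolding V by (simp add: sum.reindex inj_on_def w_def Inl image_iff)
      also have "(\<Sum>v<?n. w i (v + 2)) = 1 / 2 ^ b"
        by (simp add: w_def Inl mult_2 power_add)
      finally show ?thesis using p by simp
    next
      case (Inr k)
      have "(\<Sum>v\<in>V i. w i v) = w i 0 + (\<Sum>v<m. w i (Suc v))"
        unfolding V_def Inr sum.case by (simp add: sum.atMost_shift)
      also have "\<dots> = 1" using m by (simp add: w_def Inr power2_eq_square)
      finally show ?thesis by simp
    qed
    show "finite Y" by (rule Y)
    show "B y i \<subseteq> V i" if "y \<in> Y" "i \<in> I" for y i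
      using that content[of y] bad(2)[of y]
      by (auto simp: I_def B_def V_def Suc_le_eq less_SucI split: if_splits)
    show "\<exists>i\<in>I. B y i \<inter> B y' i = {}" if y: "y \<in> Y" "y' \<in> Y" "y \<noteq> y'" for y y'
    proof (rule ccontr)
      assume "\<not> ?thesis"
      then have meet: "B y i \<inter> B y' i \<noteq> {}" if "i \<in> I" for i using that by blast
      \<comment> \<open>The box of a cell in \<open>R z\<close> is a singleton. If it holds a value
        code, the other world must have the same value; if it holds 0, the other box contains 0 and
        hence that world leaves the cell unchanged as well.\<close>
      have eq: "content z c = content z' c" if z: "z \<in> Y" "z' \<in> Y" "c \<in> R z" "B z (Inl c) \<inter> B z' (Inl c) \<noteq> {}" for z z' c
        using z W by (auto simp: B_def split: if_splits)
      have "content y c = content y' c" if "c \<in> R y \<union> R y'" for c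
      proof -
        have "c < ?n" using that sub y by auto
        then have "B y (Inl c) \<inter> B y' (Inl c) \<noteq> {}" by (intro meet) (auto simp: I_def)
        then show ?thesis
          using eq[of y y' c] eq[of y' y c] that y Int_commute[of "B y (Inl c)" "B y' (Inl c)"] by auto
      qed
      moreover have Qs: "(k \<in> bad y \<longleftrightarrow> k \<in> bad y') \<and> (k \<in> bad y \<longrightarrow> val y k = val y' k)" if "k \<in> Q" for k
        using meet[of "Inr k"] that by (auto simp: B_def I_def split: if_splits)
      moreover have "bad y = bad y'" using Qs bad(1) y by blast
      ultimately show False using sep[of y y'] y bad(1) by blast
    qed
  qed
  have "(\<Sum>y\<in>Y. 2 powr (- cost y)) \<le> (\<Sum>y\<in>Y. \<Prod>i\<in>I. \<Sum>v\<in>B y i. w i v)"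
  proof (rule sum_mono)
    fix y assume y: "y \<in> Y"
    define L where "L i = - log 2 (\<Sum>v\<in>B y i. w i v)" for i
    have pos: "0 < (\<Sum>v\<in>B y i. w i v)" for i
      using p m b one_less_power[of "2::real" b] by (cases i) (auto simp: B_def w_def)
    have "log 2 p0 \<le> 0" "log 2 p1 \<le> 0"
      using p by (auto simp: log_le_zero_cancel_iff) (smt (verit) divide_pos_pos zero_less_power)+
    \<comment> \<open>A cell outside both sets has probability \<open>p0 + p1\<close> and costs at
      most 3 / 2 ^ b bits. Over all 2 ^ b cells this is the summand 3 of
      \<open>cost\<close>.\<close>
    then have Lc: "L (Inl c) \<le> (if c \<in> W y \<inter> R y then 2 * real b else 0) + (if c \<in> R y then - log 2 p0 else 0)
        + (if c \<in> W y then - log 2 p1 else 0) + 3 / 2 ^ b" for c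
    proof -
      define \<epsilon> where "\<epsilon> = (3::real) / 2 ^ b"
      have "\<epsilon> \<ge> 0" by (simp add: \<epsilon>_def)
      moreover have "- log 2 (1 / 2 ^ (2 * b)) = 2 * real b"
        by (simp add: log_divide log_nat_power)
      moreover have "- log 2 (p0 + p1) \<le> \<epsilon>"
        unfolding p(3) \<epsilon>_def using neg_log_one_minus_le[of "1 / 2 ^ b"] b self_le_power[of "2::real" b]
        by (simp add: field_simps)
      ultimately show ?thesis using \<open>log 2 p0 \<le> 0\<close> \<open>log 2 p1 \<le> 0\<close>
        unfolding \<epsilon>_def[symmetric] by (auto simp: L_def B_def w_def)
    qed
    have Lk: "L (Inr k) \<le> (if k \<in> bad y then 2 * log 2 m else 0) + 3 / m" for k
    proof -
      have "- log 2 (1 / m ^ 2) = 2 * log 2 m" using m by (simp add: log_divide log_nat_power)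
      moreover have "- log 2 (1 - 1 / m) \<le> 3 / m"
        using neg_log_one_minus_le[of "1 / m"] m by (simp add: field_simps)
      ultimately show ?thesis using m by (auto simp: L_def B_def w_def)
    qed
    have "(\<Sum>i\<in>I. L i) = (\<Sum>c<?n. L (Inl c)) + (\<Sum>k\<in>Q. L (Inr k))"
      unfolding I_def using Q by (subst sum.union_disjoint) (auto simp: sum.reindex)
    also have "\<dots> \<le> (\<Sum>c<?n. (if c \<in> W y \<inter> R y then 2 * real b else 0) + (if c \<in> R y then - log 2 p0 else 0)
        + (if c \<in> W y then - log 2 p1 else 0) + 3 / 2 ^ b) + (\<Sum>k\<in>Q. (if k \<in> bad y then 2 * log 2 m else 0) + 3 / m)"
      by (intro add_mono sum_mono Lc Lk)
    also have "\<dots> = (\<Sum>c<?n. if c \<in> W y \<inter> R y then 2 * real b else 0) + (\<Sum>c<?n. if c \<in> R y then - log 2 p0 else 0)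
        + (\<Sum>c<?n. if c \<in> W y then - log 2 p1 else 0) + 3 + (\<Sum>k\<in>Q. if k \<in> bad y then 2 * log 2 m else 0) + 3 / m * card Q"
      by (simp add: sum.distrib)
    also have "(\<Sum>c<?n. if c \<in> W y \<inter> R y then 2 * real b else 0) = 2 * real b * card (W y \<inter> R y)"
      using sub y by (subst sum.inter_restrict[symmetric]) (auto simp: Int_absorb1 subset_iff)
    also have "(\<Sum>c<?n. if c \<in> R y then - log 2 p0 else 0) = (- log 2 p0) * card (R y)"
      using sub y by (subst sum.inter_restrict[symmetric]) (auto simp: Int_absorb1)
    also have "(\<Sum>c<?n. if c \<in> W y then - log 2 p1 else 0) = (- log 2 p1) * card (W y)"
      using sub y by (subst sum.inter_restrict[symmetric]) (auto simp: Int_absorb1)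
    also have "(\<Sum>k\<in>Q. if k \<in> bad y then 2 * log 2 m else 0) = 2 * log 2 m * card (bad y)"
      using bad y Q by (subst sum.inter_restrict[symmetric]) (auto simp: Int_absorb1)
    finally have "(\<Sum>i\<in>I. L i) \<le> cost y" unfolding cost_def .
    then have "2 powr (- cost y) \<le> 2 powr (\<Sum>i\<in>I. - L i)"
      by (simp add: sum_negf)
    also have "\<dots> = (\<Prod>i\<in>I. 2 powr (- L i))"
      by (rule powr_sum) (use Q in \<open>auto simp: I_def\<close>)
    also have "\<dots> = (\<Prod>i\<in>I. \<Sum>v\<in>B y i. w i v)"
      using pos by (simp add: L_def)
    finally show "2 powr (- cost y) \<le> (\<Prod>i\<in>I. \<Sum>v\<in>B y i. w i v)" .
  qed
  then show ?thesis using kraft by linarith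
qed

subsection \<open>Layered permutation graphs\<close>

lemma path_edges_Cons_Cons: "path_edges (x # y # zs) = insert {x, y} (path_edges (y # zs))"
proof (intro equalityI subsetI)
  fix e assume "e \<in> path_edges (x # y # zs)"
  then obtain i where i: "Suc i < length (x # y # zs)" "e = {(x # y # zs) ! i, (x # y # zs) ! Suc i}"
    unfolding path_edges_def by blast
  show "e \<in> insert {x, y} (path_edges (y # zs))"
  proof (cases i)
    case (Suc j)
    then have "Suc j < length (y # zs)" "e = {(y # zs) ! j, (y # zs) ! Suc j}" using i by auto
    then show ?thesis unfolding path_edges_def by blast
  qed (use i in simp)
next
  fix e assume "e \<in> insert {x, y} (path_edges (y # zs))"
  then consider "e = {x, y}" | i where "Suc i < length (y # zs)" "e = {(y # zs) ! i, (y # zs) ! Suc i}"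
    unfolding path_edges_def by blast
  then show "e \<in> path_edges (x # y # zs)"
  proof cases
    case 1
    then show ?thesis unfolding path_edges_def by (intro CollectI exI[of _ 0]) simp
  next
    case (2 i)
    then show ?thesis unfolding path_edges_def by (intro CollectI exI[of _ "Suc i"]) simp
  qed
qed

lemma path_edges_singleton: "path_edges [x] = {}"
  by (simp add: path_edges_def)

text \<open>The vertices are added in decreasing order, each one in front of the path that starts with its successor.\<close>

lemma increasing_injection_path_cover:
  fixes f :: "nat \<rightharpoonup> nat"
  assumes inc: "\<And>u v. f u = Some v \<Longrightarrow> u < v \<and> v < n"
    and inj: "\<And>u u' v. f u = Some v \<Longrightarrow> f u' = Some v \<Longrightarrow> u = u'"
    and "v \<le> n"
  shows "\<exists>ps. distinct (concat ps) \<and> [] \<notin> set ps \<and> set (concat ps) = {v..<n} \<and>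
     (\<Union>xs\<in>set ps. path_edges xs) = {{u, w} | u w. v \<le> u \<and> f u = Some w} \<and>
     (\<forall>w\<in>{v..<n}. (\<forall>u\<ge>v. f u \<noteq> Some w) \<longrightarrow> (\<exists>xs\<in>set ps. hd xs = w))"
  using \<open>v \<le> n\<close>
proof (induction v rule: inc_induct)
  case base
  show ?case using inc by (intro exI[of _ "[]"]) (auto simp: linorder_not_le dest: leD less_trans)
next
  case (step v)
  obtain ps where ps: "distinct (concat ps)" "[] \<notin> set ps" "set (concat ps) = {Suc v..<n}"
    and edges: "(\<Union>xs\<in>set ps. path_edges xs) = {{u, w} | u w. Suc v \<le> u \<and> f u = Some w}"
    and hds: "\<And>w. w \<in> {Suc v..<n} \<Longrightarrow> (\<forall>u\<ge>Suc v. f u \<noteq> Some w) \<Longrightarrow> \<exists>xs\<in>set ps. hd xs = w"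
    using step.IH by metis
  have iv: "{v..<n} = insert v {Suc v..<n}" using step.hyps by auto
  have vn: "v \<notin> set (concat ps)" unfolding ps(3) by simp
  show ?case
  proof (cases "f v")
    case None
    have ed: "{{u, w} | u w. v \<le> u \<and> f u = Some w} = {{u, w} | u w. Suc v \<le> u \<and> f u = Some w}"
      using None by (metis (no_types, opaque_lifting) Suc_leD Suc_leI option.distinct(1) order_le_less)
    have "\<exists>xs\<in>set ([v] # ps). hd xs = w" if w: "w \<in> {v..<n}" "\<forall>u\<ge>v. f u \<noteq> Some w" for w
      using hds[of w] w iv by (cases "w = v") auto
    then show ?thesis using ps vn edges unfolding ed
      by (intro exI[of _ "[v] # ps"]) (simp add: path_edges_singleton iv)
  next
    case (Some w)
    have w: "w \<in> {Suc v..<n}" using inc[OF Some] by auto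
    \<comment> \<open>By injectivity no vertex after \<open>v\<close> points to \<open>w\<close>, so
      \<open>w\<close> still heads its path and \<open>v\<close> can be put in front of it.\<close>
    have "\<forall>u\<ge>Suc v. f u \<noteq> Some w" using inj[OF Some] by (metis Suc_n_not_le_n)
    from hds[OF w this] obtain xs where xs: "xs \<in> set ps" "hd xs = w" by blast
    then obtain zs where zs: "xs = w # zs" using ps(2) by (metis list.exhaust_sel)
    from xs(1) obtain as bs where pss: "ps = as @ xs # bs" by (meson split_list)
    let ?ps = "as @ (v # xs) # bs"
    have A: "{{u, w} | u w. v \<le> u \<and> f u = Some w} = insert {v, w} {{u, w} | u w. Suc v \<le> u \<and> f u = Some w}"
    proof (intro equalityI subsetI)
      fix e assume "e \<in> {{u, w} | u w. v \<le> u \<and> f u = Some w}"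
      then obtain u w' where "e = {u, w'}" "v \<le> u" "f u = Some w'" by auto
      then show "e \<in> insert {v, w} {{u, w} | u w. Suc v \<le> u \<and> f u = Some w}"
        using Some by (cases "u = v") auto
    next
      fix e assume "e \<in> insert {v, w} {{u, w} | u w. Suc v \<le> u \<and> f u = Some w}"
      then show "e \<in> {{u, w} | u w. v \<le> u \<and> f u = Some w}"
        using Some Suc_leD by blast
    qed
    have B: "(\<Union>xs\<in>set ?ps. path_edges xs) = insert {v, w} (\<Union>xs\<in>set ps. path_edges xs)"
      unfolding pss zs by (auto simp: path_edges_Cons_Cons)
    have C: "\<exists>ys\<in>set ?ps. hd ys = y" if y: "y \<in> {v..<n}" "\<forall>u\<ge>v. f u \<noteq> Some y" for y
    proof (cases "y = v")
      case False
      then obtain ys where ys: "ys \<in> set ps" "hd ys = y" using hds[of y] y iv by auto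
      have "y \<noteq> w" using y(2) Some by auto
      then show ?thesis using ys xs unfolding pss by auto
    qed auto
    have D: "distinct (concat ?ps)" "[] \<notin> set ?ps"
      using ps(1,2) vn unfolding pss by auto
    have E: "set (concat ?ps) = {v..<n}"
      using ps(3) unfolding pss iv by auto
    have F: "(\<Union>xs\<in>set ?ps. path_edges xs) = {{u, w} | u w. v \<le> u \<and> f u = Some w}"
      unfolding A B edges ..
    show ?thesis by (intro exI[of _ ?ps] conjI ballI impI D E F C)
  qed
qed

lemma path_unions_of_increasing_injection:
  fixes f :: "nat \<rightharpoonup> nat"
  assumes "\<And>u v. f u = Some v \<Longrightarrow> u < v \<and> v < n"
    and "\<And>u u' v. f u = Some v \<Longrightarrow> f u' = Some v \<Longrightarrow> u = u'"
  shows "{{u, v} | u v. f u = Some v} \<in> path_unions n"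
proof -
  obtain ps where "distinct (concat ps)" "set (concat ps) = {0..<n}"
    "(\<Union>xs\<in>set ps. path_edges xs) = {{u, w} | u w. 0 \<le> u \<and> f u = Some w}"
    using increasing_injection_path_cover[of f n 0] assms by auto
  then show ?thesis unfolding path_unions_def
    by (intro CollectI exI[of _ ps]) (simp add: atLeast0LessThan)
qed

lemma path_unions_subset_simple_graphs: "path_unions n \<subseteq> simple_graphs n"
proof
  fix E assume "E \<in> path_unions n"
  then obtain ps where ps: "distinct (concat ps)" "set (concat ps) = {..<n}" "E = (\<Union>xs\<in>set ps. path_edges xs)"
    unfolding path_unions_def by auto
  show "E \<in> simple_graphs n" unfolding simple_graphs_def
  proof (intro CollectI ballI)
    fix e assume "e \<in> E"
    then obtain xs i where xs: "xs \<in> set ps" and i: "Suc i < length xs" "e = {xs ! i, xs ! Suc i}"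
      using ps(3) unfolding path_edges_def by blast
    have "distinct xs" using ps(1) xs by (simp add: distinct_concat_iff)
    then have "xs ! i \<noteq> xs ! Suc i" using i by (simp add: nth_eq_iff_index_eq)
    moreover have "set xs \<subseteq> {..<n}" using ps(2) xs by auto
    then have "xs ! i < n" "xs ! Suc i < n"
      using i(1) subsetD[OF _ nth_mem[of i xs]] subsetD[OF _ nth_mem[of "Suc i" xs]] by auto
    ultimately show "\<exists>u v. u < n \<and> v < n \<and> u \<noteq> v \<and> e = {u, v}" using i by blast
  qed
qed

lemma admissible_mono: "admissible n G E xs \<Longrightarrow> G \<subseteq> H \<Longrightarrow> admissible n H E xs"
  by (induction xs arbitrary: E) auto

lemma admissible_append:
  "admissible n G E (xs @ ys) \<longleftrightarrow> admissible n G E xs \<and> admissible n G (fold graph_step xs E) ys"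
  by (induction xs arbitrary: E) (auto, (case_tac ys; simp)+)

lemma admissible_final: "admissible n G E xs \<Longrightarrow> fold graph_step xs E \<in> G"
  by (induction xs arbitrary: E) auto

section \<open>Grids whose columns are joined by partial injections\<close>

definition grid_vertex :: "nat \<Rightarrow> nat \<Rightarrow> nat \<Rightarrow> nat" where
  "grid_vertex m i u = i * m + u"

definition layered_graph :: "nat \<Rightarrow> nat \<Rightarrow> (nat \<Rightarrow> nat \<rightharpoonup> nat) \<Rightarrow> graph" where
  "layered_graph m K s =
     {{grid_vertex m i u, grid_vertex m (Suc i) v} | i u v. i < K \<and> u < m \<and> s i u = Some v}"

text \<open>The maps are partial because an update removes all edges of a slot before it inserts the
  new ones, and the graph has to be a union of paths after every single operation.\<close>

definition partial_injections :: "nat \<Rightarrow> (nat \<Rightarrow> nat \<rightharpoonup> nat) \<Rightarrow> bool" where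
  "partial_injections m s \<longleftrightarrow> (\<forall>i u v. s i u = Some v \<longrightarrow> v < m) \<and>
     (\<forall>i u u' v. u < m \<longrightarrow> u' < m \<longrightarrow> s i u = Some v \<longrightarrow> s i u' = Some v \<longrightarrow> u = u')"

lemma grid_vertex_eq_iff:
  "u < m \<Longrightarrow> v < m \<Longrightarrow> grid_vertex m i u = grid_vertex m j v \<longleftrightarrow> i = j \<and> u = v"
proof -
  assume "u < m" "v < m"
  then have "grid_vertex m i u div m = i" "grid_vertex m i u mod m = u"
     "grid_vertex m j v div m = j" "grid_vertex m j v mod m = v" by (auto simp: grid_vertex_def)
  then show ?thesis by metis
qed

lemma grid_vertex_less: "i \<le> K \<Longrightarrow> u < m \<Longrightarrow> (K + 1) * m \<le> n \<Longrightarrow> grid_vertex m i u < n"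
proof -
  assume a: "i \<le> K" "u < m" "(K + 1) * m \<le> n"
  have "i * m + u < (i + 1) * m" using a by simp
  also have "\<dots> \<le> (K + 1) * m" using a by (intro mult_right_mono) auto
  finally show ?thesis using a by (simp add: grid_vertex_def)
qed

text \<open>Vertex numbers grow from column to column, so the edges form an increasing injection.
  Numbers beyond the grid are isolated vertices.\<close>

lemma layered_graph_path_unions:
  assumes s: "partial_injections m s" and n: "(K + 1) * m \<le> n"
  shows "layered_graph m K s \<in> path_unions n"
proof (cases "m = 0")
  case True
  then have "layered_graph m K s = {{u, v} | u v. (\<lambda>_. None :: nat option) u = Some v}"
    by (auto simp: layered_graph_def)
  then show ?thesis using path_unions_of_increasing_injection[of "\<lambda>_. None" n] by simp
next
  case False
  define f where "f x = (if x div m < K then map_option (grid_vertex m (Suc (x div m))) (s (x div m) (x mod m)) else None)" for x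
  have f: "f x = Some y \<longleftrightarrow> (\<exists>i u v. i < K \<and> u < m \<and> s i u = Some v \<and> x = grid_vertex m i u \<and> y = grid_vertex m (Suc i) v)" for x y
  proof
    assume "f x = Some y"
    then show "\<exists>i u v. i < K \<and> u < m \<and> s i u = Some v \<and> x = grid_vertex m i u \<and> y = grid_vertex m (Suc i) v"
      using False by (fastforce simp: f_def grid_vertex_def split: if_splits
        intro: exI[of _ "x div m"] exI[of _ "x mod m"])
  next
    assume "\<exists>i u v. i < K \<and> u < m \<and> s i u = Some v \<and> x = grid_vertex m i u \<and> y = grid_vertex m (Suc i) v"
    then obtain i u v where *: "i < K" "u < m" "s i u = Some v" "x = grid_vertex m i u" "y = grid_vertex m (Suc i) v"
      by blast
    then have "x div m = i" "x mod m = u" by (auto simp: grid_vertex_def)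
    then show "f x = Some y" using * by (simp add: f_def)
  qed
  have vm: "v < m" if "s i u = Some v" for i u v using s that by (auto simp: partial_injections_def)
  have "layered_graph m K s = {{x, y} | x y. f x = Some y}"
    unfolding layered_graph_def f by blast
  moreover have "{{x, y} | x y. f x = Some y} \<in> path_unions n"
  proof (rule path_unions_of_increasing_injection)
    fix x y assume "f x = Some y"
    then obtain i u v where *: "i < K" "u < m" "s i u = Some v" "x = grid_vertex m i u" "y = grid_vertex m (Suc i) v"
      unfolding f by blast
    have "x < y" using * by (simp add: grid_vertex_def)
    moreover have "y < n" using * vm n by (auto intro!: grid_vertex_less[of "Suc i" K])
    ultimately show "x < y \<and> y < n" by simp
  next
    fix x x' y assume "f x = Some y" "f x' = Some y"
    then obtain i u v i' u' v' where *: "u < m" "s i u = Some v" "x = grid_vertex m i u" "y = grid_vertex m (Suc i) v"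
      "u' < m" "s i' u' = Some v'" "x' = grid_vertex m i' u'" "y = grid_vertex m (Suc i') v'"
      unfolding f by blast
    then have "i = i' \<and> v = v'" using grid_vertex_eq_iff[of v m v' "Suc i" "Suc i'"] vm by auto
    then have "u = u'" using * s unfolding partial_injections_def by metis
    then show "x = x'" using * \<open>i = i' \<and> v = v'\<close> by simp
  qed
  ultimately show ?thesis by simp
qed

primrec column_map :: "(nat \<Rightarrow> nat \<Rightarrow> nat) \<Rightarrow> nat \<Rightarrow> nat \<Rightarrow> nat" where
  "column_map s 0 = id"
| "column_map s (Suc q) = s q \<circ> column_map s q"

lemma column_map_permutes: "(\<And>i. i < q \<Longrightarrow> s i permutes {..<m}) \<Longrightarrow> column_map s q permutes {..<m}"
  by (induction q) (auto simp: permutes_id intro: permutes_compose)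

text \<open>The component of a vertex of column 0 is a path that meets each column once, in the row
  given by \<open>column_map\<close>. A step back to an earlier column stays on it because the slots
  are injective.\<close>

lemma same_component_layered_graph:
  assumes perm: "\<And>i. i < K \<Longrightarrow> s i permutes {..<m}" and q: "q \<le> K" and u: "u < m" and v: "v < m"
  shows "same_component (layered_graph m K (\<lambda>i u. Some (s i u))) (grid_vertex m 0 u) (grid_vertex m q v)
    \<longleftrightarrow> v = column_map s q u"
proof -
  let ?E = "layered_graph m K (\<lambda>i u. Some (s i u))"
  let ?R = "{(x, y). {x, y} \<in> ?E}"
  have cm: "column_map s i permutes {..<m}" if "i \<le> K" for i
    using that perm by (intro column_map_permutes) auto
  have sm: "s i w < m" if "i < K" "w < m" for i w
    using permutes_in_image[OF perm[OF that(1)], of w] that by simp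
  have reach: "(grid_vertex m 0 u, grid_vertex m i (column_map s i u)) \<in> ?R\<^sup>*" if "i \<le> K" for i
    using that
  proof (induction i)
    case (Suc i)
    have "column_map s i u < m" using permutes_in_image[OF cm[of i], of u] Suc.prems u by simp
    then have "(grid_vertex m i (column_map s i u), grid_vertex m (Suc i) (column_map s (Suc i) u)) \<in> ?R"
      using Suc.prems unfolding layered_graph_def by fastforce
    then show ?case using Suc by (meson Suc_leD rtrancl.rtrancl_into_rtrancl)
  qed simp
  have inv: "\<exists>i\<le>K. y = grid_vertex m i (column_map s i u)" if "(grid_vertex m 0 u, y) \<in> ?R\<^sup>*" for y
    using that
  proof (induction rule: rtrancl_induct)
    case base
    show ?case by (intro exI[of _ 0]) simp
  next
    case (step y z)
    then obtain i where i: "i \<le> K" "y = grid_vertex m i (column_map s i u)" by blast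
    have cu: "column_map s i u < m" using permutes_in_image[OF cm[OF i(1)], of u] u by simp
    from step(2) obtain j w where j: "j < K" "w < m" "{y, z} = {grid_vertex m j w, grid_vertex m (Suc j) (s j w)}"
      unfolding layered_graph_def by auto
    from j(3) consider "y = grid_vertex m j w" "z = grid_vertex m (Suc j) (s j w)"
      | "z = grid_vertex m j w" "y = grid_vertex m (Suc j) (s j w)" by (auto simp: doubleton_eq_iff)
    then show ?case
    proof cases
      case 1
      then have "i = j" "column_map s i u = w" using i cu j grid_vertex_eq_iff by metis+
      then show ?thesis using 1 j by (intro exI[of _ "Suc j"]) auto
    next
      case 2
      then have ij: "i = Suc j" "column_map s i u = s j w" using i cu sm[OF j(1,2)] grid_vertex_eq_iff by metis+
      then have "s j (column_map s j u) = s j w" by simp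
      then have "column_map s j u = w" using permutes_inj[OF perm[OF j(1)]] by (simp add: inj_eq)
      then show ?thesis using 2 j by (intro exI[of _ j]) auto
    qed
  qed
  show ?thesis unfolding same_component_def
  proof
    assume "(grid_vertex m 0 u, grid_vertex m q v) \<in> ?R\<^sup>*"
    from inv[OF this] obtain i where i: "i \<le> K" "grid_vertex m q v = grid_vertex m i (column_map s i u)" by blast
    have "column_map s i u < m" using permutes_in_image[OF cm[OF i(1)], of u] u by simp
    then show "v = column_map s q u" using grid_vertex_eq_iff[OF v] i(2) by metis
  next
    assume "v = column_map s q u"
    then show "(grid_vertex m 0 u, grid_vertex m q v) \<in> ?R\<^sup>*" using reach[OF q] by simp
  qed
qed

subsection \<open>The hard operation sequences\<close>

lemma layered_graph_cong:
  "(\<And>i u. i < K \<Longrightarrow> u < m \<Longrightarrow> s i u = s' i u) \<Longrightarrow> layered_graph m K s = layered_graph m K s'"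
  unfolding layered_graph_def by (metis (no_types, lifting))

lemma insert_layered:
  assumes s: "partial_injections m s" and i: "i < K" "u < m" "v < m" and n: "(K + 1) * m \<le> n"
    and new: "s i u = None" "\<And>u'. u' < m \<Longrightarrow> s i u' \<noteq> Some v"
  defines "x \<equiv> Insert (grid_vertex m i u) (grid_vertex m (Suc i) v)" and "s' \<equiv> s(i := (s i)(u \<mapsto> v))"
  shows "admissible n (path_unions n) (layered_graph m K s) [x]"
    and "graph_step x (layered_graph m K s) = layered_graph m K s'"
    and "partial_injections m s'"
proof -
  show s': "partial_injections m s'"
    using s i new unfolding partial_injections_def s'_def by (auto split: if_splits)
  have eq: "{grid_vertex m j w, grid_vertex m (Suc j) w'} = {grid_vertex m i u, grid_vertex m (Suc i) v} \<longleftrightarrow>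
      j = i \<and> w = u \<and> w' = v" if "w < m" "w' < m" for j w w'
    using that i by (auto simp: doubleton_eq_iff grid_vertex_eq_iff)
  have vm: "w' < m" if "s j w = Some w'" for j w w' using s that by (auto simp: partial_injections_def)
  show step: "graph_step x (layered_graph m K s) = layered_graph m K s'"
  proof (intro equalityI subsetI)
    fix e assume "e \<in> graph_step x (layered_graph m K s)"
    then consider "e = {grid_vertex m i u, grid_vertex m (Suc i) v}" | j w w' where
      "e = {grid_vertex m j w, grid_vertex m (Suc j) w'}" "j < K" "w < m" "s j w = Some w'"
      by (auto simp: x_def layered_graph_def)
    then show "e \<in> layered_graph m K s'"
    proof cases
      case 1
      then show ?thesis using i unfolding layered_graph_def s'_def
        by (intro CollectI exI[of _ i] exI[of _ u] exI[of _ v]) simp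
    next
      case (2 j w w')
      then have "s' j w = Some w'" using new by (auto simp: s'_def)
      then show ?thesis using 2 unfolding layered_graph_def by blast
    qed
  next
    fix e assume "e \<in> layered_graph m K s'"
    then obtain j w w' where *: "e = {grid_vertex m j w, grid_vertex m (Suc j) w'}" "j < K" "w < m" "s' j w = Some w'"
      by (auto simp: layered_graph_def)
    show "e \<in> graph_step x (layered_graph m K s)"
    proof (cases "j = i \<and> w = u")
      case True
      then show ?thesis using * by (simp add: x_def s'_def)
    next
      case False
      then have "s j w = Some w'" using * by (auto simp: s'_def split: if_splits)
      then show ?thesis using * unfolding x_def layered_graph_def by auto
    qed
  qed
  have "{grid_vertex m i u, grid_vertex m (Suc i) v} \<notin> layered_graph m K s"
  proof
    assume "{grid_vertex m i u, grid_vertex m (Suc i) v} \<in> layered_graph m K s"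
    then obtain j w w' where *: "{grid_vertex m j w, grid_vertex m (Suc j) w'} = {grid_vertex m i u, grid_vertex m (Suc i) v}"
       "j < K" "w < m" "s j w = Some w'" unfolding layered_graph_def by force
    then show False using eq[OF *(3) vm[OF *(4)]] new by auto
  qed
  then show "admissible n (path_unions n) (layered_graph m K s) [x]"
    using step layered_graph_path_unions[OF s n] layered_graph_path_unions[OF s' n] i n
      grid_vertex_less[of i K u m n] grid_vertex_less[of "Suc i" K v m n]
    by (auto simp: x_def grid_vertex_eq_iff)
qed

lemma delete_layered:
  assumes s: "partial_injections m s" and i: "i < K" "u < m" and n: "(K + 1) * m \<le> n" and old: "s i u = Some v"
  defines "x \<equiv> Delete (grid_vertex m i u) (grid_vertex m (Suc i) v)" and "s' \<equiv> s(i := (s i)(u := None))"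
  shows "admissible n (path_unions n) (layered_graph m K s) [x]"
    and "graph_step x (layered_graph m K s) = layered_graph m K s'"
    and "partial_injections m s'"
proof -
  show s': "partial_injections m s'"
    using s unfolding partial_injections_def s'_def by (auto split: if_splits)
  have v: "v < m" using s old by (auto simp: partial_injections_def)
  have eq: "{grid_vertex m j w, grid_vertex m (Suc j) w'} = {grid_vertex m i u, grid_vertex m (Suc i) v} \<longleftrightarrow>
      j = i \<and> w = u \<and> w' = v" if "w < m" "w' < m" for j w w'
    using that i v by (auto simp: doubleton_eq_iff grid_vertex_eq_iff)
  have vm: "w' < m" if "s j w = Some w'" for j w w' using s that by (auto simp: partial_injections_def)
  show step: "graph_step x (layered_graph m K s) = layered_graph m K s'"
  proof (intro equalityI subsetI)
    fix e assume "e \<in> graph_step x (layered_graph m K s)"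
    then obtain j w w' where *: "e = {grid_vertex m j w, grid_vertex m (Suc j) w'}" "j < K" "w < m" "s j w = Some w'"
      "e \<noteq> {grid_vertex m i u, grid_vertex m (Suc i) v}"
      by (auto simp: x_def layered_graph_def)
    then have "\<not> (j = i \<and> w = u)" using old by auto
    then have "s' j w = Some w'" using * by (auto simp: s'_def)
    then show "e \<in> layered_graph m K s'" using * unfolding layered_graph_def by blast
  next
    fix e assume "e \<in> layered_graph m K s'"
    then obtain j w w' where *: "e = {grid_vertex m j w, grid_vertex m (Suc j) w'}" "j < K" "w < m" "s' j w = Some w'"
      by (auto simp: layered_graph_def)
    then have ne: "\<not> (j = i \<and> w = u)" "s j w = Some w'" by (auto simp: s'_def split: if_splits)
    then have "e \<noteq> {grid_vertex m i u, grid_vertex m (Suc i) v}" using eq[OF *(3) vm[OF ne(2)]] * by auto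
    then show "e \<in> graph_step x (layered_graph m K s)" using * ne unfolding x_def layered_graph_def by auto
  qed
  have "{grid_vertex m i u, grid_vertex m (Suc i) v} \<in> layered_graph m K s"
    using i old unfolding layered_graph_def by blast
  then show "admissible n (path_unions n) (layered_graph m K s) [x]"
    using step layered_graph_path_unions[OF s n] layered_graph_path_unions[OF s' n] i n v
      grid_vertex_less[of i K u m n] grid_vertex_less[of "Suc i" K v m n]
    by (auto simp: x_def)
qed

lemma insert_column:
  assumes s: "partial_injections m s" and i: "i < K" and n: "(K + 1) * m \<le> n"
    and new: "\<And>u. u < m \<Longrightarrow> s i u = None" and perm: "\<sigma> permutes {..<m}" and "j \<le> m"
  defines "xs \<equiv> \<lambda>j. map (\<lambda>u. Insert (grid_vertex m i u) (grid_vertex m (Suc i) (\<sigma> u))) [0..<j]"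
    and "s' \<equiv> \<lambda>j. s(i := (\<lambda>u. if u < j then Some (\<sigma> u) else s i u))"
  shows "admissible n (path_unions n) (layered_graph m K s) (xs j) \<and>
     fold graph_step (xs j) (layered_graph m K s) = layered_graph m K (s' j) \<and> partial_injections m (s' j)"
  using \<open>j \<le> m\<close>
proof (induction j)
  case 0
  then show ?case using layered_graph_path_unions[OF s n] s by (simp add: xs_def s'_def)
next
  case (Suc j)
  then have IH: "admissible n (path_unions n) (layered_graph m K s) (xs j)"
    "fold graph_step (xs j) (layered_graph m K s) = layered_graph m K (s' j)" "partial_injections m (s' j)" by auto
  let ?x = "Insert (grid_vertex m i j) (grid_vertex m (Suc i) (\<sigma> j))"
  have xs: "xs (Suc j) = xs j @ [?x]" by (simp add: xs_def)
  have jm: "j < m" "\<sigma> j < m" using Suc.prems permutes_in_image[OF perm, of j] by auto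
  have "s' j i j = None" using new jm by (simp add: s'_def)
  moreover have "s' j i u \<noteq> Some (\<sigma> j)" if "u < m" for u
    using that new permutes_inj[OF perm] by (auto simp: s'_def inj_eq)
  ultimately have ins: "admissible n (path_unions n) (layered_graph m K (s' j)) [?x]"
    "graph_step ?x (layered_graph m K (s' j)) = layered_graph m K ((s' j)(i := (s' j i)(j \<mapsto> \<sigma> j)))"
    "partial_injections m ((s' j)(i := (s' j i)(j \<mapsto> \<sigma> j)))"
    using insert_layered[OF IH(3) i jm n] by blast+
  have "(s' j)(i := (s' j i)(j \<mapsto> \<sigma> j)) = s' (Suc j)" by (auto simp: s'_def fun_eq_iff)
  then show ?case using ins IH unfolding xs admissible_append fold_append
    by (simp del: admissible.simps)
qed

lemma delete_column:
  assumes s: "partial_injections m s" and i: "i < K" and n: "(K + 1) * m \<le> n"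
    and old: "\<And>u. u < m \<Longrightarrow> s i u = Some u" and "j \<le> m"
  defines "xs \<equiv> \<lambda>j. map (\<lambda>u. Delete (grid_vertex m i u) (grid_vertex m (Suc i) u)) [0..<j]"
    and "s' \<equiv> \<lambda>j. s(i := (\<lambda>u. if u < j then None else s i u))"
  shows "admissible n (path_unions n) (layered_graph m K s) (xs j) \<and>
     fold graph_step (xs j) (layered_graph m K s) = layered_graph m K (s' j) \<and> partial_injections m (s' j)"
  using \<open>j \<le> m\<close>
proof (induction j)
  case 0
  then show ?case using layered_graph_path_unions[OF s n] s by (simp add: xs_def s'_def)
next
  case (Suc j)
  then have IH: "admissible n (path_unions n) (layered_graph m K s) (xs j)"
    "fold graph_step (xs j) (layered_graph m K s) = layered_graph m K (s' j)" "partial_injections m (s' j)" by auto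
  let ?x = "Delete (grid_vertex m i j) (grid_vertex m (Suc i) j)"
  have xs: "xs (Suc j) = xs j @ [?x]" by (simp add: xs_def)
  have jm: "j < m" using Suc.prems by auto
  have "s' j i j = Some j" using old jm by (simp add: s'_def)
  then have del: "admissible n (path_unions n) (layered_graph m K (s' j)) [?x]"
    "graph_step ?x (layered_graph m K (s' j)) = layered_graph m K ((s' j)(i := (s' j i)(j := None)))"
    "partial_injections m ((s' j)(i := (s' j i)(j := None)))"
    using delete_layered[OF IH(3) i jm n] by blast+
  have "(s' j)(i := (s' j i)(j := None)) = s' (Suc j)" by (auto simp: s'_def fun_eq_iff)
  then show ?case using del IH unfolding xs admissible_append fold_append
    by (simp del: admissible.simps)
qed

lemma admissible_queries:
  assumes "E \<in> G" "\<And>u. u \<in> set us \<Longrightarrow> f u < n \<and> g u < n"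
  shows "admissible n G E (map (\<lambda>u. Connected (f u) (g u)) us)"
  using assms by (induction us) auto

lemma fold_graph_step_queries: "(\<And>x. x \<in> set xs \<Longrightarrow> is_query x) \<Longrightarrow> fold graph_step xs E = E"
proof (induction xs)
  case (Cons x xs)
  obtain u v where "x = Connected u v" using Cons.prems[of x] by (auto simp: is_query_def)
  then show ?case using Cons by simp
qed simp

text \<open>
  The edges of a slot \<open>i\<close> realise a permutation from column \<open>i\<close> to column \<open>i + 1\<close>. At time \<open>t\<close>,
  the slot \<open>upd t\<close> changes from the identity to the permutation given by the world, and then
  the composition of the slots before \<open>qry t\<close> is verified.
\<close>

datatype label = Del nat nat | Ins nat nat | Qry nat nat nat

definition full_layers :: "nat \<Rightarrow> (nat \<Rightarrow> nat \<Rightarrow> nat) \<Rightarrow> nat \<Rightarrow> nat \<rightharpoonup> nat" where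
  "full_layers m s i u = (if u < m then Some (s i u) else None)"

lemma partial_injections_full_layers:
  assumes "\<And>i. s i permutes {..<m}"
  shows "partial_injections m (full_layers m s)"
proof -
  have "s i u < m \<longleftrightarrow> u < m" for i u using permutes_in_image[OF assms, of i u] by simp
  moreover have "s i u = s i v \<longleftrightarrow> u = v" for i u v using permutes_inj[OF assms, of i] by (simp add: inj_eq)
  ultimately show ?thesis unfolding partial_injections_def full_layers_def by (auto split: if_splits)
qed

lemma layered_graph_full_layers:
  "layered_graph m K (full_layers m s) = layered_graph m K (\<lambda>i u. Some (s i u))"
  by (rule layered_graph_cong) (simp add: full_layers_def)

text \<open>The two regimes differ in \<open>upd\<close> and \<open>qry\<close> only, so operation
  sequences are studied for an arbitrary schedule. A slot is updated at most once and holds the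
  identity before that.\<close>

locale schedule =
  fixes n m K :: nat and upd qry :: "nat \<Rightarrow> nat option"
  assumes room: "(K + 1) * m \<le> n" and m: "m \<ge> 2"
    and upd_less: "\<And>t i. upd t = Some i \<Longrightarrow> i < K"
    and upd_inj: "\<And>t t' i. upd t = Some i \<Longrightarrow> upd t' = Some i \<Longrightarrow> t = t'"
    and qry_le: "\<And>t q. qry t = Some q \<Longrightarrow> q \<le> K"
begin

definition worlds :: "(nat \<Rightarrow> nat \<Rightarrow> nat) set" where
  "worlds = ({..<K} \<rightarrow>\<^sub>E {\<sigma>. \<sigma> permutes {..<m}})"

definition slots_done :: "nat \<Rightarrow> nat set" where
  "slots_done t = {i. \<exists>t'<t. upd t' = Some i}"

definition state :: "(nat \<Rightarrow> nat \<Rightarrow> nat) \<Rightarrow> nat \<Rightarrow> nat \<Rightarrow> nat \<Rightarrow> nat" where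
  "state x t i = (if i \<in> slots_done t then x i else id)"

text \<open>Labels are the same in all worlds and only their interpretation depends on the world,
  which is the form required by \<open>lockstep\<close>. The target row of a query is the true one
  at that moment, so every query asked has the answer yes.\<close>

primrec op :: "(nat \<Rightarrow> nat \<Rightarrow> nat) \<Rightarrow> label \<Rightarrow> operation" where
  "op x (Del i u) = Delete (grid_vertex m i u) (grid_vertex m (Suc i) u)"
| "op x (Ins i u) = Insert (grid_vertex m i u) (grid_vertex m (Suc i) (x i u))"
| "op x (Qry t q u) = Connected (grid_vertex m 0 u) (grid_vertex m q (column_map (state x (Suc t)) q u))"

definition update_labels :: "nat \<Rightarrow> label list" where
  "update_labels t = (case upd t of None \<Rightarrow> [] | Some i \<Rightarrow> map (Del i) [0..<m] @ map (Ins i) [0..<m])"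

definition query_labels :: "nat \<Rightarrow> label list" where
  "query_labels t = (case qry t of None \<Rightarrow> [] | Some q \<Rightarrow> map (Qry t q) [0..<m])"

primrec labels :: "nat \<Rightarrow> label list" where
  "labels 0 = []"
| "labels (Suc t) = labels t @ update_labels t @ query_labels t"

definition preamble :: "operation list" where
  "preamble = concat (map (\<lambda>i. map (\<lambda>u. Insert (grid_vertex m i u) (grid_vertex m (Suc i) u)) [0..<m]) [0..<K])"

lemma finite_worlds: "finite worlds"
  unfolding worlds_def by (intro finite_PiE finite_permutations) auto

lemma worlds_permutes: "x \<in> worlds \<Longrightarrow> i < K \<Longrightarrow> x i permutes {..<m}"
  by (auto simp: worlds_def PiE_iff)

lemma state_permutes: "x \<in> worlds \<Longrightarrow> state x t i permutes {..<m}"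
  using upd_less by (auto simp: state_def slots_done_def permutes_id intro!: worlds_permutes)

lemma preamble_correct:
  "admissible n (path_unions n) {} preamble \<and> fold graph_step preamble {} = layered_graph m K (full_layers m (\<lambda>_. id))"
proof -
  define s where "s i = (\<lambda>j u. if j < i \<and> u < m then Some u else None)" for i :: nat
  define xs where "xs i = concat (map (\<lambda>i. map (\<lambda>u. Insert (grid_vertex m i u) (grid_vertex m (Suc i) u)) [0..<m]) [0..<i])" for i
  have "admissible n (path_unions n) {} (xs i) \<and> fold graph_step (xs i) {} = layered_graph m K (s i) \<and> partial_injections m (s i)"
    if "i \<le> K" for i
    using that
  proof (induction i)
    case 0
    have "layered_graph m K (s 0) = {}" "partial_injections m (s 0)"
      by (auto simp: layered_graph_def s_def partial_injections_def)
    then show ?case using layered_graph_path_unions[of m "s 0" K n] room by (simp add: xs_def)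
  next
    case (Suc i)
    then have IH: "admissible n (path_unions n) {} (xs i)" "fold graph_step (xs i) {} = layered_graph m K (s i)"
      "partial_injections m (s i)" by auto
    have ext: "(s i)(i := (\<lambda>u. if u < m then Some (id u) else s i i u)) = s (Suc i)"
      by (auto simp: s_def fun_eq_iff)
    have xs: "xs (Suc i) = xs i @ map (\<lambda>u. Insert (grid_vertex m i u) (grid_vertex m (Suc i) (id u))) [0..<m]"
      by (simp add: xs_def)
    have "i < K" using Suc.prems by simp
    from insert_column[OF IH(3) this room _ permutes_id order_refl]
    have "admissible n (path_unions n) (layered_graph m K (s i)) (map (\<lambda>u. Insert (grid_vertex m i u) (grid_vertex m (Suc i) (id u))) [0..<m])"
      "fold graph_step (map (\<lambda>u. Insert (grid_vertex m i u) (grid_vertex m (Suc i) (id u))) [0..<m]) (layered_graph m K (s i)) = layered_graph m K (s (Suc i))"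
      "partial_injections m (s (Suc i))"
      unfolding ext by (simp_all add: s_def)
    then show ?case using IH unfolding xs admissible_append fold_append by simp
  qed
  from this[of K] show ?thesis
    by (simp add: xs_def preamble_def s_def full_layers_def cong: layered_graph_cong)
qed

lemma update_correct:
  assumes x: "x \<in> worlds"
  shows "admissible n (path_unions n) (layered_graph m K (full_layers m (state x t))) (map (op x) (update_labels t)) \<and>
    fold graph_step (map (op x) (update_labels t)) (layered_graph m K (full_layers m (state x t))) =
      layered_graph m K (full_layers m (state x (Suc t)))"
proof (cases "upd t")
  case None
  then have "slots_done (Suc t) = slots_done t" by (auto simp: slots_done_def less_Suc_eq)
  then have "state x (Suc t) = state x t" by (auto simp: state_def fun_eq_iff)
  moreover have "layered_graph m K (full_layers m (state x t)) \<in> path_unions n"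
    by (intro layered_graph_path_unions partial_injections_full_layers state_permutes x room)
  ultimately show ?thesis using None by (simp add: update_labels_def)
next
  case (Some i)
  let ?s = "full_layers m (state x t)"
  have slots: "slots_done (Suc t) = insert i (slots_done t)" using Some by (auto simp: slots_done_def less_Suc_eq)
  have "i \<notin> slots_done t" using Some upd_inj by (force simp: slots_done_def)
  then have id: "state x t i = id" by (simp add: state_def)
  have pi: "partial_injections m ?s" by (intro partial_injections_full_layers state_permutes x)
  have i: "i < K" using Some upd_less by simp
  let ?s1 = "?s(i := (\<lambda>u. if u < m then None else ?s i u))"
  let ?s2 = "?s1(i := (\<lambda>u. if u < m then Some (x i u) else ?s1 i u))"
  have del: "admissible n (path_unions n) (layered_graph m K ?s) (map (\<lambda>u. Delete (grid_vertex m i u) (grid_vertex m (Suc i) u)) [0..<m]) \<and>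
    fold graph_step (map (\<lambda>u. Delete (grid_vertex m i u) (grid_vertex m (Suc i) u)) [0..<m]) (layered_graph m K ?s) = layered_graph m K ?s1 \<and>
    partial_injections m ?s1"
    by (rule delete_column[OF pi i room _ order_refl]) (simp add: full_layers_def id)
  then have ins: "admissible n (path_unions n) (layered_graph m K ?s1) (map (\<lambda>u. Insert (grid_vertex m i u) (grid_vertex m (Suc i) (x i u))) [0..<m]) \<and>
    fold graph_step (map (\<lambda>u. Insert (grid_vertex m i u) (grid_vertex m (Suc i) (x i u))) [0..<m]) (layered_graph m K ?s1) = layered_graph m K ?s2 \<and>
    partial_injections m ?s2"
    by (intro insert_column[OF _ i room _ worlds_permutes[OF x i] order_refl]) auto
  have "layered_graph m K ?s2 = layered_graph m K (full_layers m (state x (Suc t)))"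
    by (rule layered_graph_cong) (auto simp: full_layers_def state_def slots)
  then show ?thesis using del ins Some
    by (simp add: update_labels_def admissible_append o_def)
qed

lemma fold_queries: "fold graph_step (map (op x) (take k (query_labels t))) E = E"
proof (rule fold_graph_step_queries)
  fix y assume "y \<in> set (map (op x) (take k (query_labels t)))"
  then obtain l where "l \<in> set (query_labels t)" "y = op x l" by (auto dest: in_set_takeD)
  then show "is_query y" by (auto simp: query_labels_def is_query_def split: option.splits)
qed

lemma column_map_less:
  assumes "x \<in> worlds" "u < m"
  shows "column_map (state x t) q u < m"
  using permutes_in_image[OF column_map_permutes[of q "state x t" m], of u] state_permutes[OF assms(1)] assms(2)
  by simp

lemma labels_correct:
  assumes x: "x \<in> worlds"
  shows "admissible n (path_unions n) {} (preamble @ map (op x) (labels t)) \<and>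
    fold graph_step (preamble @ map (op x) (labels t)) {} = layered_graph m K (full_layers m (state x t))"
proof (induction t)
  case 0
  have "state x 0 = (\<lambda>_. id)" by (simp add: state_def slots_done_def fun_eq_iff)
  then show ?case using preamble_correct by (simp add: id_def)
next
  case (Suc t)
  have PU: "layered_graph m K (full_layers m (state x (Suc t))) \<in> path_unions n"
    by (intro layered_graph_path_unions partial_injections_full_layers state_permutes x room)
  have "admissible n (path_unions n) (layered_graph m K (full_layers m (state x (Suc t)))) (map (op x) (query_labels t))"
  proof (cases "qry t")
    case (Some q)
    have "admissible n (path_unions n) (layered_graph m K (full_layers m (state x (Suc t))))
      (map (\<lambda>u. Connected (grid_vertex m 0 u) (grid_vertex m q (column_map (state x (Suc t)) q u))) [0..<m])"
      using PU qry_le[OF Some] column_map_less[OF x] room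
      by (intro admissible_queries) (auto intro!: grid_vertex_less[of _ K])
    then show ?thesis by (simp add: query_labels_def Some o_def)
  qed (use PU in \<open>simp add: query_labels_def\<close>)
  moreover have "fold graph_step (map (op x) (query_labels t)) E = E" for E
    using fold_queries[of x "length (query_labels t)" t E] by simp
  ultimately show ?case using Suc update_correct[OF x, of t]
    by (simp add: admissible_append)
qed

lemma update_labels_no_query: "Qry t q u \<notin> set (update_labels t')"
  by (auto simp: update_labels_def split: option.splits)

lemma graph_at_query:
  assumes x: "x \<in> worlds" and "k < length (labels T)" "labels T ! k = Qry t q u"
  shows "t < T \<and> qry t = Some q \<and> u < m \<and>
    fold graph_step (preamble @ map (op x) (take k (labels T))) {} = layered_graph m K (\<lambda>i u. Some (state x (Suc t) i u))"
  using assms(2,3)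
proof (induction T)
  case (Suc T)
  let ?A = "labels T @ update_labels T"
  consider "k < length (labels T)" | "length (labels T) \<le> k" "k < length ?A" | "length ?A \<le> k" by linarith
  then show ?case
  proof cases
    case 1
    then show ?thesis using Suc by (simp add: nth_append)
  next
    case 2
    then have k: "k - length (labels T) < length (update_labels T)" by auto
    then have "Qry t q u = update_labels T ! (k - length (labels T))"
      using 2 Suc.prems by (simp add: nth_append)
    then have "Qry t q u \<in> set (update_labels T)" using k nth_mem by metis
    then show ?thesis using update_labels_no_query by blast
  next
    case 3
    define j where "j = k - length ?A"
    have k: "k = length ?A + j" using 3 by (simp add: j_def)
    have j: "j < length (query_labels T)" "Qry t q u = query_labels T ! j"
      using Suc.prems unfolding k by (simp_all add: nth_append)
    then have "Qry t q u \<in> set (query_labels T)" by simp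
    then have t: "t = T" "qry t = Some q" "u < m" by (auto simp: query_labels_def split: option.splits)
    have "take k (labels (Suc T)) = ?A @ take j (query_labels T)" unfolding k by simp
    then have "fold graph_step (preamble @ map (op x) (take k (labels (Suc T)))) {} =
        layered_graph m K (full_layers m (state x (Suc T)))"
      using labels_correct[OF x, of T] update_correct[OF x, of T] by (simp add: fold_queries)
    then show ?thesis using t by (simp add: layered_graph_full_layers)
  qed
qed simp

text \<open>The row \<open>v\<close> is arbitrary: to compare two worlds, the query asked in one of
  them is also considered at the same position in the other, where its answer may be no.\<close>

lemma query_at:
  assumes x: "x \<in> worlds" and k: "k < length (labels T)" "labels T ! k = Qry t q u" and v: "v < m"
  shows "admissible n (path_unions n) {} ((preamble @ map (op x) (take k (labels T))) @ [Connected (grid_vertex m 0 u) (grid_vertex m q v)])"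
    and "same_component (fold graph_step (preamble @ map (op x) (take k (labels T))) {}) (grid_vertex m 0 u) (grid_vertex m q v)
       \<longleftrightarrow> v = column_map (state x (Suc t)) q u"
proof -
  note g = graph_at_query[OF x k]
  have "q \<le> K" "u < m" using g qry_le by auto
  have "labels T = take k (labels T) @ drop k (labels T)" by simp
  then have "admissible n (path_unions n) {} ((preamble @ map (op x) (take k (labels T))) @ map (op x) (drop k (labels T)))"
    using labels_correct[OF x, of T] by (metis append.assoc map_append)
  then have adm: "admissible n (path_unions n) {} (preamble @ map (op x) (take k (labels T)))"
    unfolding admissible_append[of _ _ _ "preamble @ map (op x) (take k (labels T))"] by simp
  then show "admissible n (path_unions n) {} ((preamble @ map (op x) (take k (labels T))) @ [Connected (grid_vertex m 0 u) (grid_vertex m q v)])"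
    unfolding admissible_append[of _ _ _ "preamble @ map (op x) (take k (labels T))"]
    using admissible_final[OF adm] grid_vertex_less[of 0 K u m n] grid_vertex_less[of q K v m n] \<open>q \<le> K\<close> \<open>u < m\<close> v room
    by simp
  show "same_component (fold graph_step (preamble @ map (op x) (take k (labels T))) {}) (grid_vertex m 0 u) (grid_vertex m q v)
       \<longleftrightarrow> v = column_map (state x (Suc t)) q u"
    using g same_component_layered_graph[of K "state x (Suc t)" m q u v] state_permutes[OF x] \<open>q \<le> K\<close> \<open>u < m\<close> v
    by simp
qed

end

subsection \<open>Information transfer between two time intervals\<close>

lemma column_map_cong: "(\<And>i. i < q \<Longrightarrow> s i = s' i) \<Longrightarrow> column_map s q = column_map s' q"
  by (induction q) auto

text \<open>A single unknown factor in a product of permutations can be isolated by cancellation: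
  the factors after it are injective, and the product before it reaches every row.\<close>

lemma column_map_differ_once:
  assumes perm: "\<And>i. s i permutes {..<m}" "\<And>i. s' i permutes {..<m}"
    and eq: "\<And>i. i < q \<Longrightarrow> i \<noteq> g \<Longrightarrow> s i = s' i" and g: "g < q"
    and maps: "\<And>u. u < m \<Longrightarrow> column_map s q u = column_map s' q u"
  shows "s g = s' g"
proof -
  have "\<forall>u<m. column_map s (Suc g) u = column_map s' (Suc g) u" using g maps eq
  proof (induction q)
    case (Suc q)
    show ?case
    proof (cases "g = q")
      case False
      then have sq: "s q = s' q" using Suc.prems by auto
      have "column_map s q u = column_map s' q u" if "u < m" for u
        using Suc.prems(2)[OF that] permutes_inj[OF perm(2)[of q]] sq by (simp add: inj_eq)
      then show ?thesis using Suc False by auto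
    qed (use Suc in auto)
  qed simp
  moreover have cm: "column_map s g = column_map s' g" using eq g by (intro column_map_cong) auto
  ultimately have *: "\<forall>u<m. s g (column_map s g u) = s' g (column_map s g u)" by simp
  have cmp: "column_map s g permutes {..<m}" by (rule column_map_permutes) (rule perm)
  show ?thesis
  proof
    fix w
    show "s g w = s' g w"
    proof (cases "w < m")
      case True
      then obtain u where "u < m" "w = column_map s g u"
        using permutes_image[OF cmp] by (metis imageE lessThan_iff)
      then show ?thesis using * by simp
    next
      case False
      then show ?thesis using permutes_not_in[OF perm(1)] permutes_not_in[OF perm(2)] by simp
    qed
  qed
qed

context schedule
begin

definition pos :: "nat \<Rightarrow> nat" where "pos t = length (labels t)"

lemma labels_split:
  assumes "a \<le> t"
  shows "\<exists>ys. labels t = labels a @ ys \<and> set ys = (\<Union>r\<in>{a..<t}. set (update_labels r) \<union> set (query_labels r))"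
  using assms
proof (induction t rule: dec_induct)
  case (step t)
  then obtain ys where "labels t = labels a @ ys" "set ys = (\<Union>r\<in>{a..<t}. set (update_labels r) \<union> set (query_labels r))"
    by blast
  moreover have "{a..<Suc t} = insert t {a..<t}" using step by auto
  ultimately show ?case by (intro exI[of _ "ys @ update_labels t @ query_labels t"]) auto
qed simp

lemma pos_mono: "a \<le> t \<Longrightarrow> pos a \<le> pos t"
  using labels_split[of a t] by (auto simp: pos_def)

lemma take_labels: "a \<le> t \<Longrightarrow> take (pos a) (labels t) = labels a"
  using labels_split[of a t] by (auto simp: pos_def)

lemma set_segment:
  assumes "a \<le> e" "e \<le> t"
  shows "set (drop (pos a) (take (pos e) (labels t))) = (\<Union>r\<in>{a..<e}. set (update_labels r) \<union> set (query_labels r))"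
  using labels_split[OF assms(1)] take_labels[OF assms(2)] by (auto simp: pos_def)

lemma nth_label_mem:
  assumes "a \<le> e" "e \<le> t" "pos a \<le> k" "k < pos e"
  shows "\<exists>r\<in>{a..<e}. labels t ! k \<in> set (update_labels r) \<union> set (query_labels r)"
proof -
  have "length (labels t) \<ge> pos e" using pos_mono[OF assms(2)] by (simp add: pos_def)
  then have "labels t ! k = drop (pos a) (take (pos e) (labels t)) ! (k - pos a)"
    "k - pos a < length (drop (pos a) (take (pos e) (labels t)))"
    using assms by auto
  then have "labels t ! k \<in> set (drop (pos a) (take (pos e) (labels t)))" using nth_mem by metis
  then show ?thesis unfolding set_segment[OF assms(1,2)] by auto
qed

text \<open>As long as the slots of \<Gamma> have not been changed, they hold the identity in every
  world, so the operations do not depend on their future contents.\<close>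

lemma op_cong:
  assumes eq: "\<And>i. i < K \<Longrightarrow> i \<notin> \<Gamma> \<Longrightarrow> x i = y i"
    and l: "l \<in> set (update_labels r) \<union> set (query_labels r)" and \<Gamma>: "\<Gamma> \<inter> slots_done (Suc r) = {}"
  shows "op x l = op y l"
proof -
  have sd: "x i = y i" if "i \<in> slots_done (Suc r)" for i
    using that \<Gamma> eq upd_less by (auto simp: slots_done_def)
  then have st: "state x (Suc r) = state y (Suc r)" by (auto simp: state_def fun_eq_iff)
  have "x i = y i" if "upd r = Some i" for i using that sd[of i] by (auto simp: slots_done_def)
  then show ?thesis using l st by (auto simp: update_labels_def query_labels_def split: option.splits)
qed

lemma upd_in_update_labels: "Del i u \<in> set (update_labels r) \<or> Ins i u \<in> set (update_labels r) \<Longrightarrow> upd r = Some i"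
  by (auto simp: update_labels_def split: option.splits)

lemma no_upd_in_query_labels: "Del i u \<notin> set (query_labels r)" "Ins i u \<notin> set (query_labels r)"
  by (auto simp: query_labels_def split: option.splits)

text \<open>The composition verified right after the first slot with different contents involves no other such slot.\<close>

lemma worlds_determined:
  assumes xy: "x \<in> worlds" "y \<in> worlds" and \<Gamma>K: "\<Gamma> \<subseteq> {..<K}"
    and eq: "\<And>i. i < K \<Longrightarrow> i \<notin> \<Gamma> \<Longrightarrow> x i = y i"
    and \<Gamma>: "\<Gamma> \<subseteq> slots_done b"
    and qf: "\<And>g. g \<in> \<Gamma> \<Longrightarrow> g < qf g" "\<And>g g'. g \<in> \<Gamma> \<Longrightarrow> g' \<in> \<Gamma> \<Longrightarrow> g < g' \<Longrightarrow> qf g \<le> g'"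
    and maps: "\<And>g. g \<in> \<Gamma> \<Longrightarrow> \<exists>t\<ge>b. \<forall>u<m. column_map (state x (Suc t)) (qf g) u = column_map (state y (Suc t)) (qf g) u"
  shows "x = y"
proof (rule ccontr)
  assume ne: "x \<noteq> y"
  have "\<exists>g\<in>\<Gamma>. x g \<noteq> y g"
  proof (rule ccontr)
    assume "\<not> ?thesis"
    then have "x i = y i" for i using eq xy by (cases "i < K") (auto simp: worlds_def PiE_def extensional_def)
    then show False using ne by auto
  qed
  then have ex: "\<exists>g. g \<in> \<Gamma> \<and> x g \<noteq> y g" by blast
  define g where "g = (LEAST g. g \<in> \<Gamma> \<and> x g \<noteq> y g)"
  have g: "g \<in> \<Gamma>" "x g \<noteq> y g" using LeastI_ex[OF ex] by (auto simp: g_def)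
  have least: "x i = y i" if "i < g" "i \<in> \<Gamma>" for i using not_less_Least[of i] that unfolding g_def by blast
  obtain t where t: "t \<ge> b" "\<forall>u<m. column_map (state x (Suc t)) (qf g) u = column_map (state y (Suc t)) (qf g) u"
    using maps[OF g(1)] by blast
  have "g \<in> slots_done (Suc t)" using g \<Gamma> t by (force simp: slots_done_def)
  then have sg: "state x (Suc t) g = x g" "state y (Suc t) g = y g" by (auto simp: state_def)
  have "state x (Suc t) g = state y (Suc t) g"
  proof (rule column_map_differ_once)
    show "state x (Suc t) i permutes {..<m}" "state y (Suc t) i permutes {..<m}" for i
      using state_permutes xy by auto
    show "g < qf g" using qf g by simp
    show "column_map (state x (Suc t)) (qf g) u = column_map (state y (Suc t)) (qf g) u" if "u < m" for u
      using t that by blast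
    show "state x (Suc t) i = state y (Suc t) i" if i: "i < qf g" "i \<noteq> g" for i
    proof -
      have "x i = y i" if "i \<in> slots_done (Suc t)"
      proof (cases "i \<in> \<Gamma>")
        case True
        then show ?thesis using least[of i] qf(2)[of g i] i g(1) by linarith
      next
        case False
        have "i < K" using that upd_less by (auto simp: slots_done_def)
        then show ?thesis using eq False by blast
      qed
      then show ?thesis by (simp add: state_def)
    qed
  qed
  then show False using sg g by simp
qed

end

section \<open>Running a data structure in different worlds of a schedule\<close>

definition query_ok :: "data_structure \<Rightarrow> memory \<Rightarrow> operation list \<Rightarrow> nat \<Rightarrow> nat \<Rightarrow> bool" where
  "query_ok D M xs u v \<longleftrightarrow> writes_consistent (connected_query D u v) (fold (memory_step D) xs M) \<and>
     (answer (connected_query D u v) (fold (memory_step D) xs M) \<longleftrightarrow> same_component (fold graph_step xs {}) u v)"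

text \<open>The assumption \<open>sure\<close> covers both models. Under Las Vegas the second
  disjunct always holds. Under Monte Carlo the first one does: the answer may be wrong, but a
  deterministic query is still a function of the cells on which it depends.\<close>

locale scheduled_structure = schedule +
  fixes b T :: nat and D :: data_structure
  assumes wf: "wf_structure n b D" and b: "b \<ge> 1"
    and sure: "\<And>M xs u v. \<lbrakk>M \<in> set_pmf (initial_memory b D); admissible n (path_unions n) {} (xs @ [Connected u v])\<rbrakk>
      \<Longrightarrow> (\<exists>p. connected_query D u v = Deterministic p) \<or> query_ok D M xs u v"
begin

abbreviation "ops x \<equiv> map (op x) (labels T)"
abbreviation "start M \<equiv> fold (memory_step D) preamble M"
abbreviation "mem x M k \<equiv> memory_at D (ops x) (start M) k"

text \<open>A position is reliable only if all m possible targets would be judged correctly, not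
  just the one asked, because the targets of other worlds are tested against the memory of this
  one.\<close>

definition bad :: "(nat \<Rightarrow> nat \<Rightarrow> nat) \<Rightarrow> memory \<Rightarrow> nat set" where
  "bad x M = {k. k < length (labels T) \<and> (\<exists>t q u. labels T ! k = Qry t q u \<and>
     (\<exists>v<m. \<not> query_ok D M (preamble @ take k (ops x)) (grid_vertex m 0 u) (grid_vertex m q v)))}"

definition queries :: "nat set" where
  "queries = {k. k < length (labels T) \<and> (\<exists>t q u. labels T ! k = Qry t q u)}"

definition true_row :: "(nat \<Rightarrow> nat \<Rightarrow> nat) \<Rightarrow> nat \<Rightarrow> nat" where
  "true_row x k = (case labels T ! k of Qry t q u \<Rightarrow> column_map (state x (Suc t)) q u | _ \<Rightarrow> 0)"

lemma mem_eq: "fold (memory_step D) (preamble @ take k (ops x)) M = mem x M k"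
  by (simp add: memory_at_def)

lemma bad_subset: "bad x M \<subseteq> queries"
  by (auto simp: bad_def queries_def)

text \<open>Let \<open>v\<close> be the target row in world \<open>x\<close>. At a reliable position
  its query accepts in \<open>x\<close>; agreement on its cells makes it accept in \<open>y\<close>
  as well, and reliability in \<open>y\<close> makes \<open>v\<close> the true row of
  \<open>y\<close>. At an unreliable position the true row comes from the advice. Either way both
  worlds ask the same query.\<close>

lemma same_step:
  assumes M: "M \<in> set_pmf (initial_memory b D)" and xy: "x \<in> worlds" "y \<in> worlds" and k: "k < length (labels T)"
    and upds: "\<And>i u. labels T ! k = Del i u \<or> labels T ! k = Ins i u \<Longrightarrow> x i = y i"
    and agree: "\<And>a. a \<in> operation_inputs D (op x (labels T ! k)) (mem x M k) \<union>
        operation_inputs D (op y (labels T ! k)) (mem y M k) \<Longrightarrow> mem x M k a = mem y M k a"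
    and bads: "k \<in> bad x M \<longleftrightarrow> k \<in> bad y M" "k \<in> bad x M \<Longrightarrow> true_row x k = true_row y k"
  shows "op x (labels T ! k) = op y (labels T ! k) \<and>
    operation_writes D (op x (labels T ! k)) (mem x M k) = operation_writes D (op y (labels T ! k)) (mem y M k)"
proof (cases "labels T ! k")
  case (Qry t q u)
  let ?v = "column_map (state x (Suc t)) q u" and ?v' = "column_map (state y (Suc t)) q u"
  let ?c = "connected_query D (grid_vertex m 0 u) (grid_vertex m q ?v)"
  let ?xs = "preamble @ take k (ops x)" and ?ys = "preamble @ take k (ops y)"
  have u: "u < m" using graph_at_query[OF xy(1) k Qry] by simp
  have v: "?v < m" using column_map_less[OF xy(1) u] by simp
  have tx: "take k (ops x) = map (op x) (take k (labels T))" for x by (simp add: take_map)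
  note qx = query_at[OF xy(1) k Qry, folded tx] and qy = query_at[OF xy(2) k Qry, folded tx]
  have agree': "mem x M k a = mem y M k a" if "a \<in> query_inputs ?c (mem x M k)" for a
    using agree[of a] that by (simp add: Qry)
  have "?v = ?v'"
  proof (cases "k \<in> bad x M")
    case True
    then show ?thesis using bads by (simp add: true_row_def Qry)
  next
    case False
    then have "query_ok D M ?xs (grid_vertex m 0 u) (grid_vertex m q ?v)"
      "query_ok D M ?ys (grid_vertex m 0 u) (grid_vertex m q ?v)"
      using bads(1) k Qry v unfolding bad_def by blast+
    then have "answer ?c (mem x M k)" "writes_consistent ?c (mem y M k)"
      "answer ?c (mem y M k) \<longleftrightarrow> same_component (fold graph_step ?ys {}) (grid_vertex m 0 u) (grid_vertex m q ?v)"
      unfolding query_ok_def mem_eq using qx(2)[OF v] by simp_all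
    then show ?thesis using query_inputs_cong[of ?c "mem x M k" "mem y M k"] agree' qy(2)[OF v] by blast
  qed
  moreover have "query_writes ?c (mem y M k) = query_writes ?c (mem x M k)"
  proof -
    have "(\<exists>p. ?c = Deterministic p) \<or> answer ?c (mem x M k)"
      using sure[OF M qx(1)[OF v]] qx(2)[OF v] unfolding query_ok_def mem_eq by blast
    moreover have "writes_consistent ?c (mem y M k)"
      using sure[OF M qy(1)[OF v]] unfolding query_ok_def mem_eq by auto
    ultimately show ?thesis using query_inputs_cong[of ?c "mem x M k" "mem y M k"] agree' by blast
  qed
  ultimately show ?thesis by (simp add: Qry)
next
  case (Del i u)
  then have "op x (labels T ! k) = op y (labels T ! k)" "\<not> is_query (op x (labels T ! k))"
    by (auto simp: is_query_def)
  then show ?thesis using update_writes_cong[of D "op x (labels T ! k)" "mem x M k" "mem y M k"] agree by simp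
next
  case (Ins i u)
  then have "op x (labels T ! k) = op y (labels T ! k)" "\<not> is_query (op x (labels T ! k))"
    using upds by (auto simp: is_query_def)
  then show ?thesis using update_writes_cong[of D "op x (labels T ! k)" "mem x M k" "mem y M k"] agree by simp
qed

lemma in_range_op:
  assumes x: "x \<in> worlds" and l: "l \<in> set (labels T)"
  shows "in_range n (op x l)"
proof -
  obtain r where r: "l \<in> set (update_labels r) \<union> set (query_labels r)"
    using labels_split[of 0 T] l by auto
  show ?thesis
  proof (cases l)
    case (Del i u)
    then have "i < K" "u < m" using r upd_less by (auto simp: update_labels_def query_labels_def split: option.splits)
    then show ?thesis using Del grid_vertex_less[of _ K u m n] room by (simp add: in_range_def)
  next
    case (Ins i u)
    then have i: "i < K" "u < m" using r upd_less by (auto simp: update_labels_def query_labels_def split: option.splits)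
    then have "x i u < m" using permutes_in_image[OF worlds_permutes[OF x i(1)], of u] by simp
    then show ?thesis using Ins i grid_vertex_less[of _ K _ m n] room by (simp add: in_range_def)
  next
    case (Qry t q u)
    then have q: "q \<le> K" "u < m" using r qry_le by (auto simp: update_labels_def query_labels_def split: option.splits)
    then show ?thesis using Qry grid_vertex_less[of _ K _ m n] room column_map_less[OF x] by (simp add: in_range_def)
  qed
qed

lemma in_range_preamble: "y \<in> set preamble \<Longrightarrow> in_range n y"
  using grid_vertex_less[of _ K _ m n] room by (auto simp: preamble_def in_range_def)

lemma initial_memory_set:
  "{M. (\<forall>a\<in>random_cells D. M a < 2 ^ b) \<and> (\<forall>a. a \<notin> random_cells D \<longrightarrow> M a = initial_contents D a)} \<noteq> {}"
  "finite {M. (\<forall>a\<in>random_cells D. M a < 2 ^ b) \<and> (\<forall>a. a \<notin> random_cells D \<longrightarrow> M a = initial_contents D a)}"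
proof -
  let ?S = "{M. (\<forall>a\<in>random_cells D. M a < 2 ^ b) \<and> (\<forall>a. a \<notin> random_cells D \<longrightarrow> M a = initial_contents D a)}"
  have "(\<lambda>a. if a \<in> random_cells D then 0 else initial_contents D a) \<in> ?S" by simp
  then show "?S \<noteq> {}" by (metis (lifting) empty_iff)
  have fr: "finite (random_cells D)" using wf finite_subset by (auto simp: wf_structure_def)
  have "?S \<subseteq> (\<lambda>g a. if a \<in> random_cells D then g a else initial_contents D a) ` (random_cells D \<rightarrow>\<^sub>E {..<2 ^ b})"
  proof
    fix M assume M: "M \<in> ?S"
    then have "M = (\<lambda>a. if a \<in> random_cells D then restrict M (random_cells D) a else initial_contents D a)"
      by (auto simp: fun_eq_iff)
    moreover have "restrict M (random_cells D) \<in> random_cells D \<rightarrow>\<^sub>E {..<2 ^ b}" using M by auto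
    ultimately show "M \<in> (\<lambda>g a. if a \<in> random_cells D then g a else initial_contents D a) ` (random_cells D \<rightarrow>\<^sub>E {..<2 ^ b})"
      by blast
  qed
  then show "finite ?S"
    by (rule finite_subset) (intro finite_imageI finite_PiE fr finite_lessThan)
qed

lemma wf_memory_mem:
  assumes "M \<in> set_pmf (initial_memory b D)" "x \<in> worlds"
  shows "wf_memory b (mem x M k)"
proof -
  have "wf_memory b M"
    using assms(1) initial_memory_set unfolding initial_memory_def
    by (intro wf_memory_initial[OF wf]) simp
  then have "wf_memory b (start M)" by (intro wf_memory_fold[OF wf] in_range_preamble)
  then show ?thesis unfolding memory_at_def
    by (rule wf_memory_fold[OF wf]) (auto dest!: in_set_takeD intro: in_range_op[OF assms(2)])
qed

lemma inputs_written_subset: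
  assumes "M \<in> set_pmf (initial_memory b D)" "x \<in> worlds" "k < length (labels T)"
  shows "inputs_at D (ops x) (start M) k \<subseteq> {..<2 ^ b}" "written_at D (ops x) (start M) k \<subseteq> {..<2 ^ b}"
  using wf_operation_inputs_writes[OF wf wf_memory_mem[OF assms(1,2), of k] in_range_op[OF assms(2), of "labels T ! k"]] assms(3)
  unfolding inputs_at_def written_at_def wf_writes_def by auto

text \<open>The length of the advice of \<open>kraft_worlds\<close> for two adjacent intervals of
  positions, with the memory at position \<open>p\<close> in the role of the old contents.\<close>

definition node_cost :: "real \<Rightarrow> real \<Rightarrow> nat \<Rightarrow> nat \<Rightarrow> nat \<Rightarrow> memory \<Rightarrow> (nat \<Rightarrow> nat \<Rightarrow> nat) \<Rightarrow> real" where
  "node_cost p0 p1 p q e M x =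
     2 * real b * card (changed D (ops x) (start M) p q \<inter> interval_inputs D (ops x) (start M) q e)
     + (- log 2 p0) * card (interval_inputs D (ops x) (start M) q e)
     + (- log 2 p1) * card (changed D (ops x) (start M) p q)
     + 3 + 2 * log 2 m * card (bad x M \<inter> {q..<e}) + 3 / m * card (queries \<inter> {q..<e})"

text \<open>All slots outside \<Gamma> are revealed, which leaves \<open>card \<Gamma>\<close>
  independent permutations and thus the entropy on the left. Worlds with equal revealed slots
  satisfy Kraft for each fixed initial memory: with compatible advice the second interval runs
  identically in both, and its queries determine the slots of \<Gamma>.\<close>

lemma node_cost_ge:
  assumes p: "0 < p0" "0 < p1" "p0 + p1 = 1 - 1 / 2 ^ b"
    and M: "M \<in> set_pmf (initial_memory b D)" and ace: "a \<le> c" "c \<le> e" "e \<le> T"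
    and \<Gamma>upd: "\<And>g. g \<in> \<Gamma> \<Longrightarrow> \<exists>t\<in>{a..<c}. upd t = Some g"
    and \<Gamma>qry: "\<And>g. g \<in> \<Gamma> \<Longrightarrow> \<exists>t\<in>{c..<e}. qry t = Some (qf g)"
    and qf: "\<And>g. g \<in> \<Gamma> \<Longrightarrow> g < qf g" "\<And>g g'. g \<in> \<Gamma> \<Longrightarrow> g' \<in> \<Gamma> \<Longrightarrow> g < g' \<Longrightarrow> qf g \<le> g'"
  shows "card worlds * (card \<Gamma> * log 2 (fact m)) \<le> (\<Sum>x\<in>worlds. node_cost p0 p1 (pos a) (pos c) (pos e) M x)"
proof -
  have \<Gamma>K: "\<Gamma> \<subseteq> {..<K}" using \<Gamma>upd upd_less by blast
  then have fin\<Gamma>: "finite \<Gamma>" by (rule finite_subset) simp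
  let ?Sm = "{\<sigma>. \<sigma> permutes {..<m}}"
  define P where "P = (({..<K} - \<Gamma>) \<rightarrow>\<^sub>E ?Sm)"
  have cardS: "card ?Sm = fact m" using card_permutations[of "{..<m}" m] by simp
  have cardW: "card worlds = fact m ^ K" by (simp add: worlds_def card_PiE cardS)
  have cardP: "card P = fact m ^ (K - card \<Gamma>)"
    using \<Gamma>K fin\<Gamma> by (simp add: P_def card_PiE cardS card_Diff_subset)
  have finP: "finite P" unfolding P_def by (intro finite_PiE finite_permutations) auto
  have "card \<Gamma> \<le> K" using card_mono[OF _ \<Gamma>K] by simp
  then have "real (card worlds) = real (card P) * real (fact m) ^ card \<Gamma>"
    unfolding cardW cardP by (simp flip: power_add)
  then have quot: "real (card worlds) / real (card P) = real (fact m) ^ card \<Gamma>"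
    using cardP by simp
  have *: "log 2 (real (card worlds) / real (card P)) = card \<Gamma> * log 2 (fact m)"
    unfolding quot by (simp add: log_nat_power)
  have ne: "worlds \<noteq> {}" using cardW by (metis card.empty fact_nonzero power_not_zero)
  have img: "(\<lambda>x. restrict x ({..<K} - \<Gamma>)) ` worlds \<subseteq> P"
    unfolding P_def by (intro image_subsetI iffD2[OF restrict_PiE_iff]) (simp add: worlds_permutes)
  have pos: "pos a \<le> pos c" "pos c \<le> pos e" "pos e \<le> length (labels T)"
    using ace pos_mono pos_mono[of e T] by (auto simp: pos_def)
  have "card worlds * log 2 (real (card worlds) / real (card P)) \<le> (\<Sum>x\<in>worlds. node_cost p0 p1 (pos a) (pos c) (pos e) M x)"
  proof (rule sum_cost_ge[OF finite_worlds ne img finP])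
    fix r assume "r \<in> P"
    define Y where "Y = {x \<in> worlds. restrict x ({..<K} - \<Gamma>) = r}"
    have eqoff: "x i = y i" if "x \<in> Y" "y \<in> Y" "i < K" "i \<notin> \<Gamma>" for x y i
      using that unfolding Y_def by (metis (mono_tags, lifting) DiffI lessThan_iff mem_Collect_eq restrict_apply')
    show "(\<Sum>x\<in>{x\<in>worlds. restrict x ({..<K} - \<Gamma>) = r}. 2 powr (- node_cost p0 p1 (pos a) (pos c) (pos e) M x)) \<le> 1"
    proof (cases "Y = {}")
      case False
      then obtain x0 where x0: "x0 \<in> Y" by blast
      have Yw: "x \<in> worlds" if "x \<in> Y" for x using that by (simp add: Y_def)
      \<comment> \<open>The slots of \<Gamma> are first touched between the times \<open>a\<close>
        and \<open>c\<close>, so all worlds of a fibre arrive at \<open>a\<close> with one memory,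
        which serves as the common reference of the advice.\<close>
      have old: "mem x M (pos a) = mem x0 M (pos a)" if "x \<in> Y" for x
      proof -
        have "op x l = op x0 l" if l: "l \<in> set (labels a)" for l
        proof -
          obtain r where r: "r < a" "l \<in> set (update_labels r) \<union> set (query_labels r)"
            using labels_split[of 0 a] l by auto
          have "\<Gamma> \<inter> slots_done (Suc r) = {}"
          proof (rule ccontr)
            assume "\<Gamma> \<inter> slots_done (Suc r) \<noteq> {}"
            then obtain g t where "g \<in> \<Gamma>" "t < Suc r" "upd t = Some g" by (auto simp: slots_done_def)
            moreover obtain t' where "t' \<in> {a..<c}" "upd t' = Some g" using \<Gamma>upd \<open>g \<in> \<Gamma>\<close> by blast
            ultimately show False using upd_inj[of t g t'] r by auto
          qed
          then show ?thesis using op_cong[of \<Gamma> x x0 l r] eqoff[OF \<open>x \<in> Y\<close> x0] r by blast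
        qed
        then show ?thesis using take_labels[of a T] ace by (simp add: memory_at_def take_map cong: map_cong)
      qed
      have "(\<Sum>x\<in>Y. 2 powr (- node_cost p0 p1 (pos a) (pos c) (pos e) M x)) \<le> 1"
        unfolding node_cost_def
      proof (rule kraft_worlds[where content = "\<lambda>x. mem x M (pos c)" and old = "mem x0 M (pos a)" and val = true_row
            and bad = "\<lambda>x. bad x M \<inter> {pos c..<pos e}"])
        show "b \<ge> 1" "m \<ge> 2" "0 < p0" "0 < p1" "p0 + p1 = 1 - 1 / 2 ^ b" using b m p by auto
        show "finite Y" unfolding Y_def using finite_worlds by simp
        show "finite (queries \<inter> {pos c..<pos e})" by simp
        show "changed D (ops y) (start M) (pos a) (pos c) = {ca. mem y M (pos c) ca \<noteq> mem x0 M (pos a) ca}" if "y \<in> Y" for y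
          unfolding changed_def old[OF that] ..
        show "changed D (ops y) (start M) (pos a) (pos c) \<subseteq> {..<2 ^ b}" if "y \<in> Y" for y
          using pos by (intro order.trans[OF changed_subset] UN_least inputs_written_subset[OF M Yw[OF that]]) auto
        show "interval_inputs D (ops y) (start M) (pos c) (pos e) \<subseteq> {..<2 ^ b}" if "y \<in> Y" for y
          using pos by (intro order.trans[OF interval_inputs_subset] UN_least inputs_written_subset[OF M Yw[OF that]]) auto
        show "mem y M (pos c) ca < 2 ^ b" if "y \<in> Y" "ca < 2 ^ b" for y ca
          using wf_memory_mem[OF M Yw[OF that(1)]] that(2) by (simp add: wf_memory_def)
        show "bad y M \<inter> {pos c..<pos e} \<subseteq> queries \<inter> {pos c..<pos e}" if "y \<in> Y" for y
          using bad_subset by blast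
        show "true_row y k < m" if y: "y \<in> Y" and k: "k \<in> bad y M \<inter> {pos c..<pos e}" for y k
        proof -
          obtain t q u where *: "k < length (labels T)" "labels T ! k = Qry t q u" using k by (auto simp: bad_def)
          then show ?thesis using graph_at_query[OF Yw[OF y] *] column_map_less[OF Yw[OF y]]
            by (simp add: true_row_def)
        qed
        fix y y'
        assume yY: "y \<in> Y" "y' \<in> Y"
          and agree: "\<And>ca. ca \<in> interval_inputs D (ops y) (start M) (pos c) (pos e) \<union>
             interval_inputs D (ops y') (start M) (pos c) (pos e) \<Longrightarrow> mem y M (pos c) ca = mem y' M (pos c) ca"
          and bads: "bad y M \<inter> {pos c..<pos e} = bad y' M \<inter> {pos c..<pos e}"
          and vals: "\<And>k. k \<in> bad y M \<inter> {pos c..<pos e} \<Longrightarrow> true_row y k = true_row y' k"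
        note y = Yw[OF yY(1)] and y' = Yw[OF yY(2)]
        let ?ls = "drop (pos c) (take (pos e) (labels T))"
        have seg: "drop (pos c) (take (pos e) (ops z)) = map (op z) ?ls" for z by (simp add: take_map drop_map)
        have memk: "fold (memory_step D) (map (op z) (take k ?ls)) (mem z M (pos c)) = mem z M (pos c + k)" if "k \<le> pos e - pos c" for z k
          using memory_at_drop[of "pos c" "pos e" "ops z" k D "start M"] that pos
          unfolding seg by (simp add: memory_at_def take_map)
        have "map (op y) ?ls = map (op y') ?ls"
        proof (rule lockstep[where D = D and M = "mem y M (pos c)" and M' = "mem y' M (pos c)"])
          show "mem y M (pos c) ca = mem y' M (pos c) ca"
            if "ca \<in> sequence_inputs D (map (op y) ?ls) (mem y M (pos c)) \<union> sequence_inputs D (map (op y') ?ls) (mem y' M (pos c))" for ca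
            using that agree[of ca] unfolding interval_inputs_def seg by blast
          fix k
          assume k: "k < length ?ls" and ag: "\<And>ca. ca \<in> operation_inputs D (op y (?ls ! k)) (fold (memory_step D) (map (op y) (take k ?ls)) (mem y M (pos c))) \<union>
              operation_inputs D (op y' (?ls ! k)) (fold (memory_step D) (map (op y') (take k ?ls)) (mem y' M (pos c))) \<Longrightarrow>
            fold (memory_step D) (map (op y) (take k ?ls)) (mem y M (pos c)) ca = fold (memory_step D) (map (op y') (take k ?ls)) (mem y' M (pos c)) ca"
          have k': "k < pos e - pos c" "pos c + k < length (labels T)" "pos c + k < pos e" using k pos by auto
          have lk: "?ls ! k = labels T ! (pos c + k)" using k' pos by simp
          \<comment> \<open>An update of the second interval concerns a revealed slot, because slots
            are updated only once and those of \<Gamma> had their turn in the first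
            interval.\<close>
          have "y i = y' i" if l: "labels T ! (pos c + k) = Del i u \<or> labels T ! (pos c + k) = Ins i u" for i u
          proof -
            obtain r where r: "r \<in> {c..<e}" "labels T ! (pos c + k) \<in> set (update_labels r) \<union> set (query_labels r)"
              using nth_label_mem[OF ace(2,3) le_add1 k'(3)] by blast
            then have "upd r = Some i"
              using l upd_in_update_labels[of i u r] no_upd_in_query_labels[of i u r] by auto
            have "i \<notin> \<Gamma>"
            proof
              assume "i \<in> \<Gamma>"
              then obtain t where t: "t \<in> {a..<c}" "upd t = Some i" using \<Gamma>upd by blast
              then have "t = r" using upd_inj \<open>upd r = Some i\<close> by blast
              then show False using t r(1) by simp
            qed
            then show ?thesis using eqoff[OF yY] upd_less[OF \<open>upd r = Some i\<close>] by blast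
          qed
          note upd_eq = this
          have kin: "pos c + k \<in> {pos c..<pos e}" using k' by simp
          have bad_iff: "pos c + k \<in> bad y M \<longleftrightarrow> pos c + k \<in> bad y' M"
            using kin by (metis IntE IntI bads)
          have val_eq: "true_row y (pos c + k) = true_row y' (pos c + k)" if "pos c + k \<in> bad y M"
            by (rule vals[OF IntI[OF that kin]])
          note mems = memk[of k y, OF less_imp_le[OF k'(1)]] memk[of k y', OF less_imp_le[OF k'(1)]]
          show "op y (?ls ! k) = op y' (?ls ! k) \<and>
              operation_writes D (op y (?ls ! k)) (fold (memory_step D) (map (op y) (take k ?ls)) (mem y M (pos c))) =
              operation_writes D (op y' (?ls ! k)) (fold (memory_step D) (map (op y') (take k ?ls)) (mem y' M (pos c)))"
            unfolding lk mems
            by (rule same_step[OF M y y' k'(2) upd_eq ag[unfolded lk mems] bad_iff val_eq])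
        qed
        then have same: "op y l = op y' l" if "l \<in> set ?ls" for l using that by simp
        show "y = y'"
        proof (rule worlds_determined[OF y y' \<Gamma>K eqoff[OF yY], of c qf])
          show "\<Gamma> \<subseteq> slots_done c"
          proof
            fix g assume "g \<in> \<Gamma>"
            then obtain t where "t < c" "upd t = Some g" using \<Gamma>upd[of g] by auto
            then show "g \<in> slots_done c" by (auto simp: slots_done_def)
          qed
          show "g < qf g" if "g \<in> \<Gamma>" for g using qf that by blast
          show "qf g \<le> g'" if "g \<in> \<Gamma>" "g' \<in> \<Gamma>" "g < g'" for g g' using qf that by blast
          fix g assume "g \<in> \<Gamma>"
          then obtain t where t: "t \<in> {c..<e}" "qry t = Some (qf g)" using \<Gamma>qry by blast
          \<comment> \<open>Equal queries have equal target rows, and these are the values of the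
            verified compositions in the two worlds.\<close>
          have "column_map (state y (Suc t)) (qf g) u = column_map (state y' (Suc t)) (qf g) u" if u: "u < m" for u
          proof -
            have "Qry t (qf g) u \<in> set (query_labels t)" using t(2) u by (simp add: query_labels_def)
            then have "Qry t (qf g) u \<in> set ?ls" unfolding set_segment[OF ace(2,3)] using t(1) by blast
            from same[OF this] show ?thesis
              using grid_vertex_eq_iff[OF column_map_less[OF y u, of "Suc t" "qf g"] column_map_less[OF y' u, of "Suc t" "qf g"], of "qf g" "qf g"]
              by simp
          qed
          then show "\<exists>t\<ge>c. \<forall>u<m. column_map (state y (Suc t)) (qf g) u = column_map (state y' (Suc t)) (qf g) u"
            using t(1) by (intro exI[of _ t]) auto
        qed
      qed
      then show ?thesis unfolding Y_def .
    next
      case True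
      then show ?thesis unfolding Y_def by (simp only: sum.empty)
    qed
  qed
  then show ?thesis unfolding * by simp
qed

end

subsection \<open>Summation over a family of pairs of intervals\<close>

lemma sum_intervals_le:
  fixes f :: "nat \<Rightarrow> nat"
  assumes F: "finite F" and I: "\<And>\<phi>. \<phi> \<in> F \<Longrightarrow> I \<phi> \<subseteq> {..<N}"
    and \<mu>: "\<And>k. k < N \<Longrightarrow> card {\<phi> \<in> F. k \<in> I \<phi>} \<le> \<mu>"
  shows "(\<Sum>\<phi>\<in>F. \<Sum>k\<in>I \<phi>. f k) \<le> \<mu> * (\<Sum>k<N. f k)"
proof -
  have "(\<Sum>\<phi>\<in>F. \<Sum>k\<in>I \<phi>. f k) = (\<Sum>\<phi>\<in>F. \<Sum>k<N. if k \<in> I \<phi> then f k else 0)"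
  proof (rule sum.cong[OF refl])
    fix \<phi> assume "\<phi> \<in> F"
    then have "{k \<in> {..<N}. k \<in> I \<phi>} = I \<phi>" using I by blast
    then show "(\<Sum>k\<in>I \<phi>. f k) = (\<Sum>k<N. if k \<in> I \<phi> then f k else 0)"
      by (simp add: sum.inter_filter[symmetric])
  qed
  also have "\<dots> = (\<Sum>k<N. \<Sum>\<phi>\<in>F. if k \<in> I \<phi> then f k else 0)" by (rule sum.swap)
  also have "\<dots> = (\<Sum>k<N. card {\<phi> \<in> F. k \<in> I \<phi>} * f k)"
    using F by (simp add: sum.inter_filter[symmetric])
  also have "\<dots> \<le> (\<Sum>k<N. \<mu> * f k)" by (intro sum_mono mult_right_mono \<mu>) auto
  finally show ?thesis by (simp add: sum_distrib_left)
qed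

lemma total_cost_append: "total_cost D (xs @ ys) M = total_cost D xs M + total_cost D ys (fold (memory_step D) xs M)"
  by (induction xs arbitrary: M) (simp_all add: add.assoc)

section \<open>Counting the operations of a schedule\<close>

context schedule
begin

lemma leaf_exists: "k < pos t \<Longrightarrow> \<exists>r<t. pos r \<le> k \<and> k < pos (Suc r)"
proof (induction t)
  case (Suc t)
  then show ?case by (cases "k < pos t") (auto intro: less_SucI)
qed (simp add: pos_def)

lemma pos_less_imp: "pos a < pos t \<Longrightarrow> a < t"
  using pos_mono by (meson linorder_not_le)

text \<open>Passage from times to operation positions: a position belongs to the operations of some
  time, and every interval containing the position contains that time.\<close>

lemma card_interval_family:
  assumes F: "finite F" and \<mu>: "\<And>t. t < T \<Longrightarrow> card {\<phi> \<in> F. t \<in> {l \<phi>..<r \<phi>}} \<le> \<mu>" and k: "k < pos T"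
  shows "card {\<phi> \<in> F. k \<in> {pos (l \<phi>)..<pos (r \<phi>)}} \<le> \<mu>"
proof -
  obtain t where t: "t < T" "pos t \<le> k" "k < pos (Suc t)" using leaf_exists[OF k] by blast
  have "{\<phi> \<in> F. k \<in> {pos (l \<phi>)..<pos (r \<phi>)}} \<subseteq> {\<phi> \<in> F. t \<in> {l \<phi>..<r \<phi>}}"
  proof safe
    fix \<phi> assume "k \<in> {pos (l \<phi>)..<pos (r \<phi>)}"
    then have "pos (l \<phi>) < pos (Suc t)" "pos t < pos (r \<phi>)" using t by auto
    then show "t \<in> {l \<phi>..<r \<phi>}" by (auto dest!: pos_less_imp)
  qed
  then have "card {\<phi> \<in> F. k \<in> {pos (l \<phi>)..<pos (r \<phi>)}} \<le> card {\<phi> \<in> F. t \<in> {l \<phi>..<r \<phi>}}"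
    using F by (intro card_mono) auto
  then show ?thesis using \<mu>[OF t(1)] by linarith
qed

definition n_upd :: "nat \<Rightarrow> nat" where "n_upd T = card {t. t < T \<and> upd t \<noteq> None}"
definition n_qry :: "nat \<Rightarrow> nat" where "n_qry T = card {t. t < T \<and> qry t \<noteq> None}"

lemma is_query_op: "is_query (op x l) \<longleftrightarrow> (\<exists>t q u. l = Qry t q u)"
  by (cases l) (auto simp: is_query_def)

lemma card_Suc_filter:
  "card {t. t < Suc T \<and> P t} = card {t. t < T \<and> P t} + (if P T then 1 else 0)"
proof -
  have "{t. t < Suc T \<and> P t} = (if P T then insert T {t. t < T \<and> P t} else {t. t < T \<and> P t})"
    by (auto simp: less_Suc_eq)
  then show ?thesis by simp
qed

lemma length_filter_labels:
  "length (filter (\<lambda>l. \<exists>t q u. l = Qry t q u) (labels T)) = m * n_qry T"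
  "length (filter (\<lambda>l. \<not> (\<exists>t q u. l = Qry t q u)) (labels T)) = 2 * m * n_upd T"
proof (induction T)
  case (Suc T)
  have 1: "length (filter (\<lambda>l. \<exists>t q u. l = Qry t q u) (update_labels T)) = 0"
    "length (filter (\<lambda>l. \<not> (\<exists>t q u. l = Qry t q u)) (update_labels T)) = (if upd T \<noteq> None then 2 * m else 0)"
    by (auto simp: update_labels_def o_def split: option.splits)
  have 2: "length (filter (\<lambda>l. \<exists>t q u. l = Qry t q u) (query_labels T)) = (if qry T \<noteq> None then m else 0)"
    "length (filter (\<lambda>l. \<not> (\<exists>t q u. l = Qry t q u)) (query_labels T)) = 0"
    by (auto simp: query_labels_def o_def split: option.splits)
  show "length (filter (\<lambda>l. \<exists>t q u. l = Qry t q u) (labels (Suc T))) = m * n_qry (Suc T)"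
    using Suc(1) 1(1) 2(1) by (simp add: n_qry_def card_Suc_filter)
  show "length (filter (\<lambda>l. \<not> (\<exists>t q u. l = Qry t q u)) (labels (Suc T))) = 2 * m * n_upd (Suc T)"
    using Suc(2) 1(2) 2(2) by (simp add: n_upd_def card_Suc_filter)
qed (simp_all add: n_qry_def n_upd_def)

lemma length_filter_preamble: "length (filter (\<lambda>x. \<not> is_query x) preamble) = K * m" "filter is_query preamble = []"
proof -
  have "\<not> is_query x" if "x \<in> set preamble" for x using that by (auto simp: preamble_def is_query_def)
  then have "filter (\<lambda>x. \<not> is_query x) preamble = preamble" "filter is_query preamble = []" by simp_all
  moreover have "length preamble = K * m" by (simp add: preamble_def length_concat o_def sum_list_triv)
  ultimately show "length (filter (\<lambda>x. \<not> is_query x) preamble) = K * m" "filter is_query preamble = []" by simp_all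
qed

lemma length_filter_sequence:
  "length (filter (\<lambda>x. \<not> is_query x) (preamble @ map (op x) (labels T))) = (K + 2 * n_upd T) * m"
  "length (filter is_query (preamble @ map (op x) (labels T))) = m * n_qry T"
  by (simp_all add: length_filter_preamble filter_map o_def is_query_op length_filter_labels[simplified]
    add_mult_distrib)

end

section \<open>Averages over initial memories and worlds\<close>

context scheduled_structure
begin

lemma card_queries: "card queries = m * n_qry T"
  using length_filter_labels(1)[of T]
  unfolding queries_def length_filter_conv_card by simp

definition cells_touched :: "(nat \<Rightarrow> nat \<Rightarrow> nat) \<Rightarrow> memory \<Rightarrow> nat" where
  "cells_touched x M = (\<Sum>k<length (ops x). card (inputs_at D (ops x) (start M) k) + card (written_at D (ops x) (start M) k))"

abbreviation "initial_memories \<equiv> set_pmf (initial_memory b D)"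

lemma initial_memories: "initial_memories \<noteq> {}" "finite initial_memories"
    "initial_memory b D = pmf_of_set initial_memories"
  using initial_memory_set by (simp_all add: initial_memory_def)

text \<open>The initial memory is uniform on a finite set, so expectations are averages.
  Amortization starts from the empty graph, hence C also pays for the K * m insertions of the
  preamble.\<close>

lemma sum_cells_touched:
  fixes C tu tq :: real
  assumes time: "amortized_expected_time n (path_unions n) b D tu tq" and x: "x \<in> worlds"
    and C: "real ((K + 2 * n_upd T) * m) * tu + real (m * n_qry T) * tq \<le> C" "0 \<le> C"
  shows "(\<Sum>M\<in>initial_memories. real (cells_touched x M)) \<le> card initial_memories * C"
proof -
  let ?S = initial_memories and ?xs = "preamble @ ops x"
  have cS: "card ?S > 0" using initial_memories by (simp add: card_gt_0_iff)
  have "admissible n (path_unions n) {} ?xs" using labels_correct[OF x, of T] by simp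
  then have "(\<integral>\<^sup>+ M. total_cost D ?xs M \<partial>measure_pmf (initial_memory b D)) \<le> ennreal
      (real (length (filter (\<lambda>x. \<not> is_query x) ?xs)) * tu + real (length (filter is_query ?xs)) * tq)"
    using time unfolding amortized_expected_time_def by blast
  also have "\<dots> \<le> ennreal C" unfolding length_filter_sequence using C by (intro ennreal_leI)
  also have "(\<integral>\<^sup>+ M. total_cost D ?xs M \<partial>measure_pmf (initial_memory b D)) = sum (total_cost D ?xs) ?S / card ?S"
    by (subst initial_memories(3), rule nn_integral_pmf_of_set) (use initial_memories in auto)
  finally have le: "sum (total_cost D ?xs) ?S / card ?S \<le> ennreal C" .
  have "of_nat (cells_touched x M) \<le> total_cost D ?xs M" for M
  proof -
    have "of_nat (cells_touched x M) \<le> total_cost D (ops x) (start M)"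
      unfolding cells_touched_def by (rule sum_card_inputs_written)
    also have "\<dots> \<le> total_cost D ?xs M" unfolding total_cost_append by simp
    finally show ?thesis .
  qed
  then have "(\<Sum>M\<in>?S. of_nat (cells_touched x M)) \<le> sum (total_cost D ?xs) ?S" by (intro sum_mono)
  then have "ennreal (real (\<Sum>M\<in>?S. cells_touched x M)) / card ?S \<le> sum (total_cost D ?xs) ?S / card ?S"
    by (intro divide_right_mono_ennreal) (simp add: ennreal_of_nat_eq_real_of_nat)
  also note le
  also have "ennreal (real (\<Sum>M\<in>?S. cells_touched x M)) / card ?S = ennreal (real (\<Sum>M\<in>?S. cells_touched x M) / card ?S)"
    using cS by (simp add: ennreal_of_nat_eq_real_of_nat divide_ennreal sum_nonneg)
  finally have "real (\<Sum>M\<in>?S. cells_touched x M) / card ?S \<le> C" using C by simp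
  then show ?thesis using cS by (simp add: field_simps)
qed

text \<open>A union bound over the m candidate targets of each query.\<close>

lemma sum_card_bad:
  fixes err :: real
  assumes err: "\<And>xs u v. admissible n (path_unions n) {} (xs @ [Connected u v]) \<Longrightarrow>
      measure_pmf.prob (initial_memory b D) {M. \<not> query_ok D M xs u v} \<le> err"
    and x: "x \<in> worlds"
  shows "(\<Sum>M\<in>initial_memories. real (card (bad x M))) \<le> card initial_memories * (card queries * (m * err))"
proof -
  let ?S = initial_memories
  have cS: "card ?S > 0" using initial_memories by (simp add: card_gt_0_iff)
  have fq: "finite queries" by (simp add: queries_def)
  have one: "real (card {M \<in> ?S. k \<in> bad x M}) \<le> card ?S * (m * err)" if kq: "k \<in> queries" for k
  proof -
    obtain t q u where k: "k < length (labels T)" "labels T ! k = Qry t q u" using kq by (auto simp: queries_def)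
    let ?B = "\<lambda>v. {M. \<not> query_ok D M (preamble @ take k (ops x)) (grid_vertex m 0 u) (grid_vertex m q v)}"
    have "{M \<in> ?S. k \<in> bad x M} \<subseteq> (\<Union>v<m. ?S \<inter> ?B v)"
      using k by (auto simp: bad_def)
    then have "card {M \<in> ?S. k \<in> bad x M} \<le> card (\<Union>v<m. ?S \<inter> ?B v)"
      using initial_memories by (intro card_mono) auto
    also have "\<dots> \<le> (\<Sum>v<m. card (?S \<inter> ?B v))" by (rule card_UN_le) simp
    finally have "real (card {M \<in> ?S. k \<in> bad x M}) \<le> (\<Sum>v<m. real (card (?S \<inter> ?B v)))"
      by (simp only: of_nat_le_iff flip: of_nat_sum)
    also have "\<dots> \<le> (\<Sum>v<m. card ?S * err)"
    proof (rule sum_mono)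
      fix v assume "v \<in> {..<m}"
      then have "measure_pmf.prob (initial_memory b D) (?B v) \<le> err"
        using query_at(1)[OF x k, of v] err[of "preamble @ take k (ops x)"] by (simp add: take_map)
      moreover have "measure_pmf.prob (initial_memory b D) (?B v) = card (?S \<inter> ?B v) / card ?S"
        by (subst initial_memories(3), rule measure_pmf_of_set) (use initial_memories in auto)
      ultimately show "real (card (?S \<inter> ?B v)) \<le> card ?S * err" using cS by (simp add: field_simps)
    qed
    finally show ?thesis by (simp add: mult_ac)
  qed
  have "(\<Sum>M\<in>?S. real (card (bad x M))) = (\<Sum>M\<in>?S. \<Sum>k\<in>queries. if k \<in> bad x M then 1 else 0)"
  proof (rule sum.cong[OF refl])
    fix M
    have "{k \<in> queries. k \<in> bad x M} = bad x M" using bad_subset by blast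
    then show "real (card (bad x M)) = (\<Sum>k\<in>queries. if k \<in> bad x M then 1 else 0)"
      using fq by (simp add: sum.inter_filter[symmetric])
  qed
  also have "\<dots> = (\<Sum>k\<in>queries. \<Sum>M\<in>?S. if k \<in> bad x M then 1 else 0)" by (rule sum.swap)
  also have "\<dots> = (\<Sum>k\<in>queries. real (card {M \<in> ?S. k \<in> bad x M}))"
    using initial_memories by (simp add: sum.inter_filter[symmetric])
  also have "\<dots> \<le> (\<Sum>k\<in>queries. card ?S * (m * err))" by (intro sum_mono one)
  finally show ?thesis by (simp add: mult_ac)
qed

text \<open>Transferred cells cost 2 * b bits each but are charged once in the whole family, because
  the rectangles are disjoint. Other reads and writes are charged with multiplicities \<mu>R and
  \<mu>W, at the much lower prices \<open>- log 2 p0\<close> and \<open>- log 2 p1\<close>, which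
  can be balanced against them.\<close>

lemma family_cost_le:
  fixes a c e :: "'f \<Rightarrow> nat"
  assumes p: "0 < p0" "0 < p1" "p0 \<le> 1" "p1 \<le> 1" and F: "finite F"
    and ace: "\<And>\<phi>. \<phi> \<in> F \<Longrightarrow> a \<phi> \<le> c \<phi> \<and> c \<phi> \<le> e \<phi> \<and> e \<phi> \<le> T"
    and disj: "\<And>\<phi> \<psi> s t. \<lbrakk>\<phi> \<in> F; \<psi> \<in> F; s \<in> {a \<phi>..<c \<phi>}; t \<in> {c \<phi>..<e \<phi>}; s \<in> {a \<psi>..<c \<psi>}; t \<in> {c \<psi>..<e \<psi>}\<rbrakk> \<Longrightarrow> \<phi> = \<psi>"
    and \<mu>: "\<And>t. t < T \<Longrightarrow> card {\<phi> \<in> F. t \<in> {a \<phi>..<c \<phi>}} \<le> \<mu>W" "\<And>t. t < T \<Longrightarrow> card {\<phi> \<in> F. t \<in> {c \<phi>..<e \<phi>}} \<le> \<mu>R"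
  shows "(\<Sum>\<phi>\<in>F. node_cost p0 p1 (pos (a \<phi>)) (pos (c \<phi>)) (pos (e \<phi>)) M x) \<le>
    (2 * real b + (- log 2 p0) * \<mu>R + (- log 2 p1) * \<mu>W) * cells_touched x M + 3 * card F
     + 2 * log 2 m * (\<mu>R * card (bad x M)) + 3 / m * (\<mu>R * card queries)"
proof -
  let ?I = "\<lambda>k. card (inputs_at D (ops x) (start M) k)" and ?W = "\<lambda>k. card (written_at D (ops x) (start M) k)"
  let ?p = "\<lambda>\<phi>. pos (a \<phi>)" and ?q = "\<lambda>\<phi>. pos (c \<phi>)" and ?e = "\<lambda>\<phi>. pos (e \<phi>)"
  let ?Ch = "\<lambda>\<phi>. changed D (ops x) (start M) (?p \<phi>) (?q \<phi>)"
    and ?In = "\<lambda>\<phi>. interval_inputs D (ops x) (start M) (?q \<phi>) (?e \<phi>)"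
  define N where "N = pos T"
  have len: "length (ops x) = N" by (simp add: N_def pos_def)
  have ord: "?p \<phi> \<le> ?q \<phi>" "?q \<phi> \<le> ?e \<phi>" "?e \<phi> \<le> N" "?q \<phi> \<le> N" if "\<phi> \<in> F" for \<phi>
    using ace[OF that] pos_mono by (auto simp: N_def)
  have logs: "0 \<le> - log 2 p0" "0 \<le> - log 2 p1" "0 \<le> 2 * log 2 m"
    using p m by auto
  have R: "(\<Sum>\<phi>\<in>F. \<Sum>k\<in>{?q \<phi>..<?e \<phi>}. f k) \<le> \<mu>R * (\<Sum>k<N. f k)" for f :: "nat \<Rightarrow> nat"
    by (rule sum_intervals_le[OF F]) (use ord card_interval_family[OF F \<mu>(2)] in \<open>auto simp: N_def intro: order.strict_trans2\<close>)
  have W: "(\<Sum>\<phi>\<in>F. \<Sum>k\<in>{?p \<phi>..<?q \<phi>}. f k) \<le> \<mu>W * (\<Sum>k<N. f k)" for f :: "nat \<Rightarrow> nat"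
    by (rule sum_intervals_le[OF F]) (use ord card_interval_family[OF F \<mu>(1)] in \<open>auto simp: N_def intro: order.strict_trans2\<close>)
  have c1: "(\<Sum>\<phi>\<in>F. card (?Ch \<phi> \<inter> ?In \<phi>))
      \<le> (\<Sum>k<N. ?I k)"
  proof -
    have "(\<Sum>\<phi>\<in>F. card (?Ch \<phi> \<inter> ?In \<phi>))
      \<le> (\<Sum>\<phi>\<in>F. card (transfers D (ops x) (start M) (?p \<phi>) (?q \<phi>) (?e \<phi>)))"
      by (intro sum_mono card_information_transfer) (use ord len in auto)
    also have "\<dots> \<le> (\<Sum>k<length (ops x). ?I k)"
    proof (rule sum_card_transfers[OF F])
      show "?e \<phi> \<le> length (ops x)" if "\<phi> \<in> F" for \<phi> using ord[OF that] len by simp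
      fix \<phi> \<psi> s k
      assume *: "\<phi> \<in> F" "\<psi> \<in> F" "?p \<phi> \<le> s" "s < ?q \<phi>" "?q \<phi> \<le> k" "k < ?e \<phi>" "?p \<psi> \<le> s" "s < ?q \<psi>" "?q \<psi> \<le> k" "k < ?e \<psi>"
      then have "k < pos T" "s < pos T" using ord[of \<phi>] by (auto simp: N_def)
      then obtain t r where t: "pos t \<le> k" "k < pos (Suc t)" and r: "pos r \<le> s" "s < pos (Suc r)"
        using leaf_exists by meson
      have "pos (c \<phi>) < pos (Suc t)" "pos t < pos (e \<phi>)" "pos (c \<psi>) < pos (Suc t)" "pos t < pos (e \<psi>)"
        "pos (a \<phi>) < pos (Suc r)" "pos r < pos (c \<phi>)" "pos (a \<psi>) < pos (Suc r)" "pos r < pos (c \<psi>)"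
        using * t r by linarith+
      then show "\<phi> = \<psi>" using disj[OF *(1,2), of r t] by (auto dest!: pos_less_imp)
    qed
    finally show ?thesis unfolding len .
  qed
  have c2: "(\<Sum>\<phi>\<in>F. card (?In \<phi>)) \<le> \<mu>R * (\<Sum>k<N. ?I k)"
  proof -
    have "(\<Sum>\<phi>\<in>F. card (?In \<phi>)) \<le> (\<Sum>\<phi>\<in>F. \<Sum>k\<in>{?q \<phi>..<?e \<phi>}. ?I k)"
      by (intro sum_mono card_interval_inputs) (use ord len in auto)
    then show ?thesis using R[of ?I] by linarith
  qed
  have c3: "(\<Sum>\<phi>\<in>F. card (?Ch \<phi>)) \<le> \<mu>W * (\<Sum>k<N. ?W k)"
  proof -
    have "(\<Sum>\<phi>\<in>F. card (?Ch \<phi>)) \<le> (\<Sum>\<phi>\<in>F. \<Sum>k\<in>{?p \<phi>..<?q \<phi>}. ?W k)"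
      by (intro sum_mono card_changed) (use ord len in auto)
    then show ?thesis using W[of ?W] by linarith
  qed
  have cS: "(\<Sum>\<phi>\<in>F. card (S \<inter> {?q \<phi>..<?e \<phi>})) \<le> \<mu>R * card S" if "S \<subseteq> {..<N}" for S
  proof -
    have "{k \<in> {?q \<phi>..<?e \<phi>}. k \<in> S} = S \<inter> {?q \<phi>..<?e \<phi>}" for \<phi> by auto
    then have "(\<Sum>\<phi>\<in>F. card (S \<inter> {?q \<phi>..<?e \<phi>})) = (\<Sum>\<phi>\<in>F. \<Sum>k\<in>{?q \<phi>..<?e \<phi>}. if k \<in> S then 1 else 0)"
      by (simp add: sum.inter_filter[symmetric])
    also have "\<dots> \<le> \<mu>R * (\<Sum>k<N. if k \<in> S then 1 else 0)" by (rule R)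
    also have "(\<Sum>k<N. if k \<in> S then 1 else 0) = card S"
    proof -
      have "{k \<in> {..<N}. k \<in> S} = S" using that by blast
      then show ?thesis by (simp add: sum.inter_filter[symmetric])
    qed
    finally show ?thesis .
  qed
  have QN: "queries \<subseteq> {..<N}" by (auto simp: queries_def N_def pos_def)
  have c4: "(\<Sum>\<phi>\<in>F. card (bad x M \<inter> {?q \<phi>..<?e \<phi>})) \<le> \<mu>R * card (bad x M)"
    using QN bad_subset by (intro cS) blast
  have c5: "(\<Sum>\<phi>\<in>F. card (queries \<inter> {?q \<phi>..<?e \<phi>})) \<le> \<mu>R * card queries"
    by (rule cS[OF QN])
  have touched: "cells_touched x M = (\<Sum>k<N. ?I k) + (\<Sum>k<N. ?W k)"
    unfolding cells_touched_def len by (rule sum.distrib)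
  have "(\<Sum>\<phi>\<in>F. node_cost p0 p1 (?p \<phi>) (?q \<phi>) (?e \<phi>) M x) =
     2 * real b * (\<Sum>\<phi>\<in>F. card (?Ch \<phi> \<inter> ?In \<phi>))
     + (- log 2 p0) * (\<Sum>\<phi>\<in>F. card (?In \<phi>))
     + (- log 2 p1) * (\<Sum>\<phi>\<in>F. card (?Ch \<phi>))
     + 3 * card F + 2 * log 2 m * (\<Sum>\<phi>\<in>F. card (bad x M \<inter> {?q \<phi>..<?e \<phi>}))
     + 3 / m * (\<Sum>\<phi>\<in>F. card (queries \<inter> {?q \<phi>..<?e \<phi>}))"
    unfolding node_cost_def sum.distrib sum_distrib_left of_nat_sum by simp
  also have "\<dots> \<le> 2 * real b * cells_touched x M + (- log 2 p0) * (\<mu>R * cells_touched x M)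
     + (- log 2 p1) * (\<mu>W * cells_touched x M) + 3 * card F + 2 * log 2 m * (\<mu>R * card (bad x M)) + 3 / m * (\<mu>R * card queries)"
  proof -
    have "(\<Sum>\<phi>\<in>F. card (?Ch \<phi> \<inter> ?In \<phi>)) \<le> cells_touched x M"
      using c1 touched by linarith
    moreover have "(\<Sum>\<phi>\<in>F. card (?In \<phi>)) \<le> \<mu>R * cells_touched x M"
      using c2 touched by (simp add: add_mult_distrib2)
    moreover have "(\<Sum>\<phi>\<in>F. card (?Ch \<phi>)) \<le> \<mu>W * cells_touched x M"
      using c3 touched by (simp add: add_mult_distrib2)
    ultimately show ?thesis using c4 c5 logs
      by (intro add_mono order_refl mult_left_mono) (simp_all flip: of_nat_mult of_nat_sum)
  qed
  also have "\<dots> = (2 * real b + (- log 2 p0) * \<mu>R + (- log 2 p1) * \<mu>W) * cells_touched x M + 3 * card F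
     + 2 * log 2 m * (\<mu>R * card (bad x M)) + 3 / m * (\<mu>R * card queries)"
    by (simp add: algebra_simps)
  finally show ?thesis .
qed

text \<open>The entropy bound holds for every initial memory on average over the worlds, the time
  bound for every world on average over the initial memories. Summing over both and exchanging the
  sums brings them together. The - 1 is the slot that may be lost in
  \<open>interleaved_gaps\<close>.\<close>

lemma information_transfer_bound:
  fixes a c e :: "'f \<Rightarrow> nat" and err C tu tq :: real
  assumes p: "0 < p0" "0 < p1" "p0 + p1 = 1 - 1 / 2 ^ b" and F: "finite F"
    and ace: "\<And>\<phi>. \<phi> \<in> F \<Longrightarrow> a \<phi> \<le> c \<phi> \<and> c \<phi> \<le> e \<phi> \<and> e \<phi> \<le> T"
    and disj: "\<And>\<phi> \<psi> s t. \<lbrakk>\<phi> \<in> F; \<psi> \<in> F; s \<in> {a \<phi>..<c \<phi>}; t \<in> {c \<phi>..<e \<phi>}; s \<in> {a \<psi>..<c \<psi>}; t \<in> {c \<psi>..<e \<psi>}\<rbrakk> \<Longrightarrow> \<phi> = \<psi>"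
    and \<mu>: "\<And>t. t < T \<Longrightarrow> card {\<phi> \<in> F. t \<in> {a \<phi>..<c \<phi>}} \<le> \<mu>W" "\<And>t. t < T \<Longrightarrow> card {\<phi> \<in> F. t \<in> {c \<phi>..<e \<phi>}} \<le> \<mu>R"
    and interleaved: "\<And>\<phi>. \<phi> \<in> F \<Longrightarrow> \<exists>\<Gamma> qf. real (N \<phi>) \<le> card \<Gamma> + 1 \<and> (\<forall>g\<in>\<Gamma>. (\<exists>t\<in>{a \<phi>..<c \<phi>}. upd t = Some g) \<and>
        (\<exists>t\<in>{c \<phi>..<e \<phi>}. qry t = Some (qf g)) \<and> g < qf g \<and> (\<forall>g'\<in>\<Gamma>. g < g' \<longrightarrow> qf g \<le> g'))"
    and err: "\<And>xs u v. admissible n (path_unions n) {} (xs @ [Connected u v]) \<Longrightarrow>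
      measure_pmf.prob (initial_memory b D) {M. \<not> query_ok D M xs u v} \<le> err"
    and time: "amortized_expected_time n (path_unions n) b D tu tq"
    and C: "real ((K + 2 * n_upd T) * m) * tu + real (m * n_qry T) * tq \<le> C" "0 \<le> C"
  shows "(\<Sum>\<phi>\<in>F. real (N \<phi>) - 1) * log 2 (fact m) \<le>
     (2 * real b + (- log 2 p0) * \<mu>R + (- log 2 p1) * \<mu>W) * C + 3 * card F
     + \<mu>R * (m * n_qry T) * (2 * log 2 m * (m * err) + 3 / m)"
proof -
  let ?S = initial_memories and ?X = worlds
  let ?cost = "\<lambda>M x. (\<Sum>\<phi>\<in>F. node_cost p0 p1 (pos (a \<phi>)) (pos (c \<phi>)) (pos (e \<phi>)) M x)"
  let ?L = "log 2 (fact m)" and ?A = "2 * real b + (- log 2 p0) * \<mu>R + (- log 2 p1) * \<mu>W"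
  define RHS where "RHS = ?A * C + 3 * card F + \<mu>R * (m * n_qry T) * (2 * log 2 m * (m * err) + 3 / m)"
  have "0 \<le> 1 / (2::real) ^ b" by simp
  then have p1: "p0 \<le> 1" "p1 \<le> 1" using p by linarith+
  have L: "?L \<ge> 0" by (simp add: fact_ge_1)
  have A: "?A \<ge> 0"
    using p p1 by (intro add_nonneg_nonneg mult_nonneg_nonneg) auto
  have cS: "real (card ?S) > 0" using initial_memories by (simp add: card_gt_0_iff)
  have "(\<lambda>i\<in>{..<K}. id) \<in> ?X" by (simp add: worlds_def permutes_id)
  then have cX: "real (card ?X) > 0" using finite_worlds by (auto simp: card_gt_0_iff)
  have lower: "real (card ?X) * ((\<Sum>\<phi>\<in>F. real (N \<phi>) - 1) * ?L) \<le> (\<Sum>x\<in>?X. ?cost M x)" if M: "M \<in> ?S" for M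
  proof -
    have "real (card ?X) * ((\<Sum>\<phi>\<in>F. real (N \<phi>) - 1) * ?L) = (\<Sum>\<phi>\<in>F. real (card ?X) * ((real (N \<phi>) - 1) * ?L))"
      by (simp add: sum_distrib_left sum_distrib_right)
    also have "\<dots> \<le> (\<Sum>\<phi>\<in>F. \<Sum>x\<in>?X. node_cost p0 p1 (pos (a \<phi>)) (pos (c \<phi>)) (pos (e \<phi>)) M x)"
    proof (rule sum_mono)
      fix \<phi> assume \<phi>: "\<phi> \<in> F"
      from interleaved[OF \<phi>] obtain \<Gamma> qf where N: "real (N \<phi>) \<le> card \<Gamma> + 1"
        and \<Gamma>: "\<forall>g\<in>\<Gamma>. (\<exists>t\<in>{a \<phi>..<c \<phi>}. upd t = Some g) \<and> (\<exists>t\<in>{c \<phi>..<e \<phi>}. qry t = Some (qf g)) \<and>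
          g < qf g \<and> (\<forall>g'\<in>\<Gamma>. g < g' \<longrightarrow> qf g \<le> g')"
        by (elim exE conjE)
      have "real (card ?X) * ((real (N \<phi>) - 1) * ?L) \<le> card ?X * (card \<Gamma> * ?L)"
        using N L by (intro mult_left_mono mult_right_mono) auto
      also have "\<dots> \<le> (\<Sum>x\<in>?X. node_cost p0 p1 (pos (a \<phi>)) (pos (c \<phi>)) (pos (e \<phi>)) M x)"
        by (rule node_cost_ge[OF p M, of _ _ _ \<Gamma> qf]) (use ace[OF \<phi>] \<Gamma> in \<open>blast+\<close>)
      finally show "real (card ?X) * ((real (N \<phi>) - 1) * ?L) \<le> (\<Sum>x\<in>?X. node_cost p0 p1 (pos (a \<phi>)) (pos (c \<phi>)) (pos (e \<phi>)) M x)" .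
    qed
    also have "\<dots> = (\<Sum>x\<in>?X. ?cost M x)" by (rule sum.swap)
    finally show ?thesis .
  qed
  have upper: "(\<Sum>M\<in>?S. ?cost M x) \<le> card ?S * RHS" if x: "x \<in> ?X" for x
  proof -
    have "(\<Sum>M\<in>?S. ?cost M x) \<le> (\<Sum>M\<in>?S. ?A * cells_touched x M + 3 * card F
     + 2 * log 2 m * (\<mu>R * card (bad x M)) + 3 / m * (\<mu>R * card queries))"
      by (intro sum_mono family_cost_le[OF p(1,2) p1 F ace disj \<mu>])
    also have "\<dots> = ?A * (\<Sum>M\<in>?S. cells_touched x M) + card ?S * (3 * card F)
      + 2 * log 2 m * \<mu>R * (\<Sum>M\<in>?S. card (bad x M)) + card ?S * (3 / m * (\<mu>R * card queries))"
      unfolding sum.distrib sum_distrib_left of_nat_sum by (simp add: mult_ac)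
    also have "\<dots> \<le> ?A * (card ?S * C) + card ?S * (3 * card F)
      + 2 * log 2 m * \<mu>R * (card ?S * (card queries * (m * err))) + card ?S * (3 / m * (\<mu>R * card queries))"
      using sum_cells_touched[OF time x C] sum_card_bad[OF err x] A m
      by (intro add_mono mult_left_mono order_refl) auto
    also have "\<dots> = card ?S * RHS" by (simp add: RHS_def card_queries algebra_simps)
    finally show ?thesis .
  qed
  have "real (card ?S) * (real (card ?X) * ((\<Sum>\<phi>\<in>F. real (N \<phi>) - 1) * ?L)) = (\<Sum>M\<in>?S. real (card ?X) * ((\<Sum>\<phi>\<in>F. real (N \<phi>) - 1) * ?L))"
    by simp
  also have "\<dots> \<le> (\<Sum>M\<in>?S. \<Sum>x\<in>?X. ?cost M x)" by (intro sum_mono lower)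
  also have "\<dots> = (\<Sum>x\<in>?X. \<Sum>M\<in>?S. ?cost M x)" by (rule sum.swap)
  also have "\<dots> \<le> (\<Sum>x\<in>?X. card ?S * RHS)" by (intro sum_mono upper)
  also have "\<dots> = real (card ?S) * (real (card ?X) * RHS)" by simp
  finally show ?thesis using cS cX unfolding RHS_def by (simp add: mult_le_cancel_left_pos)
qed

end

subsection \<open>Digit reversal\<close>

text \<open>Only the lowest \<open>d\<close> digits of \<open>t\<close> in base \<open>r\<close>
  enter; higher digits are dropped.\<close>

primrec reverse_digits :: "nat \<Rightarrow> nat \<Rightarrow> nat \<Rightarrow> nat" where
  "reverse_digits r 0 t = 0"
| "reverse_digits r (Suc d) t = (t mod r) * r ^ d + reverse_digits r d (t div r)"

lemma reverse_digits_less: "r > 0 \<Longrightarrow> reverse_digits r d t < r ^ d"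
proof (induction d arbitrary: t)
  case (Suc d)
  have "(t mod r) * r ^ d + reverse_digits r d (t div r) < (t mod r + 1) * r ^ d"
    using Suc by simp
  also have "\<dots> \<le> r * r ^ d" using Suc.prems by (intro mult_right_mono) (auto simp: Suc_le_eq)
  finally show ?case by simp
qed simp

text \<open>Low digits become leading digits: an aligned block of r ^ h consecutive times is sent to
  numbers that are evenly spaced at distance r ^ (d - h), with an offset that depends only on the
  block.\<close>

lemma reverse_digits_split:
  assumes "r > 0" "h \<le> d" "w < r ^ h"
  shows "reverse_digits r d (s * r ^ h + w) = reverse_digits r h w * r ^ (d - h) + reverse_digits r (d - h) s"
  using assms(2,3)
proof (induction h arbitrary: d w)
  case (Suc h)
  then obtain d' where d: "d = Suc d'" "h \<le> d'" by (cases d) auto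
  have eq: "s * r ^ Suc h + w = w + r * (s * r ^ h)" by simp
  have "(s * r ^ Suc h + w) mod r = w mod r" unfolding eq by simp
  moreover have "(s * r ^ Suc h + w) div r = s * r ^ h + w div r"
    unfolding eq using assms(1) by (subst div_mult_self2) auto
  moreover have "w div r < r ^ h" using Suc.prems(2) by (simp add: less_mult_imp_div_less mult.commute)
  moreover have "r ^ d' = r ^ h * r ^ (d' - h)" using d by (simp flip: power_add)
  ultimately show ?case using Suc.IH[of d' "w div r"] d by (simp add: add_mult_distrib)
qed simp

lemma reverse_digits_inj: "r > 0 \<Longrightarrow> inj_on (reverse_digits r d) {..<r ^ d}"
proof (induction d)
  case (Suc d)
  show ?case
  proof (rule inj_onI)
    fix x y assume xy: "x \<in> {..<r ^ Suc d}" "y \<in> {..<r ^ Suc d}" "reverse_digits r (Suc d) x = reverse_digits r (Suc d) y"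
    have div: "reverse_digits r (Suc d) z div r ^ d = z mod r" "reverse_digits r (Suc d) z mod r ^ d = reverse_digits r d (z div r)" for z
      using reverse_digits_less[OF Suc.prems, of d "z div r"] Suc.prems by simp_all
    have "x mod r = y mod r" "reverse_digits r d (x div r) = reverse_digits r d (y div r)"
      using div[of x] div[of y] xy(3) by simp_all
    moreover have "x div r < r ^ d" "y div r < r ^ d" using xy by (simp_all add: less_mult_imp_div_less mult.commute)
    ultimately show "x = y" using inj_onD[OF Suc.IH[OF Suc.prems], of "x div r" "y div r"]
      by (metis div_mult_mod_eq lessThan_iff)
  qed
qed (simp add: lessThan_Suc)

lemma reverse_digits_image: "r > 0 \<Longrightarrow> reverse_digits r d ` {..<r ^ d} = {..<r ^ d}"
  by (rule endo_inj_surj) (auto simp: reverse_digits_less reverse_digits_inj)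

text \<open>Both families have at most one number in each gap of length \<open>G\<close>, at the
  fixed offsets \<open>f1\<close> and \<open>f2\<close>. If \<open>f1 < f2\<close>, the prefix that
  isolates a slot ends in the same gap, otherwise in the next one. Since one of the families
  occupies all \<open>L\<close> gaps, the shift loses at most one slot.\<close>

lemma interleaved_gaps:
  fixes G L f1 f2 :: nat
  assumes f: "f1 < G" "f2 < G" and \<Delta>: "\<Delta>1 \<subseteq> {..<L}" "\<Delta>2 \<subseteq> {..<L}" "\<Delta>1 = {..<L} \<or> \<Delta>2 = {..<L}"
    and S: "\<And>\<gamma>. \<gamma> \<in> \<Delta>1 \<Longrightarrow> \<gamma> * G + f1 \<in> S" and Q: "\<And>\<gamma>. \<gamma> \<in> \<Delta>2 \<Longrightarrow> \<gamma> * G + f2 \<in> Q"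
  shows "\<exists>\<Gamma> qf. card (\<Delta>1 \<inter> \<Delta>2) \<le> card \<Gamma> + 1 \<and>
    (\<forall>g\<in>\<Gamma>. g \<in> S \<and> qf g \<in> Q \<and> g < qf g \<and> (\<forall>g'\<in>\<Gamma>. g < g' \<longrightarrow> qf g \<le> g'))"
proof -
  have fin: "finite \<Delta>1" "finite \<Delta>2" using \<Delta> finite_subset by blast+
  \<comment> \<open>Here \<open>z\<close> is the number of gaps, 0 or 1, by which a prefix is
    shifted against its slot.\<close>
  obtain \<Delta> z where z: "\<And>\<gamma>. \<gamma> \<in> \<Delta> \<Longrightarrow> \<gamma> \<in> \<Delta>1 \<and> \<gamma> + z \<in> \<Delta>2" "card (\<Delta>1 \<inter> \<Delta>2) \<le> card \<Delta> + 1"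
    "f1 < z * G + f2" "z * G + f2 \<le> G + f1" "finite \<Delta>"
  proof (cases "f1 < f2")
    case True
    show ?thesis by (rule that[of "\<Delta>1 \<inter> \<Delta>2" 0]) (use True f fin in auto)
  next
    case False
    define \<Delta> where "\<Delta> = {\<gamma> \<in> \<Delta>1. \<gamma> + 1 \<in> \<Delta>2}"
    have fin\<Delta>: "finite \<Delta>" using fin by (simp add: \<Delta>_def)
    \<comment> \<open>If all slots are present, only a prefix in gap 0 has no slot one gap earlier;
      if all prefixes are present, only a slot in the last gap has no prefix one gap later.\<close>
    have "card (\<Delta>1 \<inter> \<Delta>2) \<le> card \<Delta> + 1" using \<Delta>(3)
    proof
      assume all: "\<Delta>1 = {..<L}"
      then have "\<Delta>1 \<inter> \<Delta>2 \<subseteq> insert 0 (Suc ` \<Delta>)"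
      proof (intro subsetI)
        fix \<gamma> assume "\<gamma> \<in> \<Delta>1 \<inter> \<Delta>2"
        then show "\<gamma> \<in> insert 0 (Suc ` \<Delta>)" using all \<Delta>(2) by (cases \<gamma>) (auto simp: \<Delta>_def)
      qed
      then have "card (\<Delta>1 \<inter> \<Delta>2) \<le> card (insert 0 (Suc ` \<Delta>))" using fin\<Delta> by (intro card_mono) auto
      also have "\<dots> \<le> Suc (card (Suc ` \<Delta>))" using fin\<Delta> by (simp add: card_insert_if)
      finally show ?thesis by (simp add: card_image)
    next
      assume all: "\<Delta>2 = {..<L}"
      then have "\<Delta>1 \<inter> \<Delta>2 \<subseteq> insert (L - 1) \<Delta>" using \<Delta>(1) by (auto simp: \<Delta>_def)
      then have "card (\<Delta>1 \<inter> \<Delta>2) \<le> card (insert (L - 1) \<Delta>)" using fin\<Delta> by (intro card_mono) auto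
      also have "\<dots> \<le> Suc (card \<Delta>)" using fin\<Delta> by (simp add: card_insert_if)
      finally show ?thesis by simp
    qed
    then show ?thesis by (intro that[of \<Delta> 1]) (use False f fin\<Delta> in \<open>auto simp: \<Delta>_def\<close>)
  qed
  define \<Gamma> where "\<Gamma> = (\<lambda>\<gamma>. \<gamma> * G + f1) ` \<Delta>"
  have dv: "(\<gamma> * G + f1) div G = \<gamma>" for \<gamma> using f by simp
  have "inj_on (\<lambda>\<gamma>. \<gamma> * G + f1) \<Delta>" by (rule inj_on_inverseI[of _ "\<lambda>g. g div G"]) (rule dv)
  then have "card \<Gamma> = card \<Delta>" unfolding \<Gamma>_def by (rule card_image)
  moreover have "g \<in> S \<and> (g div G + z) * G + f2 \<in> Q \<and> g < (g div G + z) * G + f2 \<and>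
      (\<forall>g'\<in>\<Gamma>. g < g' \<longrightarrow> (g div G + z) * G + f2 \<le> g')" if g: "g \<in> \<Gamma>" for g
  proof -
    obtain \<gamma> where \<gamma>: "\<gamma> \<in> \<Delta>" "g = \<gamma> * G + f1" using g by (auto simp: \<Gamma>_def)
    have "(g div G + z) * G + f2 \<le> g'" if g': "g' \<in> \<Gamma>" "g < g'" for g'
    proof -
      obtain \<gamma>' where \<gamma>': "g' = \<gamma>' * G + f1" using g' by (auto simp: \<Gamma>_def)
      then have "\<gamma> < \<gamma>'" using g'(2) \<gamma>(2) by simp
      then have "(\<gamma> + 1) * G \<le> \<gamma>' * G" by (intro mult_right_mono) auto
      then show ?thesis using z(4) unfolding \<gamma>' \<gamma>(2) dv by (simp add: add_mult_distrib)
    qed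
    moreover have "(\<gamma> + z) * G + f2 \<in> Q" "\<gamma> * G + f1 \<in> S" using z(1)[OF \<gamma>(1)] S Q by blast+
    moreover have "\<gamma> * G + f1 < (\<gamma> + z) * G + f2" using z(3) by (simp add: add_mult_distrib)
    ultimately show ?thesis unfolding \<gamma>(2) dv by blast
  qed
  ultimately show ?thesis using z(2) by (intro exI[of _ \<Gamma>] exI[of _ "\<lambda>g. (g div G + z) * G + f2"]) auto
qed


subsection \<open>The hierarchy of intervals\<close>

text \<open>The node \<open>(l, q)\<close> stands for the times from \<open>q * r ^ l\<close> up to
  \<open>(q + 1) * r ^ l\<close>, out of r ^ (D + 1) in total; its parent is
  \<open>(l + 1, q div r)\<close> and its rank among its siblings is \<open>q mod r\<close>. Level 0
  is left out because the slower operation occurs only at every r-th time, and the root because it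
  has no siblings.\<close>

definition tree_nodes :: "nat \<Rightarrow> nat \<Rightarrow> (nat \<times> nat) set" where
  "tree_nodes r D = (SIGMA l:{1..D}. {..<r ^ (D + 1 - l)})"

lemma finite_tree_nodes: "finite (tree_nodes r D)"
  by (simp add: tree_nodes_def)

lemma card_tree_nodes: "r > 0 \<Longrightarrow> card (tree_nodes r D) \<le> D * r ^ (D + 1)"
proof -
  assume r: "r > 0"
  have "card (tree_nodes r D) = (\<Sum>l\<in>{1..D}. r ^ (D + 1 - l))" by (simp add: tree_nodes_def)
  also have "\<dots> \<le> (\<Sum>l\<in>{1..D}. r ^ (D + 1))" using r by (intro sum_mono power_increasing) auto
  finally show ?thesis by simp
qed

lemma node_end_le:
  assumes "(l, q) \<in> tree_nodes r D"
  shows "(q + 1) * r ^ l \<le> r ^ (D + 1)" "(q div r + 1) * r ^ (l + 1) \<le> r ^ (D + 1)"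
proof -
  have l: "1 \<le> l" "l \<le> D" "q < r ^ (D + 1 - l)" using assms by (auto simp: tree_nodes_def)
  have "(q + 1) * r ^ l \<le> r ^ (D + 1 - l) * r ^ l" using l by (intro mult_right_mono) auto
  also have "\<dots> = r ^ (D + 1)" using l by (simp flip: power_add)
  finally show "(q + 1) * r ^ l \<le> r ^ (D + 1)" .
  have "q < r ^ (D - l) * r" using l by (simp add: Suc_diff_le mult.commute)
  then have "q div r < r ^ (D - l)" by (rule less_mult_imp_div_less)
  then have "(q div r + 1) * r ^ (l + 1) \<le> r ^ (D - l) * r ^ (l + 1)" by (intro mult_right_mono) auto
  also have "\<dots> = r ^ (D + 1)" using l by (simp flip: power_add power_Suc)
  finally show "(q div r + 1) * r ^ (l + 1) \<le> r ^ (D + 1)" .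
qed

lemma div_eq_iff: "(0::nat) < L \<Longrightarrow> t \<in> {q * L..<(q + 1) * L} \<longleftrightarrow> t div L = q"
  using div_nat_eqI[of L q t] dividend_less_div_times[of L t] by (auto simp: mult.commute add.commute)

lemma child_interval:
  fixes q r :: nat
  assumes "r > 0"
  shows "{q * r ^ l..<(q + 1) * r ^ l} \<subseteq> {(q div r) * r ^ (l + 1)..<(q div r + 1) * r ^ (l + 1)}"
proof -
  have "q div r * r \<le> q" by simp
  then have "q div r * r * r ^ l \<le> q * r ^ l" by (intro mult_right_mono) auto
  moreover have "q < (q div r + 1) * r" using assms dividend_less_div_times[of r q] by simp
  then have "(q + 1) * r ^ l \<le> (q div r + 1) * r * r ^ l" by (intro mult_right_mono) auto
  ultimately show ?thesis unfolding power_add power_one_right mult.assoc[symmetric] mult.commute[of "r ^ l" r]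
    by (simp only: mult.assoc) auto
qed

text \<open>Ancestors that coincide at one level coincide at all higher ones, so two times part at a
  single level. A pair of a write and a later read is thus charged to one level only.\<close>

lemma level_unique:
  fixes s t :: nat
  assumes "r > 0" "s div r ^ (l + 1) = t div r ^ (l + 1)" "s div r ^ l \<noteq> t div r ^ l"
    "s div r ^ (l' + 1) = t div r ^ (l' + 1)" "s div r ^ l' \<noteq> t div r ^ l'"
  shows "l = l'"
proof -
  have mono: "s div r ^ j = t div r ^ j" if "s div r ^ i = t div r ^ i" "i \<le> j" for i j
  proof -
    have "r ^ j = r ^ i * r ^ (j - i)" using that by (simp flip: power_add)
    then show ?thesis using that by (simp add: div_mult2_eq)
  qed
  show ?thesis using assms mono[of "l + 1" l'] mono[of "l' + 1" l] by (metis Suc_eq_plus1 not_less_eq_eq le_antisym)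
qed

lemma card_nodes_at:
  assumes r: "r > 0" and X: "X \<subseteq> tree_nodes r D" and q: "\<And>l q. (l, q) \<in> X \<Longrightarrow> q = t div r ^ l"
  shows "card X \<le> D"
proof -
  have "X \<subseteq> (\<lambda>l. (l, t div r ^ l)) ` {1..D}" using X q by (fastforce simp: tree_nodes_def)
  then have "card X \<le> card ((\<lambda>l. (l, t div r ^ l)) ` {1..D})" by (intro card_mono) auto
  also have "\<dots> \<le> card {1..D}" by (rule card_image_le) simp
  finally show ?thesis by simp
qed

text \<open>A time lies in a sibling interval of up to r nodes per level. The factor r over
  \<open>card_nodes_at\<close> is compensated by the price of order 1 / r in
  \<open>separator_weights\<close>.\<close>

lemma card_nodes_below:
  assumes r: "r > 0" and X: "X \<subseteq> tree_nodes r D" and q: "\<And>l q. (l, q) \<in> X \<Longrightarrow> q div r = t div r ^ (l + 1)"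
  shows "card X \<le> D * r"
proof -
  have "X \<subseteq> (SIGMA l:{1..D}. {(t div r ^ (l + 1)) * r..<(t div r ^ (l + 1) + 1) * r})"
  proof
    fix \<phi> assume \<phi>: "\<phi> \<in> X"
    obtain l q where lq: "\<phi> = (l, q)" by force
    have "l \<in> {1..D}" using X \<phi> by (auto simp: tree_nodes_def lq)
    moreover have "q \<in> {(t div r ^ (l + 1)) * r..<(t div r ^ (l + 1) + 1) * r}"
      using q[of l q] \<phi> div_eq_iff[OF r] unfolding lq by blast
    ultimately show "\<phi> \<in> (SIGMA l:{1..D}. {(t div r ^ (l + 1)) * r..<(t div r ^ (l + 1) + 1) * r})"
      unfolding lq by simp
  qed
  then have "card X \<le> card (SIGMA l:{1..D}. {(t div r ^ (l + 1)) * r..<(t div r ^ (l + 1) + 1) * r})"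
    by (intro card_mono) auto
  then show ?thesis by simp
qed

lemma sum_mod: "(\<Sum>q<k * r. f (q mod r)) = real k * (\<Sum>j<r. f j)" for f :: "nat \<Rightarrow> real"
proof (induction k)
  case (Suc k)
  have "(\<Sum>q<Suc k * r. f (q mod r)) = (\<Sum>q<k * r. f (q mod r)) + (\<Sum>q=k * r..<k * r + r. f (q mod r))"
    by (metis add.commute lessThan_atLeast0 mult_Suc sum.atLeastLessThan_concat zero_le le_add1)
  also have "(\<Sum>q=k * r..<k * r + r. f (q mod r)) = (\<Sum>j<r. f j)"
    using sum.shift_bounds_nat_ivl[of "\<lambda>q. f (q mod r)" 0 "k * r" r]
    by (simp add: add.commute lessThan_atLeast0)
  finally show ?case using Suc by (simp add: algebra_simps)
qed simp

text \<open>Here \<open>g\<close> counts the siblings on one side, on average (r - 1) / 2, and a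
  sibling at level \<open>l\<close> contains r ^ (l - 1) slow operations. Each level thus
  contributes almost half of r ^ (D + 1); the factor 1/4 absorbs the one slot lost per node.\<close>

lemma sum_tree_nodes:
  assumes r: "r \<ge> 16" and g: "(\<Sum>j<r. real (g j)) = real r * (real r - 1) / 2"
  shows "(\<Sum>(l, q)\<in>tree_nodes r D. real (g (q mod r) * r ^ (l - 1)) - 1) \<ge> real D * r ^ (D + 1) / 4"
proof -
  have "(\<Sum>(l, q)\<in>tree_nodes r D. real (g (q mod r) * r ^ (l - 1)) - 1) =
      (\<Sum>l\<in>{1..D}. \<Sum>q<r ^ (D + 1 - l). real (g (q mod r) * r ^ (l - 1)) - 1)"
    unfolding tree_nodes_def by (subst sum.Sigma) auto
  also have "\<dots> \<ge> (\<Sum>l\<in>{1..D}. real (r ^ (D + 1)) / 4)"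
  proof (rule sum_mono)
    fix l assume l: "l \<in> {1..D}"
    define k where "k = r ^ (D - l)"
    have n: "r ^ (D + 1 - l) = k * r" using l by (simp add: k_def Suc_diff_le mult.commute)
    have "r ^ (D + 1) = r ^ ((D - l) + 1 + 1 + (l - 1))" using l by simp
    then have T: "r ^ (D + 1) = k * r * r * r ^ (l - 1)" unfolding power_add k_def by simp
    have "(\<Sum>q<r ^ (D + 1 - l). real (g (q mod r) * r ^ (l - 1)) - 1) =
        real k * (real r * (real r - 1) / 2) * r ^ (l - 1) - real k * r"
      unfolding n by (simp add: sum_subtractf sum_mod[of "\<lambda>j. real (g j)"] g flip: sum_distrib_right)
    moreover have "real (r ^ (D + 1)) / 4 \<le> real k * (real r * (real r - 1) / 2) * r ^ (l - 1) - real k * r"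
    proof -
      define P where "P = real (r ^ (l - 1))"
      have P: "P \<ge> 1" using r by (simp add: P_def)
      have R: "real r \<ge> 16" using r by simp
      have "real r * P / 4 + 1 \<le> (real r - 1) / 2 * P"
      proof -
        have "(real r / 4 - 1 / 2) * P \<ge> (real r / 4 - 1 / 2) * 1" using P R by (intro mult_left_mono) auto
        then show ?thesis using R by (simp add: field_simps)
      qed
      then have "real k * r * (real r * P / 4 + 1) \<le> real k * r * ((real r - 1) / 2 * P)"
        by (intro mult_left_mono) auto
      then show ?thesis unfolding T by (simp add: P_def field_simps)
    qed
    ultimately show "real (r ^ (D + 1)) / 4 \<le> (\<Sum>q<r ^ (D + 1 - l). real (g (q mod r) * r ^ (l - 1)) - 1)" by linarith
  qed
  finally show ?thesis by simp
qed

lemma sum_indices: "(\<Sum>j<r. real j) = real r * (real r - 1) / 2"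
  by (induction r) (auto simp: field_simps)

lemma sum_indices_reversed: "(\<Sum>j<r. real (r - 1 - j)) = real r * (real r - 1) / 2"
  using sum.nat_diff_reindex[of real r] unfolding diff_diff_left plus_1_eq_Suc sum_indices .

subsection \<open>The two regimes\<close>

lemma dvd_bounded_card:
  fixes r :: nat
  assumes "r > 0"
  shows "card {t. t < r ^ (D + 1) \<and> r dvd t} \<le> r ^ D"
proof -
  have "{t. t < r ^ (D + 1) \<and> r dvd t} \<subseteq> (\<lambda>q. q * r) ` {..<r ^ D}"
  proof
    fix t assume "t \<in> {t. t < r ^ (D + 1) \<and> r dvd t}"
    then obtain q where "t = q * r" "t < r ^ D * r" by (auto simp: dvd_def mult.commute)
    then show "t \<in> (\<lambda>q. q * r) ` {..<r ^ D}" by auto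
  qed
  then have "card {t. t < r ^ (D + 1) \<and> r dvd t} \<le> card ((\<lambda>q. q * r) ` {..<r ^ D})" by (intro card_mono) auto
  also have "\<dots> \<le> card {..<r ^ D}" by (rule card_image_le) simp
  finally show ?thesis by simp
qed

text \<open>Accesses counted D * r times get the weight \<open>p\<close> and cost at most 6 / r
  each, accesses counted D times get the weight 1 / r and cost log 2 r. Both products are at most of
  order D * log 2 r per probe. The 6 is 3 times the deficit 1 - p, which is at most 2 / r.\<close>

lemma separator_weights:
  assumes r: "r \<ge> 16" and b: "r \<le> (2::nat) ^ b"
  defines "p \<equiv> 1 - 1 / real r - 1 / 2 ^ b"
  shows "0 < p" "1 / real r + p = 1 - 1 / 2 ^ b" "- log 2 p * real r \<le> 6" "- log 2 (1 / real r) = log 2 r"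
proof -
  have R: "real r \<ge> 16" using r by simp
  have "real r \<le> 2 ^ b" using b by (metis numeral_power_eq_of_nat_cancel_iff of_nat_le_iff)
  then have le: "1 / 2 ^ b \<le> 1 / real r" using R by (intro divide_left_mono) auto
  have small: "1 / real r \<le> 1 / 16" using R by simp
  show "0 < p" using le small by (simp add: p_def)
  show "1 / real r + p = 1 - 1 / 2 ^ b" by (simp add: p_def)
  define y where "y = 1 / real r + 1 / 2 ^ b"
  have "0 \<le> y" using R by (simp add: y_def)
  moreover have y: "y \<le> 2 * (1 / real r)" using le by (simp add: y_def)
  moreover have "y \<le> 1 / 2" using y small by linarith
  ultimately have "- log 2 (1 - y) \<le> 3 * (2 * (1 / real r))" using neg_log_one_minus_le[of y] by linarith
  moreover have "1 - y = p" by (simp add: y_def p_def)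
  ultimately have "- log 2 p \<le> 6 / real r" by simp
  then have "- log 2 p * real r \<le> 6 / real r * real r" by (intro mult_right_mono) auto
  then show "- log 2 p * real r \<le> 6" using R by simp
  show "- log 2 (1 / real r) = log 2 r" using R by (simp add: log_divide)
qed

text \<open>The common conclusion of both regimes, with \<open>t\<close> the time of the faster
  operation. The factor \<open>4 * (r ^ (D + 1) * m * t)\<close> bounds the expected cost of the
  whole sequence, preamble included.\<close>

definition transfer_inequality :: "nat \<Rightarrow> nat \<Rightarrow> nat \<Rightarrow> nat \<Rightarrow> real \<Rightarrow> real \<Rightarrow> bool" where
  "transfer_inequality b r D m t err \<longleftrightarrow>
     real D * r ^ (D + 1) / 4 * log 2 (fact m) \<le> (2 * real b + real D * (log 2 r + 6)) * (4 * (r ^ (D + 1) * m * t))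
     + 3 * (D * r ^ (D + 1)) + D * (m * r ^ (D + 1)) * (2 * log 2 m * (m * err) + 3 / m)"

definition nearly_correct :: "nat \<Rightarrow> nat \<Rightarrow> real \<Rightarrow> data_structure \<Rightarrow> bool" where
  "nearly_correct n b err S \<longleftrightarrow> wf_structure n b S \<and>
     (\<forall>xs u v. admissible n (path_unions n) {} (xs @ [Connected u v]) \<longrightarrow>
       (\<forall>M \<in> set_pmf (initial_memory b S). (\<exists>p. connected_query S u v = Deterministic p) \<or> query_ok S M xs u v) \<and>
       measure_pmf.prob (initial_memory b S) {M. \<not> query_ok S M xs u v} \<le> err)"

text \<open>Queries take place at every time, updates at every r-th one. The rectangle of a node
  pairs the updates of its older siblings with its own queries; writes then have multiplicity D * r
  and reads multiplicity D, so \<open>p1\<close> is the weight close to 1.\<close>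

lemma slow_updates_bound:
  fixes tu tq err :: real
  assumes correct: "nearly_correct n b err S" and m: "m \<ge> 2" and r: "r \<ge> 16" "r \<le> 2 ^ b" and room: "(r ^ D + 1) * m \<le> n"
    and time: "amortized_expected_time n (path_unions n) b S tu tq"
    and tu: "0 \<le> tu" "0 \<le> tq" "tu \<le> real r * tq"
  shows "transfer_inequality b r D m tq err"
proof -
  have r0: "r > 0" using r by simp
  have wf: "wf_structure n b S" using correct by (simp add: nearly_correct_def)
  define T where "T = r ^ (D + 1)"
  \<comment> \<open>Both use \<open>D\<close> digits: an update those of \<open>t div r\<close>, a
    query the lowest \<open>D\<close> of the \<open>D + 1\<close> digits of \<open>t\<close>. Below
    \<open>T\<close> every slot is updated once and every prefix length below \<open>r ^ D\<close>
    is verified \<open>r\<close> times.\<close>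
  define upd where "upd t = (if t < T \<and> r dvd t then Some (reverse_digits r D (t div r)) else None)" for t
  define qry where "qry t = Some (reverse_digits r D t)" for t
  have b: "b \<ge> 1" using r by (cases b) auto
  interpret scheduled_structure n m "r ^ D" upd qry b T S
  proof unfold_locales
    show "(r ^ D + 1) * m \<le> n" "m \<ge> 2" "wf_structure n b S" "1 \<le> b" using room m wf b by auto
    show "i < r ^ D" if "upd t = Some i" for t i
      using that reverse_digits_less[OF r0] by (auto simp: upd_def split: if_splits)
    show "t = t'" if "upd t = Some i" "upd t' = Some i" for t t' i
    proof -
      have *: "t < T" "t' < T" "r dvd t" "r dvd t'" "reverse_digits r D (t div r) = reverse_digits r D (t' div r)"
        using that by (auto simp: upd_def split: if_splits)
      then have "t div r < r ^ D" "t' div r < r ^ D" by (simp_all add: T_def less_mult_imp_div_less mult.commute)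
      then have "t div r = t' div r" using inj_onD[OF reverse_digits_inj[OF r0, of D] *(5)] by simp
      then show "t = t'" using *(3,4) by (metis dvd_div_mult_self)
    qed
    show "q \<le> r ^ D" if "qry t = Some q" for t q
      using that reverse_digits_less[OF r0, of D t] by (simp add: qry_def)
    show "(\<exists>p. connected_query S u v = Deterministic p) \<or> query_ok S M xs u v"
      if "M \<in> set_pmf (initial_memory b S)" "admissible n (path_unions n) {} (xs @ [Connected u v])" for M xs u v
      using correct that unfolding nearly_correct_def by blast
  qed
  let ?F = "tree_nodes r D"
  define a c e where "a = (\<lambda>(l, q). (q div r) * r ^ (l + 1))" and "c = (\<lambda>(l, q). q * r ^ l)"
    and "e = (\<lambda>(l, q). (q + 1) * r ^ l)"
  define N where "N = (\<lambda>(l, q). (q mod r) * r ^ (l - 1))"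
  define p1 where "p1 = 1 - 1 / real r - 1 / 2 ^ b"
  note weights = separator_weights[OF r, folded p1_def]
  have below: "s div r ^ (l + 1) = q div r" "s div r ^ l \<noteq> q" if "s \<in> {a (l, q)..<c (l, q)}" for s l q
  proof -
    have "s \<in> {(q div r) * r ^ (l + 1)..<(q div r + 1) * r ^ (l + 1)}"
      using that child_interval[OF r0, of q l] r0 by (auto simp: a_def c_def)
    then show "s div r ^ (l + 1) = q div r" using div_eq_iff[of "r ^ (l + 1)"] r0 by simp
    have "s \<notin> {q * r ^ l..<(q + 1) * r ^ l}" using that by (simp add: c_def)
    then show "s div r ^ l \<noteq> q" using div_eq_iff[of "r ^ l" s q] zero_less_power[OF r0, of l] by blast
  qed
  have at: "t div r ^ l = q" "t div r ^ (l + 1) = q div r" if "t \<in> {c (l, q)..<e (l, q)}" for t l q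
  proof -
    have "t \<in> {q * r ^ l..<(q + 1) * r ^ l}" using that by (simp add: c_def e_def)
    then show *: "t div r ^ l = q" using div_eq_iff[of "r ^ l" t q] zero_less_power[OF r0, of l] by blast
    show "t div r ^ (l + 1) = q div r" unfolding power_add power_one_right div_mult2_eq * ..
  qed
  have bound: "(\<Sum>\<phi>\<in>?F. real (N \<phi>) - 1) * log 2 (fact m) \<le>
     (2 * real b + (- log 2 (1 / real r)) * D + (- log 2 p1) * real (D * r)) * (4 * (T * m * tq)) + 3 * card ?F
     + D * (m * n_qry T) * (2 * log 2 m * (m * err) + 3 / m)"
  proof (rule information_transfer_bound[where a = a and c = c and e = e])
    show "0 < 1 / real r" "0 < p1" "1 / real r + p1 = 1 - 1 / 2 ^ b" using r0 weights by auto
    show "finite ?F" by (rule finite_tree_nodes)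
    show "a \<phi> \<le> c \<phi> \<and> c \<phi> \<le> e \<phi> \<and> e \<phi> \<le> T" if "\<phi> \<in> ?F" for \<phi>
    proof -
      obtain l q where lq: "\<phi> = (l, q)" by force
      have "q div r * r * r ^ l \<le> q * r ^ l" by (intro mult_right_mono) auto
      then show ?thesis using node_end_le(1)[of l q r D] that by (simp add: lq a_def c_def e_def T_def mult.assoc)
    qed
    show "\<phi> = \<psi>" if "\<phi> \<in> ?F" "\<psi> \<in> ?F" "s \<in> {a \<phi>..<c \<phi>}" "t \<in> {c \<phi>..<e \<phi>}" "s \<in> {a \<psi>..<c \<psi>}" "t \<in> {c \<psi>..<e \<psi>}"
      for \<phi> \<psi> s t
    proof -
      obtain l q l' q' where lq: "\<phi> = (l, q)" "\<psi> = (l', q')" by force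
      note * = that[unfolded lq]
      have "l = l'" using level_unique[OF r0, of s l t l'] below[OF *(3)] below[OF *(5)] at[OF *(4)] at[OF *(6)] by metis
      then show ?thesis using at(1)[OF *(4)] at(1)[OF *(6)] lq by simp
    qed
    show "card {\<phi> \<in> ?F. t \<in> {a \<phi>..<c \<phi>}} \<le> D * r" for t
      by (rule card_nodes_below[OF r0, where t = t]) (use below(1)[of t] in \<open>(blast, metis (lifting) mem_Collect_eq)\<close>)
    show "card {\<phi> \<in> ?F. t \<in> {c \<phi>..<e \<phi>}} \<le> D" for t
      by (rule card_nodes_at[OF r0, where t = t]) (use at(1)[of t] in \<open>(blast, metis (lifting) mem_Collect_eq)\<close>)
    show "\<exists>\<Gamma> qf. real (N \<phi>) \<le> card \<Gamma> + 1 \<and> (\<forall>g\<in>\<Gamma>. (\<exists>t\<in>{a \<phi>..<c \<phi>}. upd t = Some g) \<and>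
        (\<exists>t\<in>{c \<phi>..<e \<phi>}. qry t = Some (qf g)) \<and> g < qf g \<and> (\<forall>g'\<in>\<Gamma>. g < g' \<longrightarrow> qf g \<le> g'))" if \<phi>: "\<phi> \<in> ?F" for \<phi>
    proof -
      obtain l q where lq: "\<phi> = (l, q)" by force
      have l: "1 \<le> l" "l \<le> D" using \<phi> by (auto simp: tree_nodes_def lq)
      let ?G = "r ^ (D - l)" and ?f1 = "reverse_digits r (D - l) (q div r)" and ?f2 = "reverse_digits r (D - l) q"
      have jl: "(q mod r) * r ^ (l - 1) \<le> r ^ l"
      proof -
        have "(q mod r) * r ^ (l - 1) \<le> r * r ^ (l - 1)" using r0 by (intro mult_right_mono) auto
        then show ?thesis using l by (simp flip: power_Suc)
      qed
      have S: "\<gamma> * ?G + ?f1 \<in> {g. \<exists>t\<in>{a \<phi>..<c \<phi>}. upd t = Some g}"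
        if \<gamma>: "\<gamma> \<in> reverse_digits r l ` {..<(q mod r) * r ^ (l - 1)}" for \<gamma>
      proof -
        obtain w where w: "w < (q mod r) * r ^ (l - 1)" "\<gamma> = reverse_digits r l w" using \<gamma> by auto
        \<comment> \<open>Update times are multiples of r. Divided by r, the parent begins at
          \<open>(q div r) * r ^ l\<close>, and \<open>w\<close> numbers the updates of the older
          siblings from there.\<close>
        let ?t = "((q div r) * r ^ l + w) * r"
        have "w * r < (q mod r) * r ^ (l - 1) * r" using w r0 by simp
        then have "w * r < (q mod r) * r ^ l" using l by (simp add: mult.assoc flip: power_Suc2)
        moreover have "q * r ^ l = (q div r) * r ^ (l + 1) + (q mod r) * r ^ l"
        proof -
          have "q * r ^ l = (q div r * r + q mod r) * r ^ l" by simp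
          then show ?thesis by (simp only: add_mult_distrib add_mult_distrib2 power_add power_one_right mult_ac)
        qed
        ultimately have tin: "?t \<in> {a \<phi>..<c \<phi>}" by (simp add: lq a_def c_def add_mult_distrib algebra_simps)
        moreover have "c \<phi> \<le> T" using node_end_le(1)[of l q r D] \<phi> by (simp add: lq c_def T_def)
        ultimately have "upd ?t = Some (reverse_digits r D ((q div r) * r ^ l + w))"
          using r0 by (simp add: upd_def)
        also have "reverse_digits r D ((q div r) * r ^ l + w) = \<gamma> * ?G + ?f1"
          using reverse_digits_split[OF r0 l(2), of w "q div r"] w jl by simp
        finally show ?thesis using tin by blast
      qed
      have Q: "\<gamma> * ?G + ?f2 \<in> {k. \<exists>t\<in>{c \<phi>..<e \<phi>}. qry t = Some k}" if \<gamma>: "\<gamma> \<in> {..<r ^ l}" for \<gamma>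
      proof -
        obtain y where y: "y < r ^ l" "\<gamma> = reverse_digits r l y" using \<gamma> reverse_digits_image[OF r0, of l] by (metis imageE lessThan_iff)
        have "qry (q * r ^ l + y) = Some (\<gamma> * ?G + ?f2)"
          using reverse_digits_split[OF r0 l(2) y(1), of q] y by (simp add: qry_def)
        moreover have "q * r ^ l + y \<in> {c \<phi>..<e \<phi>}" using y by (simp add: lq c_def e_def)
        ultimately show ?thesis by blast
      qed
      have sub: "reverse_digits r l ` {..<(q mod r) * r ^ (l - 1)} \<subseteq> {..<r ^ l}"
        using reverse_digits_less[OF r0, of l] by auto
      have "inj_on (reverse_digits r l) {..<(q mod r) * r ^ (l - 1)}"
        by (rule inj_on_subset[OF reverse_digits_inj[OF r0]]) (use jl in auto)
      then have cN: "card (reverse_digits r l ` {..<(q mod r) * r ^ (l - 1)} \<inter> {..<r ^ l}) = N \<phi>"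
        using sub by (simp add: Int_absorb2 card_image N_def lq)
      have "\<exists>\<Gamma> qf. card (reverse_digits r l ` {..<(q mod r) * r ^ (l - 1)} \<inter> {..<r ^ l}) \<le> card \<Gamma> + 1 \<and>
          (\<forall>g\<in>\<Gamma>. g \<in> {g. \<exists>t\<in>{a \<phi>..<c \<phi>}. upd t = Some g} \<and> qf g \<in> {k. \<exists>t\<in>{c \<phi>..<e \<phi>}. qry t = Some k} \<and>
            g < qf g \<and> (\<forall>g'\<in>\<Gamma>. g < g' \<longrightarrow> qf g \<le> g'))"
        by (rule interleaved_gaps[OF reverse_digits_less[OF r0] reverse_digits_less[OF r0] sub order_refl disjI2[OF refl] S Q])
      then obtain \<Gamma> qf where card\<Gamma>: "N \<phi> \<le> card \<Gamma> + 1"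
        and \<Gamma>: "\<forall>g\<in>\<Gamma>. (\<exists>t\<in>{a \<phi>..<c \<phi>}. upd t = Some g) \<and> (\<exists>t\<in>{c \<phi>..<e \<phi>}. qry t = Some (qf g)) \<and>
          g < qf g \<and> (\<forall>g'\<in>\<Gamma>. g < g' \<longrightarrow> qf g \<le> g')"
        unfolding mem_Collect_eq cN by (elim exE conjE)
      have "real (N \<phi>) \<le> card \<Gamma> + 1" using card\<Gamma> by simp
      then show ?thesis by (intro exI[of _ \<Gamma>] exI[of _ qf] conjI \<Gamma>)
    qed
    show "measure_pmf.prob (initial_memory b S) {M. \<not> query_ok S M xs u v} \<le> err"
      if "admissible n (path_unions n) {} (xs @ [Connected u v])" for xs u v
      using correct that unfolding nearly_correct_def by blast
    show "amortized_expected_time n (path_unions n) b S tu tq" by (rule time)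
    show "0 \<le> 4 * (T * m * tq)" using tu by simp
    have "n_upd T \<le> r ^ D"
    proof -
      have "{t. t < T \<and> upd t \<noteq> None} = {t. t < r ^ (D + 1) \<and> r dvd t}" by (auto simp: upd_def T_def)
      then show ?thesis using dvd_bounded_card[OF r0, of D] by (simp add: n_upd_def)
    qed
    \<comment> \<open>One insertion per edge in the preamble and two operations per edge in an
      update make the factor 3; with \<open>tu \<le> r * tq\<close> this is three times the cost of
      all queries.\<close>
    then have le: "(r ^ D + 2 * n_upd T) * m \<le> 3 * r ^ D * m" by (intro mult_right_mono) auto
    have "real ((r ^ D + 2 * n_upd T) * m) * tu \<le> real (3 * r ^ D * m) * (r * tq)"
      by (intro mult_mono of_nat_mono le) (use tu in auto)
    also have "\<dots> = 3 * (T * m * tq)" by (simp add: T_def)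
    finally have "real ((r ^ D + 2 * n_upd T) * m) * tu \<le> 3 * (T * m * tq)" .
    moreover have "real (m * n_qry T) * tq = T * m * tq" by (simp add: n_qry_def qry_def)
    ultimately show "real ((r ^ D + 2 * n_upd T) * m) * tu + real (m * n_qry T) * tq \<le> 4 * (T * m * tq)"
      by linarith
  qed
  have "real D * T / 4 \<le> (\<Sum>\<phi>\<in>?F. real (N \<phi>) - 1)"
    using sum_tree_nodes[OF r(1) sum_indices, of D] by (simp add: N_def T_def case_prod_unfold)
  then have "real D * T / 4 * log 2 (fact m) \<le> (\<Sum>\<phi>\<in>?F. real (N \<phi>) - 1) * log 2 (fact m)"
    by (intro mult_right_mono) auto
  also note bound
  also have "(2 * real b + (- log 2 (1 / real r)) * D + (- log 2 p1) * real (D * r)) * (4 * (T * m * tq)) + 3 * card ?F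
     + D * (m * n_qry T) * (2 * log 2 m * (m * err) + 3 / m)
     \<le> (2 * real b + real D * (log 2 r + 6)) * (4 * (T * m * tq)) + 3 * (D * T)
     + D * (m * T) * (2 * log 2 m * (m * err) + 3 / m)"
  proof -
    have "real D * (- log 2 p1 * real r) \<le> real D * 6" using weights by (intro mult_left_mono) auto
    then have "2 * real b + (- log 2 (1 / real r)) * D + (- log 2 p1) * real (D * r) \<le> 2 * real b + real D * (log 2 r + 6)"
      unfolding weights(4) by (simp add: algebra_simps)
    then have "(2 * real b + (- log 2 (1 / real r)) * D + (- log 2 p1) * real (D * r)) * (4 * (T * m * tq)) \<le>
        (2 * real b + real D * (log 2 r + 6)) * (4 * (T * m * tq))"
      using tu by (intro mult_right_mono) auto
    moreover have "real (3 * card ?F) \<le> real (3 * (D * T))"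
      using card_tree_nodes[OF r0, of D] unfolding T_def by (intro of_nat_mono mult_left_mono) auto
    moreover have "n_qry T = T" by (simp add: n_qry_def qry_def)
    ultimately show ?thesis by (intro add_mono) simp_all
  qed
  finally show ?thesis unfolding T_def transfer_inequality_def by simp
qed

lemma div_mult_le_self: "q div r * r ^ (l + 1) \<le> (q + 1) * r ^ l" for q r :: nat
proof -
  have "q div r * r * r ^ l \<le> (q + 1) * r ^ l" by (intro mult_right_mono trans_le_add1) simp_all
  then show ?thesis by (simp add: mult.assoc)
qed

lemma path_unions_empty: "{} \<in> path_unions n"
  using path_unions_of_increasing_injection[of "\<lambda>_. None" n] by simp

text \<open>The mirror image: the rectangle of a node pairs its own updates with the queries of its
  younger siblings, so reads now have multiplicity D * r and \<open>p0\<close> is the weight close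
  to 1. Updates occur at every time, which requires a slot for each of the r ^ (D + 1)
  times.\<close>

lemma slow_queries_bound:
  fixes tu tq err :: real
  assumes correct: "nearly_correct n b err S" and m: "m \<ge> 2" and r: "r \<ge> 16" "r \<le> 2 ^ b" and room: "(r ^ (D + 1) + 1) * m \<le> n"
    and time: "amortized_expected_time n (path_unions n) b S tu tq"
    and tu: "0 \<le> tu" "0 \<le> tq" "tq \<le> real r * tu"
  shows "transfer_inequality b r D m tu err"
proof -
  have r0: "r > 0" using r by simp
  have wf: "wf_structure n b S" using correct by (simp add: nearly_correct_def)
  define T where "T = r ^ (D + 1)"
  define upd where "upd t = (if t < T then Some (reverse_digits r (D + 1) t) else None)" for t
  define qry where "qry t = (if r dvd t then Some (reverse_digits r (D + 1) (t div r)) else None)" for t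
  have b: "b \<ge> 1" using r by (cases b) auto
  interpret scheduled_structure n m "r ^ (D + 1)" upd qry b T S
  proof unfold_locales
    show "(r ^ (D + 1) + 1) * m \<le> n" "m \<ge> 2" "wf_structure n b S" "1 \<le> b" using room m wf b by auto
    show "i < r ^ (D + 1)" if "upd t = Some i" for t i
      using that reverse_digits_less[OF r0, of "D + 1" t] by (auto simp: upd_def split: if_splits)
    show "t = t'" if "upd t = Some i" "upd t' = Some i" for t t' i
    proof -
      have "t < T" "t' < T" "reverse_digits r (D + 1) t = reverse_digits r (D + 1) t'"
        using that by (auto simp: upd_def split: if_splits)
      then show "t = t'" using inj_onD[OF reverse_digits_inj[OF r0, of "D + 1"], of t t'] by (simp add: T_def)
    qed
    show "q \<le> r ^ (D + 1)" if "qry t = Some q" for t q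
      using that reverse_digits_less[OF r0, of "D + 1" "t div r"] by (simp add: qry_def split: if_splits)
    show "(\<exists>p. connected_query S u v = Deterministic p) \<or> query_ok S M xs u v"
      if "M \<in> set_pmf (initial_memory b S)" "admissible n (path_unions n) {} (xs @ [Connected u v])" for M xs u v
      using correct that unfolding nearly_correct_def by blast
  qed
  let ?F = "tree_nodes r D"
  define a c e where "a = (\<lambda>(l, q). q * r ^ l)" and "c = (\<lambda>(l, q). (q + 1) * r ^ l)"
    and "e = (\<lambda>(l, q). (q div r + 1) * r ^ (l + 1))"
  define N where "N = (\<lambda>(l, q). (r - 1 - q mod r) * r ^ (l - 1))"
  define p1 where "p1 = 1 - 1 / real r - 1 / 2 ^ b"
  note weights = separator_weights[OF r, folded p1_def]
  have at: "s div r ^ l = q" "s div r ^ (l + 1) = q div r" if "s \<in> {a (l, q)..<c (l, q)}" for s l q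
  proof -
    have "s \<in> {q * r ^ l..<(q + 1) * r ^ l}" using that by (simp add: a_def c_def)
    then show *: "s div r ^ l = q" using div_eq_iff[of "r ^ l" s q] zero_less_power[OF r0, of l] by blast
    show "s div r ^ (l + 1) = q div r" unfolding power_add power_one_right div_mult2_eq * ..
  qed
  have above: "t div r ^ (l + 1) = q div r" "t div r ^ l \<noteq> q" if "t \<in> {c (l, q)..<e (l, q)}" for t l q
  proof -
    have "{(q + 1) * r ^ l..<(q div r + 1) * r ^ (l + 1)} \<subseteq> {(q div r) * r ^ (l + 1)..<(q div r + 1) * r ^ (l + 1)}"
      using div_mult_le_self[of q r l] by auto
    then have "t \<in> {(q div r) * r ^ (l + 1)..<(q div r + 1) * r ^ (l + 1)}" using that by (auto simp: c_def e_def)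
    then show "t div r ^ (l + 1) = q div r" using div_eq_iff[of "r ^ (l + 1)" t "q div r"] zero_less_power[OF r0, of "l + 1"] by blast
    have "t \<notin> {q * r ^ l..<(q + 1) * r ^ l}" using that by (simp add: c_def)
    then show "t div r ^ l \<noteq> q" using div_eq_iff[of "r ^ l" t q] zero_less_power[OF r0, of l] by blast
  qed
  have n_qry: "n_qry T \<le> r ^ D"
  proof -
    have "{t. t < T \<and> qry t \<noteq> None} = {t. t < r ^ (D + 1) \<and> r dvd t}" by (auto simp: qry_def T_def)
    then show ?thesis using dvd_bounded_card[OF r0, of D] by (simp add: n_qry_def)
  qed
  have bound: "(\<Sum>\<phi>\<in>?F. real (N \<phi>) - 1) * log 2 (fact m) \<le>
     (2 * real b + (- log 2 p1) * real (D * r) + (- log 2 (1 / real r)) * D) * (4 * (T * m * tu)) + 3 * card ?F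
     + (D * r) * (m * n_qry T) * (2 * log 2 m * (m * err) + 3 / m)"
  proof (rule information_transfer_bound[where a = a and c = c and e = e])
    show "0 < p1" "0 < 1 / real r" "p1 + 1 / real r = 1 - 1 / 2 ^ b" using r0 weights by (auto simp: add.commute)
    show "finite ?F" by (rule finite_tree_nodes)
    show "a \<phi> \<le> c \<phi> \<and> c \<phi> \<le> e \<phi> \<and> e \<phi> \<le> T" if "\<phi> \<in> ?F" for \<phi>
    proof -
      obtain l q where lq: "\<phi> = (l, q)" by force
      have "(q + 1) * r ^ l \<le> (q div r + 1) * r ^ (l + 1)"
        using child_interval[OF r0, of q l] r0 by (simp add: atLeastLessThan_subset_iff)
      then show ?thesis using node_end_le(2)[of l q r D] that by (simp add: lq a_def c_def e_def T_def)
    qed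
    show "\<phi> = \<psi>" if "\<phi> \<in> ?F" "\<psi> \<in> ?F" "s \<in> {a \<phi>..<c \<phi>}" "t \<in> {c \<phi>..<e \<phi>}" "s \<in> {a \<psi>..<c \<psi>}" "t \<in> {c \<psi>..<e \<psi>}"
      for \<phi> \<psi> s t
    proof -
      obtain l q l' q' where lq: "\<phi> = (l, q)" "\<psi> = (l', q')" by force
      note * = that[unfolded lq]
      have "l = l'" using level_unique[OF r0, of s l t l'] at[OF *(3)] at[OF *(5)] above[OF *(4)] above[OF *(6)] by metis
      then show ?thesis using at(1)[OF *(3)] at(1)[OF *(5)] lq by simp
    qed
    show "card {\<phi> \<in> ?F. t \<in> {a \<phi>..<c \<phi>}} \<le> D" for t
      by (rule card_nodes_at[OF r0, where t = t]) (use at(1)[of t] in \<open>(blast, metis (lifting) mem_Collect_eq)\<close>)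
    show "card {\<phi> \<in> ?F. t \<in> {c \<phi>..<e \<phi>}} \<le> D * r" for t
      by (rule card_nodes_below[OF r0, where t = t]) (use above(1)[of t] in \<open>(blast, metis (lifting) mem_Collect_eq)\<close>)
    show "\<exists>\<Gamma> qf. real (N \<phi>) \<le> card \<Gamma> + 1 \<and> (\<forall>g\<in>\<Gamma>. (\<exists>t\<in>{a \<phi>..<c \<phi>}. upd t = Some g) \<and>
        (\<exists>t\<in>{c \<phi>..<e \<phi>}. qry t = Some (qf g)) \<and> g < qf g \<and> (\<forall>g'\<in>\<Gamma>. g < g' \<longrightarrow> qf g \<le> g'))" if \<phi>: "\<phi> \<in> ?F" for \<phi>
    proof -
      obtain l q where lq: "\<phi> = (l, q)" by force
      have l: "1 \<le> l" "l \<le> D" using \<phi> by (auto simp: tree_nodes_def lq)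
      let ?G = "r ^ (D + 1 - l)" and ?f1 = "reverse_digits r (D + 1 - l) q" and ?f2 = "reverse_digits r (D + 1 - l) (q div r)"
      have lD: "l \<le> D + 1" using l by simp
      let ?I = "{(q mod r + 1) * r ^ (l - 1)..<r ^ l}"
      have S: "\<gamma> * ?G + ?f1 \<in> {g. \<exists>t\<in>{a \<phi>..<c \<phi>}. upd t = Some g}" if \<gamma>: "\<gamma> \<in> {..<r ^ l}" for \<gamma>
      proof -
        obtain y where y: "y < r ^ l" "\<gamma> = reverse_digits r l y" using \<gamma> reverse_digits_image[OF r0, of l] by (metis imageE lessThan_iff)
        have tin: "q * r ^ l + y \<in> {a \<phi>..<c \<phi>}" using y by (simp add: lq a_def c_def)
        moreover have "c \<phi> \<le> T" using node_end_le(1)[of l q r D] \<phi> by (simp add: lq c_def T_def)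
        ultimately have "upd (q * r ^ l + y) = Some (\<gamma> * ?G + ?f1)"
          using reverse_digits_split[OF r0 lD y(1), of q] y(2) unfolding upd_def by (simp del: reverse_digits.simps)
        then show ?thesis using tin by blast
      qed
      have Q: "\<gamma> * ?G + ?f2 \<in> {k. \<exists>t\<in>{c \<phi>..<e \<phi>}. qry t = Some k}" if \<gamma>: "\<gamma> \<in> reverse_digits r l ` ?I" for \<gamma>
      proof -
        obtain w where w: "(q mod r + 1) * r ^ (l - 1) \<le> w" "w < r ^ l" "\<gamma> = reverse_digits r l w" using \<gamma> by auto
        let ?t = "((q div r) * r ^ l + w) * r"
        have "(q mod r + 1) * r ^ (l - 1) * r \<le> w * r" using w by (intro mult_right_mono) auto
        moreover have "r ^ l = r ^ (l - 1) * r" using l by (simp flip: power_Suc2)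
        ultimately have "(q mod r + 1) * r ^ l \<le> w * r" by (simp only: mult.assoc)
        moreover have "(q + 1) * r ^ l = (q div r) * r ^ (l + 1) + (q mod r + 1) * r ^ l"
        proof -
          have "(q + 1) * r ^ l = (q div r * r + q mod r + 1) * r ^ l" by simp
          then show ?thesis by (simp only: add_mult_distrib add_mult_distrib2 power_add power_one_right mult_ac add_ac)
        qed
        moreover have "?t = (q div r) * r ^ (l + 1) + w * r" by (simp add: add_mult_distrib)
        moreover have "(q div r + 1) * r ^ (l + 1) = (q div r) * r ^ (l + 1) + r ^ l * r" by (simp add: add_mult_distrib)
        moreover have "w * r < r ^ l * r" using w r0 by simp
        ultimately have "c \<phi> \<le> ?t" "?t < e \<phi>" unfolding lq c_def e_def prod.case by linarith+
        moreover have "qry ?t = Some (\<gamma> * ?G + ?f2)"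
          using reverse_digits_split[OF r0 lD w(2), of "q div r"] w(3) r0 unfolding qry_def by (simp del: reverse_digits.simps)
        ultimately show ?thesis by (intro CollectI bexI[of _ ?t]) auto
      qed
      have sub: "reverse_digits r l ` ?I \<subseteq> {..<r ^ l}"
        using reverse_digits_less[OF r0, of l] by auto
      have "inj_on (reverse_digits r l) ?I"
        by (rule inj_on_subset[OF reverse_digits_inj[OF r0]]) auto
      moreover have "r ^ l - (q mod r + 1) * r ^ (l - 1) = N \<phi>"
      proof -
        have "r ^ l = r * r ^ (l - 1)" using l by (simp flip: power_Suc)
        then show ?thesis by (simp add: N_def lq diff_mult_distrib)
      qed
      ultimately have cN: "card ({..<r ^ l} \<inter> reverse_digits r l ` ?I) = N \<phi>"
        using sub by (simp add: Int_absorb1 card_image)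
      have "\<exists>\<Gamma> qf. card ({..<r ^ l} \<inter> reverse_digits r l ` ?I) \<le> card \<Gamma> + 1 \<and>
          (\<forall>g\<in>\<Gamma>. g \<in> {g. \<exists>t\<in>{a \<phi>..<c \<phi>}. upd t = Some g} \<and> qf g \<in> {k. \<exists>t\<in>{c \<phi>..<e \<phi>}. qry t = Some k} \<and>
            g < qf g \<and> (\<forall>g'\<in>\<Gamma>. g < g' \<longrightarrow> qf g \<le> g'))"
        by (rule interleaved_gaps[OF reverse_digits_less[OF r0] reverse_digits_less[OF r0] order_refl sub disjI1[OF refl] S Q])
      then obtain \<Gamma> qf where card\<Gamma>: "N \<phi> \<le> card \<Gamma> + 1"
        and \<Gamma>: "\<forall>g\<in>\<Gamma>. (\<exists>t\<in>{a \<phi>..<c \<phi>}. upd t = Some g) \<and> (\<exists>t\<in>{c \<phi>..<e \<phi>}. qry t = Some (qf g)) \<and>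
          g < qf g \<and> (\<forall>g'\<in>\<Gamma>. g < g' \<longrightarrow> qf g \<le> g')"
        unfolding mem_Collect_eq cN by (elim exE conjE)
      have "real (N \<phi>) \<le> card \<Gamma> + 1" using card\<Gamma> by simp
      then show ?thesis by (intro exI[of _ \<Gamma>] exI[of _ qf] conjI \<Gamma>)
    qed
    show "measure_pmf.prob (initial_memory b S) {M. \<not> query_ok S M xs u v} \<le> err"
      if "admissible n (path_unions n) {} (xs @ [Connected u v])" for xs u v
      using correct that unfolding nearly_correct_def by blast
    show "amortized_expected_time n (path_unions n) b S tu tq" by (rule time)
    show "0 \<le> 4 * (T * m * tu)" using tu by simp
    have "{t. t < T \<and> upd t \<noteq> None} = {..<T}" by (auto simp: upd_def)
    then have "n_upd T = T" by (simp add: n_upd_def)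
    then have "real ((r ^ (D + 1) + 2 * n_upd T) * m) * tu = 3 * (T * m * tu)" by (simp add: T_def)
    moreover have "real (m * n_qry T) * tq \<le> real (m * r ^ D) * (r * tu)"
      by (intro mult_mono of_nat_mono mult_left_mono n_qry) (use tu in auto)
    moreover have "real (m * r ^ D) * (r * tu) = T * m * tu" by (simp add: T_def)
    ultimately show "real ((r ^ (D + 1) + 2 * n_upd T) * m) * tu + real (m * n_qry T) * tq \<le> 4 * (T * m * tu)"
      by linarith
  qed
  have "real D * T / 4 \<le> (\<Sum>\<phi>\<in>?F. real (N \<phi>) - 1)"
    using sum_tree_nodes[OF r(1) sum_indices_reversed, of D] by (simp add: N_def T_def case_prod_unfold)
  then have "real D * T / 4 * log 2 (fact m) \<le> (\<Sum>\<phi>\<in>?F. real (N \<phi>) - 1) * log 2 (fact m)"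
    by (intro mult_right_mono) auto
  also note bound
  also have "(2 * real b + (- log 2 p1) * real (D * r) + (- log 2 (1 / real r)) * D) * (4 * (T * m * tu)) + 3 * card ?F
     + (D * r) * (m * n_qry T) * (2 * log 2 m * (m * err) + 3 / m)
     \<le> (2 * real b + real D * (log 2 r + 6)) * (4 * (T * m * tu)) + 3 * (D * T)
     + D * (m * T) * (2 * log 2 m * (m * err) + 3 / m)"
  proof -
    have "real D * (- log 2 p1 * real r) \<le> real D * 6" using weights by (intro mult_left_mono) auto
    then have "2 * real b + (- log 2 (1 / real r)) * D + (- log 2 p1) * real (D * r) \<le> 2 * real b + real D * (log 2 r + 6)"
      unfolding weights(4) by (simp add: algebra_simps)
    then have "(2 * real b + (- log 2 p1) * real (D * r) + (- log 2 (1 / real r)) * D) * (4 * (T * m * tu)) \<le>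
        (2 * real b + real D * (log 2 r + 6)) * (4 * (T * m * tu))"
      using tu by (intro mult_right_mono) auto
    moreover have "real (3 * card ?F) \<le> real (3 * (D * T))"
      using card_tree_nodes[OF r0, of D] unfolding T_def by (intro of_nat_mono mult_left_mono) auto
    \<comment> \<open>Queries occur at every r-th time only, which makes up for the multiplicity D *
      r with which the advice about answers is counted.\<close>
    moreover have "real (D * r * (m * n_qry T)) * (2 * log 2 m * (m * err) + 3 / m) \<le> real (D * (m * T)) * (2 * log 2 m * (m * err) + 3 / m)"
    proof (intro mult_right_mono of_nat_mono)
      have "D * r * (m * n_qry T) \<le> D * r * (m * r ^ D)" by (intro mult_left_mono n_qry) auto
      then show "D * r * (m * n_qry T) \<le> D * (m * T)" by (simp add: T_def mult_ac)
      have "admissible n (path_unions n) {} ([] @ [Connected 0 0])" using path_unions_empty room m by auto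
      then have "0 \<le> err" using correct order.trans[OF measure_nonneg] unfolding nearly_correct_def by blast
      then show "0 \<le> 2 * log 2 m * (m * err) + 3 / m" using m by simp
    qed
    ultimately show ?thesis by linarith
  qed
  finally show ?thesis unfolding T_def transfer_inequality_def by simp
qed

subsection \<open>Operations cannot be free\<close>

lemma path_unions_one_edge: "2 \<le> n \<Longrightarrow> {{0, 1}} \<in> path_unions n"
proof -
  assume n: "2 \<le> n"
  define f where "f = [0 :: nat \<mapsto> 1 :: nat]"
  have "{{u, v} | u v. f u = Some v} \<in> path_unions n"
    by (rule path_unions_of_increasing_injection) (use n in \<open>auto simp: f_def split: if_splits\<close>)
  moreover have "{{u, v} | u v. f u = Some v} = {{0, 1}}" by (auto simp: f_def split: if_splits)
  ultimately show ?thesis by simp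
qed

lemma probes_zero: "probes p M = 0 \<Longrightarrow> \<exists>x. p = Return x"
  by (cases p) auto

text \<open>If no thread probes on one memory, every thread is already a \<open>Return\<close>, so
  the answer is the same on all memories.\<close>

lemma free_query_constant:
  assumes "query_cost q M = 0"
  shows "answer q N = answer q N'"
proof (cases q)
  case (Deterministic p)
  then show ?thesis using assms probes_zero[of p M] by auto
next
  case (Nondeterministic T)
  have "result p N = result p N'" if "p \<in> T" for p
  proof -
    have "of_nat (probes p M) \<le> query_cost q M"
      using that unfolding Nondeterministic query_cost.simps by (rule SUP_upper)
    then show ?thesis using assms probes_zero[of p M] by auto
  qed
  then show ?thesis by (simp add: Nondeterministic)
qed

lemma query_cost_ge_1:
  assumes "query_cost q M \<noteq> 0"
  shows "1 \<le> query_cost q M"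
proof (cases q)
  case (Deterministic p)
  then have "(of_nat 1 :: ennreal) \<le> of_nat (probes p M)"
    using assms by (intro of_nat_mono) (cases "probes p M"; simp)
  then show ?thesis by (simp add: Deterministic)
next
  case (Nondeterministic T)
  have "\<exists>p\<in>T. probes p M \<noteq> 0"
  proof (rule ccontr)
    assume "\<not> ?thesis"
    then have "query_cost q M \<le> 0" unfolding Nondeterministic query_cost.simps by (intro SUP_least) auto
    then show False using assms by simp
  qed
  then obtain p where p: "p \<in> T" "probes p M \<noteq> 0" by blast
  then have "(of_nat 1 :: ennreal) \<le> of_nat (probes p M)" by (intro of_nat_mono) simp
  also have "\<dots> \<le> query_cost q M"
    using p(1) unfolding Nondeterministic query_cost.simps by (rule SUP_upper)
  finally show ?thesis by simp
qed

text \<open>A free query or a free insertion would give the same answer before and after an edge is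
  inserted, so on every memory one of the two answers would be wrong; two error probabilities below
  1/2 exclude this. The quotients of running times are thereby meaningful.\<close>

lemma times_ge_1:
  fixes err :: real
  assumes n: "n \<ge> 2" and small: "err < 1 / 2"
    and correct: "nearly_correct n b err S"
    and time: "amortized_expected_time n (path_unions n) b S tu tq"
  shows "1 \<le> tu" "1 \<le> tq"
proof -
  let ?q = "connected_query S 0 1" and ?p = "measure_pmf (initial_memory b S)"
  have adm: "admissible n (path_unions n) {} ([] @ [Connected 0 1])"
    "admissible n (path_unions n) {} ([Insert 0 1] @ [Connected 0 1])"
    "admissible n (path_unions n) {} [Insert 0 1]"
    using n path_unions_empty path_unions_one_edge by auto
  have "(0, 1) \<notin> {(x, y). {x, y} \<in> ({} :: graph)}\<^sup>*" by simp
  then have truth: "\<not> same_component {} 0 1" "same_component (graph_step (Insert 0 1) {}) 0 1"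
    unfolding same_component_def by auto
  have differ: "\<exists>M. answer ?q M \<noteq> answer ?q (memory_step S (Insert 0 1) M)"
  proof (rule ccontr)
    assume "\<not> ?thesis"
    then have "UNIV = {M. \<not> query_ok S M [] 0 1} \<union> {M. \<not> query_ok S M [Insert 0 1] 0 1}"
      using truth unfolding query_ok_def by auto
    then have "1 = measure_pmf.prob (initial_memory b S) ({M. \<not> query_ok S M [] 0 1} \<union> {M. \<not> query_ok S M [Insert 0 1] 0 1})"
      by (metis measure_pmf_UNIV)
    also have "\<dots> \<le> measure_pmf.prob (initial_memory b S) {M. \<not> query_ok S M [] 0 1}
        + measure_pmf.prob (initial_memory b S) {M. \<not> query_ok S M [Insert 0 1] 0 1}"
      by (intro measure_Un_le) auto
    also have "\<dots> \<le> err + err"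
      using correct adm(1,2) unfolding nearly_correct_def by (intro add_mono) blast+
    finally show False using small by simp
  qed
  have q1: "1 \<le> query_cost ?q M" for M
    using differ free_query_constant[of ?q M] by (intro query_cost_ge_1) blast
  have p1: "1 \<le> probes (insert_prog S 0 1) M" for M
  proof (rule ccontr)
    assume "\<not> ?thesis"
    then obtain x where "insert_prog S 0 1 = Return x" using probes_zero[of "insert_prog S 0 1" M] by auto
    then have "memory_step S (Insert 0 1) N = N" for N by (simp add: memory_step_def apply_writes_def)
    then show False using differ by simp
  qed
  have kinds: "is_query (Connected 0 1)" "\<not> is_query (Insert 0 1)" unfolding is_query_def by blast+
  have "1 = (\<integral>\<^sup>+ M. 1 \<partial>?p)" by simp
  also have "\<dots> \<le> (\<integral>\<^sup>+ M. total_cost S [Connected 0 1] M \<partial>?p)" using q1 by (intro nn_integral_mono) simp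
  also have "\<dots> \<le> ennreal (real (length (filter (\<lambda>x. \<not> is_query x) [Connected 0 1])) * tu + real (length (filter is_query [Connected 0 1])) * tq)"
    using time adm(1) unfolding amortized_expected_time_def by (metis append_Nil)
  also have "\<dots> = ennreal tq" using kinds by simp
  finally show "1 \<le> tq" by (simp add: ennreal_ge_1)
  have "1 = (\<integral>\<^sup>+ M. 1 \<partial>?p)" by simp
  also have "\<dots> \<le> (\<integral>\<^sup>+ M. total_cost S [Insert 0 1] M \<partial>?p)"
    using p1 of_nat_mono[OF p1, where 'a = ennreal] by (intro nn_integral_mono) simp
  also have "\<dots> \<le> ennreal (real (length (filter (\<lambda>x. \<not> is_query x) [Insert 0 1])) * tu + real (length (filter is_query [Insert 0 1])) * tq)"
    using time adm(3) unfolding amortized_expected_time_def by metis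
  also have "\<dots> = ennreal tu" using kinds by simp
  finally show "1 \<le> tu" by (simp add: ennreal_ge_1)
qed


subsection \<open>The trade-offs\<close>

text \<open>In the product of two copies of m!, the factors i + 1 and m - i are paired; each pair is
  at least m.\<close>

lemma log_fact_ge: "m * log 2 m \<le> 2 * log 2 (fact m)"
proof (cases "m = 0")
  case False
  have "(\<Prod>i<m. m) \<le> (\<Prod>i<m. Suc i * (m - i))"
  proof (rule prod_mono)
    fix i assume "i \<in> {..<m}"
    then obtain k where k: "m = i + 1 + k" by (metis Suc_eq_plus1 less_iff_Suc_add lessThan_iff add_Suc)
    show "0 \<le> m \<and> m \<le> Suc i * (m - i)" unfolding k by (simp add: algebra_simps)
  qed
  also have "\<dots> = (\<Prod>i<m. Suc i) * (\<Prod>i<m. m - i)" by (rule prod.distrib)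
  also have "(\<Prod>i<m. m - i) = (\<Prod>i<m. Suc (m - Suc i))" by (intro prod.cong) auto
  also have "\<dots> = (\<Prod>i<m. Suc i)" by (rule prod.nat_diff_reindex)
  also have "(\<Prod>i<m. Suc i) = fact m" by (simp add: fact_prod_Suc lessThan_atLeast0)
  finally have "m ^ m \<le> fact m * fact m" by simp
  then have "real (m ^ m) \<le> real (fact m * fact m)" by (rule of_nat_mono)
  then have le: "real m ^ m \<le> fact m * fact m" by simp
  have "m * log 2 m = log 2 (real m ^ m)" using False by (simp add: log_nat_power)
  also have "\<dots> \<le> log 2 (fact m * fact m)" using le False by (subst log_le_cancel_iff) auto
  also have "\<dots> = 2 * log 2 (fact m)" by (simp add: log_mult)
  finally show ?thesis .
qed simp

lemma lg_ge_1: "0 \<le> x \<Longrightarrow> 1 \<le> lg x"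
  unfolding lg_def by (subst le_log_iff) auto

lemma lg_le: "0 \<le> x \<Longrightarrow> lg x \<le> 1 + x"
proof -
  assume x: "0 \<le> x"
  have "ln (1 + x / 2) \<le> x / 2" using x by (intro ln_add_one_self_le_self) auto
  also have "\<dots> \<le> x * ln 2" using x ln2_ge_two_thirds mult_left_mono[of "1 / 2" "ln 2" x] by simp
  finally have "log 2 (1 + x / 2) \<le> x" by (simp add: log_def field_simps)
  moreover have "log 2 (2 * (1 + x / 2)) = log 2 2 + log 2 (1 + x / 2)"
    by (rule log_mult_pos) (use x in auto)
  ultimately show ?thesis by (simp add: lg_def)
qed

text \<open>The entropy is at least D / 8 * m * log 2 m. The error term and the overhead 6 * D take
  at most 1/32 of D * m * log 2 m each, because m * err is at most 1/64 and m at least 64, so half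
  of the entropy is left. With log 2 r + 6 at most 5/2 * log 2 r, the constants are 128 = 2 * 4 * 16
  and 160 = 5/2 * 4 * 16.\<close>

lemma bound_imp_tradeoff:
  fixes t err \<rho> :: real and n m r D b :: nat
  assumes bound: "transfer_inequality b r D m t err"
    and m: "m \<ge> 64" "m * err \<le> 1 / 64" and r: "r \<ge> 16" and D: "D \<ge> 1" and t: "t \<ge> 0"
  shows "log 2 m \<le> t * (128 * real b / D + 160 * log 2 r)"
proof -
  have R: "real r ^ (D + 1) > 0" using r by simp
  have M: "real m \<ge> 64" using m by simp
  have "log 2 64 \<le> log 2 m" using m by (subst log_le_cancel_iff) auto
  moreover have "log 2 64 = (6::real)" using log_nat_power[of 2 2 6] by simp
  ultimately have lm: "log 2 m \<ge> 6" by simp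
  have "log 2 16 \<le> log 2 r" using r by (subst log_le_cancel_iff) auto
  moreover have "log 2 16 = (4::real)" using log_nat_power[of 2 2 4] by simp
  ultimately have lr: "log 2 r \<ge> 4" by simp
  have "real r ^ (D + 1) * (D / 4 * log 2 (fact m)) \<le> real r ^ (D + 1) * ((2 * b + D * (log 2 r + 6)) * (4 * m * t)
     + 3 * D + D * m * (2 * log 2 m * (m * err) + 3 / m))"
  proof -
    define P X L where "P = real r ^ (D + 1)" and "X = 2 * log 2 m * (m * err) + 3 / m" and "L = log 2 (fact m)"
    show ?thesis using bound unfolding transfer_inequality_def of_nat_mult of_nat_power of_nat_numeral P_def[symmetric] X_def[symmetric] L_def[symmetric] by (simp add: algebra_simps)
  qed
  then have "D / 4 * log 2 (fact m) \<le> (2 * b + D * (log 2 r + 6)) * (4 * m * t)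
     + 3 * D + D * m * (2 * log 2 m * (m * err) + 3 / m)"
    using R by (simp only: mult_le_cancel_left_pos)
  moreover have "D / 8 * (m * log 2 m) \<le> D / 4 * log 2 (fact m)"
    using mult_left_mono[OF log_fact_ge[of m], of "D / 8"] by simp
  moreover have "D * m * (2 * log 2 m * (m * err) + 3 / m) \<le> D * m * (log 2 m / 32) + 3 * D"
  proof -
    have "2 * log 2 m * (m * err) \<le> 2 * log 2 m * (1 / 64)" using m lm by (intro mult_left_mono) auto
    then have "D * m * (2 * log 2 m * (m * err) + 3 / m) \<le> D * m * (log 2 m / 32 + 3 / m)"
      by (intro mult_left_mono) auto
    also have "\<dots> = D * m * (log 2 m / 32) + 3 * D" using M by (simp add: field_simps)
    finally show ?thesis .
  qed
  moreover have "6 * D \<le> D * m * (log 2 m / 32)"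
  proof -
    have "6 \<le> m * (log 2 m / 32)" using mult_mono[OF M, of "6 / 32" "log 2 m / 32"] lm by simp
    then have "real D * 6 \<le> real D * (m * (log 2 m / 32))" by (intro mult_left_mono) auto
    then show ?thesis by (simp add: mult_ac)
  qed
  ultimately have "D / 8 * (m * log 2 m) \<le> (2 * b + D * (log 2 r + 6)) * (4 * m * t) + D * m * (log 2 m / 16)"
    by linarith
  also have "\<dots> \<le> (2 * b + D * (5 / 2 * log 2 r)) * (4 * m * t) + D * m * (log 2 m / 16)"
    using lr t by (intro add_right_mono mult_right_mono add_left_mono mult_left_mono) auto
  finally have "(real D * real m) * log 2 m \<le> m * t * (128 * b + 160 * D * log 2 r)"
    by (simp add: algebra_simps)
  also have "\<dots> = (real D * real m) * (t * (128 * real b / D + 160 * log 2 r))"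
    using D by (simp add: field_simps)
  finally have "(real D * real m) * log 2 m \<le> (real D * real m) * (t * (128 * real b / D + 160 * log 2 r))" .
  then show ?thesis using D M by (simp only: mult_le_cancel_left_pos mult_pos_pos)
qed

lemma nat_floor_bounds:
  fixes y :: real
  assumes "1 \<le> y"
  shows "1 \<le> nat \<lfloor>y\<rfloor>" "real (nat \<lfloor>y\<rfloor>) \<le> y" "y \<le> 2 * real (nat \<lfloor>y\<rfloor>)"
proof -
  have "1 \<le> \<lfloor>y\<rfloor>" using assms by (simp add: le_floor_iff)
  moreover from this have "real (nat \<lfloor>y\<rfloor>) = of_int \<lfloor>y\<rfloor>" by simp
  moreover have "of_int \<lfloor>y\<rfloor> \<le> y" "y < of_int \<lfloor>y\<rfloor> + 1" by linarith+
  ultimately show "1 \<le> nat \<lfloor>y\<rfloor>" "real (nat \<lfloor>y\<rfloor>) \<le> y" "y \<le> 2 * real (nat \<lfloor>y\<rfloor>)" by linarith+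
qed

text \<open>The number \<rho> is the ratio of the slower to the faster running time. With r close to
  \<rho> and D of order log n / log r, the term b / D of \<open>bound_imp_tradeoff\<close> is of the
  order of log r as well, since b is at most of order log n.\<close>

lemma tradeoff_of_bounds:
  fixes \<beta>1 \<beta>2 c :: real
  assumes pos: "0 < \<beta>1" "0 < \<beta>2" "0 < c"
  shows "\<exists>\<delta>>0. \<forall>\<^sub>F n in sequentially. real n powr (- c) < 1 / 2 \<and> n \<ge> 2 \<and> (\<forall>b t \<rho>.
     \<beta>1 * lg n \<le> real b \<and> real b \<le> \<beta>2 * lg n \<and> 1 \<le> t \<and> 1 \<le> \<rho> \<and>
     (\<forall>r D m. r \<ge> 16 \<and> r \<le> 2 ^ b \<and> (r ^ (D + 1) + 1) * m \<le> n \<and> m \<ge> 2 \<and> \<rho> \<le> real r \<longrightarrow>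
        transfer_inequality b r D m t (real n powr (- c)))
     \<longrightarrow> \<delta> * lg n \<le> t * lg \<rho>)"
proof -
  \<comment> \<open>The bound 1/8 keeps \<open>r ^ (D + 1)\<close> below
    \<open>n powr (1 / 4)\<close>; the bound \<beta>1 ensures \<open>r \<le> 2 ^ b\<close>.\<close>
  define \<eta> where "\<eta> = min (1 / 8) \<beta>1"
  \<comment> \<open>As the exponent of m, 1/4 lets the grid fit into n vertices, and c / 2 keeps m
    times the error probability small.\<close>
  define \<zeta> where "\<zeta> = min (1 / 4) (c / 2)"
  \<comment> \<open>The 512 is 128 with two factors 2, one from
    \<open>lg n \<le> 2 * \<Lambda>\<close> and one from rounding D down.\<close>
  define A where "A = 512 * \<beta>2 / \<eta> + 160"
  \<comment> \<open>The two entries serve the case in which no level fits and the case in which D is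
    positive. The factor 10 is 5 * 2, from \<open>lr\<close> and
    \<open>lg n \<le> 2 * \<Lambda>\<close>; the 20 contains another 2 from rounding m down.\<close>
  define \<delta> where "\<delta> = min (\<eta> / 10) (\<zeta> / (20 * A))"
  have \<eta>: "0 < \<eta>" "\<eta> \<le> 1 / 8" "\<eta> \<le> \<beta>1" and \<zeta>: "0 < \<zeta>" "\<zeta> \<le> 1 / 4" "\<zeta> \<le> c / 2"
    using pos by (auto simp: \<eta>_def \<zeta>_def)
  have A: "A > 0" using pos \<eta> by (simp add: A_def add_pos_pos)
  have \<delta>: "\<delta> > 0" using \<eta> \<zeta> A by (simp add: \<delta>_def)
  have large: "\<forall>\<^sub>F n in sequentially. real n powr a \<ge> B" if "a > 0" "B > 0" for a B :: real
  proof -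
    have "\<forall>\<^sub>F n in sequentially. real n \<ge> B powr (1 / a)"
      using filterlim_real_sequentially unfolding filterlim_at_top by blast
    then show ?thesis
    proof eventually_elim
      case (elim n)
      have "B = (B powr (1 / a)) powr a" using that by (simp add: powr_powr)
      also have "\<dots> \<le> real n powr a" using elim that by (intro powr_mono2) auto
      finally show ?case .
    qed
  qed
  have "\<forall>\<^sub>F n in sequentially. n \<ge> 4 \<and> real n powr \<zeta> \<ge> 65 \<and> real n powr (c / 2) \<ge> 64"
    using large[of \<zeta> 65] large[of "c / 2" 64] \<zeta> pos by (auto intro: eventually_conj eventually_ge_at_top)
  then have "\<forall>\<^sub>F n in sequentially. real n powr (- c) < 1 / 2 \<and> n \<ge> 2 \<and> (\<forall>b t \<rho>.
     \<beta>1 * lg n \<le> real b \<and> real b \<le> \<beta>2 * lg n \<and> 1 \<le> t \<and> 1 \<le> \<rho> \<and>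
     (\<forall>r D m. r \<ge> 16 \<and> r \<le> 2 ^ b \<and> (r ^ (D + 1) + 1) * m \<le> n \<and> m \<ge> 2 \<and> \<rho> \<le> real r \<longrightarrow>
        transfer_inequality b r D m t (real n powr (- c)))
     \<longrightarrow> \<delta> * lg n \<le> t * lg \<rho>)"
  proof eventually_elim
    case (elim n)
    then have n: "real n \<ge> 4" and n\<zeta>: "real n powr \<zeta> \<ge> 65" and nc: "real n powr (c / 2) \<ge> 64" by auto
    have n0: "real n > 0" "n > 0" using n by auto
    define \<Lambda> where "\<Lambda> = log 2 n"
    have "log 2 4 \<le> \<Lambda>" unfolding \<Lambda>_def using n by (subst log_le_cancel_iff) auto
    moreover have "log 2 4 = (2::real)" using log_nat_power[of 2 2 2] by simp
    ultimately have \<Lambda>: "\<Lambda> \<ge> 2" by simp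
    have nP: "real n powr a = 2 powr (a * \<Lambda>)" for a using n0 by (simp add: \<Lambda>_def powr_powr[symmetric] mult.commute[of a])
    have lgn: "\<Lambda> \<le> lg n" "lg n \<le> 2 * \<Lambda>"
    proof -
      show "\<Lambda> \<le> lg n" unfolding \<Lambda>_def lg_def using n0 by (subst log_le_cancel_iff) auto
      have "lg n \<le> log 2 (2 * real n)" unfolding lg_def using n by (subst log_le_cancel_iff) auto
      also have "\<dots> = 1 + \<Lambda>" using n0 by (simp add: log_mult \<Lambda>_def)
      finally show "lg n \<le> 2 * \<Lambda>" using \<Lambda> by simp
    qed
    have ncc: "real n powr (- c) * real n powr (c / 2) \<le> 1 / 64"
    proof -
      have "real n powr (- c) * real n powr (c / 2) = 1 / real n powr (c / 2)"
        using n0 by (simp add: powr_add[symmetric] powr_minus_divide[symmetric])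
      also have "\<dots> \<le> 1 / 64" using nc n0 by (intro divide_left_mono) auto
      finally show ?thesis .
    qed
    have "real n powr (- c) * 64 \<le> real n powr (- c) * real n powr (c / 2)" using nc by (intro mult_left_mono) auto
    then have "real n powr (- c) < 1 / 2" using ncc by simp
    moreover have "n \<ge> 2" using n by simp
    moreover have "\<delta> * lg n \<le> t * lg \<rho>"
      if b: "\<beta>1 * lg n \<le> real b" "real b \<le> \<beta>2 * lg n" and t: "1 \<le> t" and \<rho>: "1 \<le> \<rho>"
        and bound: "\<forall>r D m. r \<ge> 16 \<and> r \<le> 2 ^ b \<and> (r ^ (D + 1) + 1) * m \<le> n \<and> m \<ge> 2 \<and> \<rho> \<le> real r \<longrightarrow>
        transfer_inequality b r D m t (real n powr (- c))"
      for b :: nat and t \<rho> :: real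
    proof -
      define r where "r = 16 + nat \<lceil>\<rho>\<rceil>"
      have r: "r \<ge> 16" "\<rho> \<le> real r" "real r \<le> 17 + \<rho>" using \<rho> by (auto simp: r_def) linarith+
      have lr0: "log 2 r \<ge> 4"
      proof -
        have "log 2 16 \<le> log 2 r" using r by (subst log_le_cancel_iff) auto
        moreover have "log 2 16 = (4::real)" using log_nat_power[of 2 2 4] by simp
        ultimately show ?thesis by simp
      qed
      \<comment> \<open>Rounding \<rho> up to an integer of at least 16 costs a factor 5 in the
        logarithm, because 16 is at most the fourth power of 2 + \<rho>.\<close>
      have lr: "log 2 r \<le> 5 * lg \<rho>"
      proof -
        have "(2::real) ^ 4 \<le> (2 + \<rho>) ^ 4" using \<rho> by (intro power_mono) auto
        then have "16 * (2 + \<rho>) \<le> (2 + \<rho>) ^ 4 * (2 + \<rho>)" using \<rho> by (intro mult_right_mono) auto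
        also have "(2 + \<rho>) ^ 4 * (2 + \<rho>) = (2 + \<rho>) ^ 5" using power_Suc2[of "2 + \<rho>" 4] by simp
        finally have "16 * (2 + \<rho>) \<le> (2 + \<rho>) ^ 5" .
        moreover have "real r \<le> 16 * (2 + \<rho>)" using r(3) \<rho> by simp
        ultimately have "real r \<le> (2 + \<rho>) ^ 5" by (rule order.trans[rotated])
        then have "log 2 r \<le> log 2 ((2 + \<rho>) ^ 5)" using r \<rho> by (subst log_le_cancel_iff) auto
        also have "\<dots> = 5 * lg \<rho>" using \<rho> by (simp add: lg_def log_nat_power)
        finally show ?thesis .
      qed
      have lg0: "lg \<rho> \<ge> 0" using lg_ge_1[of \<rho>] \<rho> by simp
      show ?thesis
      proof (cases "log 2 r > \<eta> * \<Lambda>")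
        \<comment> \<open>If r exceeds a fixed power of n, then lg \<rho> is already of order lg n
          and \<open>t \<ge> 1\<close> suffices.\<close>
        case True
        have "\<delta> * lg n \<le> \<eta> / 10 * (2 * \<Lambda>)" using \<eta> \<Lambda> lgn \<delta> by (intro mult_mono) (auto simp: \<delta>_def)
        also have "\<dots> = \<eta> * \<Lambda> / 5" by simp
        also have "\<dots> \<le> lg \<rho>" using True lr by linarith
        also have "\<dots> \<le> t * lg \<rho>" using t lg0 mult_right_mono[of 1 t "lg \<rho>"] by simp
        finally show ?thesis .
      next
        case False
        define D where "D = nat \<lfloor>\<eta> * \<Lambda> / log 2 r\<rfloor>"
        define m where "m = nat \<lfloor>real n powr \<zeta>\<rfloor>"
        have x: "\<eta> * \<Lambda> / log 2 r \<ge> 1" using False lr0 by (simp add: field_simps)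
        have D: "D \<ge> 1" "real D \<le> \<eta> * \<Lambda> / log 2 r" "\<eta> * \<Lambda> / log 2 r \<le> 2 * real D"
          unfolding D_def using nat_floor_bounds[OF x] by auto
        have m: "m \<ge> 64" "real m \<le> real n powr \<zeta>" "real n powr \<zeta> \<le> 2 * real m"
          unfolding m_def using nat_floor_bounds[of "real n powr \<zeta>"] n\<zeta> by (auto simp: le_nat_iff le_floor_iff)
        have rpow: "real r = 2 powr (log 2 r)" using r by simp
        have rD: "real r ^ (D + 1) \<le> real n powr (1 / 4)"
        proof -
          have "real r ^ (D + 1) = real r powr real (D + 1)" using r by (subst powr_realpow) auto
          also have "\<dots> = (2 powr log 2 r) powr real (D + 1)" using r by simp
          also have "\<dots> = 2 powr (log 2 r * (real D + 1))" by (simp only: powr_powr of_nat_add of_nat_1)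
          also have "\<dots> \<le> 2 powr (1 / 4 * \<Lambda>)"
          proof (rule powr_mono)
            have "log 2 r * real D \<le> \<eta> * \<Lambda>" using D(2) lr0 by (simp add: field_simps)
            moreover have "\<eta> * \<Lambda> \<le> 1 / 8 * \<Lambda>" using \<eta> \<Lambda> by (intro mult_right_mono) auto
            ultimately show "log 2 r * (real D + 1) \<le> 1 / 4 * \<Lambda>" using False by (simp add: distrib_left)
          qed simp
          finally show ?thesis unfolding nP .
        qed
        have room: "(r ^ (D + 1) + 1) * m \<le> n"
        proof -
          have q1: "1 \<le> real n powr (1 / 4)" using n by (intro ge_one_powr_ge_zero) auto
          have "real m \<le> real n powr (1 / 4)" using m(2) \<zeta> n powr_mono[of \<zeta> "1 / 4" "real n"] by linarith
          then have "(real r ^ (D + 1) + 1) * real m \<le> (2 * real n powr (1 / 4)) * real n powr (1 / 4)"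
            using rD q1 by (intro mult_mono) auto
          also have "\<dots> = 2 * real n powr (1 / 2)" by (simp add: powr_add[symmetric])
          also have "\<dots> \<le> real n powr (1 / 2) * real n powr (1 / 2)"
          proof -
            have "(2::real) = 4 powr (1 / 2)" by (simp add: powr_half_sqrt)
            also have "\<dots> \<le> real n powr (1 / 2)" using n by (intro powr_mono2) auto
            finally show ?thesis by (intro mult_right_mono) auto
          qed
          also have "\<dots> = real n" using n0 by (simp add: powr_add[symmetric])
          finally have "real ((r ^ (D + 1) + 1) * m) \<le> real n"
            unfolding of_nat_mult of_nat_add of_nat_power of_nat_1 .
          then show ?thesis by (simp only: of_nat_le_iff)
        qed
        have rb: "r \<le> 2 ^ b"
        proof -
          have "\<eta> * \<Lambda> \<le> \<beta>1 * lg n" using \<eta> \<Lambda> lgn by (intro mult_mono) auto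
          then have "log 2 r \<le> real b" using False b by linarith
          then have "real r \<le> 2 powr real b" using rpow by (metis powr_mono one_le_numeral)
          then have "real r \<le> real (2 ^ b)" by (simp add: powr_realpow)
          then show ?thesis by (simp only: of_nat_le_iff)
        qed
        have merr: "real m * real n powr (- c) \<le> 1 / 64"
        proof -
          have "real n powr \<zeta> \<le> real n powr (c / 2)" using \<zeta> n by (intro powr_mono) auto
          then have "real m * real n powr (- c) \<le> real n powr (c / 2) * real n powr (- c)"
            using m by (intro mult_right_mono) auto
          then show ?thesis using ncc by (simp add: mult.commute)
        qed
        have "log 2 m \<le> t * (128 * real b / D + 160 * log 2 r)"
          by (rule bound_imp_tradeoff[OF _ m(1) merr r(1) D(1)]) (use bound r rb room m t in auto)
        also have "\<dots> \<le> t * (A * log 2 r)"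
        proof (rule mult_left_mono)
          have "real b \<le> \<beta>2 * (2 * \<Lambda>)" using b(2) lgn pos mult_left_mono[of "lg n" "2 * \<Lambda>" \<beta>2] by linarith
          then have "128 * real b / D \<le> 128 * (\<beta>2 * (2 * \<Lambda>)) / D" by (intro divide_right_mono mult_left_mono; (assumption | simp))
          also have "\<dots> \<le> 128 * (\<beta>2 * (2 * \<Lambda>)) / (\<eta> * \<Lambda> / log 2 r / 2)"
          proof -
            define y where "y = \<eta> * \<Lambda> / log 2 r"
            have "y \<ge> 1" "y \<le> 2 * real D" using x D(3) by (simp_all add: y_def)
            then show ?thesis using D(1) pos \<Lambda> unfolding y_def[symmetric]
              by (intro divide_left_mono) auto
          qed
          also have "\<dots> = 512 * \<beta>2 / \<eta> * log 2 r" using \<Lambda> \<eta> lr0 by (simp add: field_simps)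
          finally show "128 * real b / D + 160 * log 2 r \<le> A * log 2 r" by (simp add: A_def algebra_simps)
        qed (use t in auto)
        finally have lm: "log 2 m \<le> t * (A * log 2 r)" .
        have "\<zeta> * \<Lambda> / 2 \<le> log 2 m"
        proof -
          have "log 2 (real n powr \<zeta>) \<le> log 2 (2 * real m)" using m n0 by (subst log_le_cancel_iff) auto
          then have 1: "\<zeta> * \<Lambda> \<le> 1 + log 2 m" using m n0 by (simp add: log_mult log_powr \<Lambda>_def)
          have "log 2 2 \<le> log 2 m" using m by (subst log_le_cancel_iff) auto
          then show ?thesis using 1 by simp
        qed
        also note lm
        also have "t * (A * log 2 r) \<le> t * (A * (5 * lg \<rho>))" using t A lr by (intro mult_left_mono) auto
        finally have "\<zeta> * \<Lambda> / (10 * A) \<le> t * lg \<rho>" using A by (simp add: field_simps)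
        moreover have "\<delta> * lg n \<le> \<zeta> / (20 * A) * (2 * \<Lambda>)" using \<zeta> A \<Lambda> lgn \<delta> by (intro mult_mono) (auto simp: \<delta>_def)
        moreover have "\<zeta> / (20 * A) * (2 * \<Lambda>) = \<zeta> * \<Lambda> / (10 * A)" by simp
        ultimately show ?thesis by linarith
      qed
    qed
    ultimately show ?case by blast
  qed
  then show ?thesis using \<delta> by blast
qed

text \<open>With s the faster and t the slower time, the left side is at most s + t, while lg is at
  least 1 on the right. The trade-off in which lg is only a constant thus follows from the other
  one, and each regime needs a single bound.\<close>

lemma lg_swap_le:
  assumes "1 \<le> s" "s \<le> t"
  shows "s * lg (t / s) \<le> 2 * (t * lg (s / t))"
proof -
  have "s * lg (t / s) \<le> s * (1 + t / s)" using assms by (intro mult_left_mono lg_le) auto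
  also have "\<dots> = s + t" using assms by (simp add: field_simps)
  also have "\<dots> \<le> 2 * (t * 1)" using assms by simp
  also have "\<dots> \<le> 2 * (t * lg (s / t))" using assms by (intro mult_left_mono lg_ge_1) auto
  finally show ?thesis .
qed

text \<open>The predicate \<open>C\<close> stands for either notion of correctness. As path unions
  are simple graphs, a structure for the larger class also has to handle the hard sequences.\<close>

lemma connectivity_tradeoff:
  fixes \<beta>1 \<beta>2 c :: real
  assumes pos: "0 < \<beta>1" "0 < \<beta>2" "0 < c"
    and C: "\<And>n G b S. C n G b S \<Longrightarrow> G \<in> {simple_graphs n, path_unions n} \<Longrightarrow> nearly_correct n b (real n powr (- c)) S"
  shows "\<exists>\<delta>>0. \<forall>\<^sub>F n in sequentially. \<forall>G \<in> {simple_graphs n, path_unions n}. \<forall>b S tu tq.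
     \<beta>1 * lg (real n) \<le> real b \<and> real b \<le> \<beta>2 * lg (real n) \<and> C n G b S \<and> amortized_expected_time n G b S tu tq \<longrightarrow>
     tq * lg (tu / tq) \<ge> \<delta> * lg (real n) \<and> tu * lg (tq / tu) \<ge> \<delta> * lg (real n)"
proof -
  obtain \<delta> where \<delta>: "\<delta> > 0" and ev: "\<forall>\<^sub>F n in sequentially. real n powr (- c) < 1 / 2 \<and> n \<ge> 2 \<and> (\<forall>b t \<rho>.
     \<beta>1 * lg n \<le> real b \<and> real b \<le> \<beta>2 * lg n \<and> 1 \<le> t \<and> 1 \<le> \<rho> \<and>
     (\<forall>r D m. r \<ge> 16 \<and> r \<le> 2 ^ b \<and> (r ^ (D + 1) + 1) * m \<le> n \<and> m \<ge> 2 \<and> \<rho> \<le> real r \<longrightarrow>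
        transfer_inequality b r D m t (real n powr (- c)))
     \<longrightarrow> \<delta> * lg n \<le> t * lg \<rho>)"
    using tradeoff_of_bounds[OF pos] by blast
  show ?thesis
  proof (intro exI[of _ "\<delta> / 2"] conjI)
    show "\<delta> / 2 > 0" using \<delta> by simp
    show "\<forall>\<^sub>F n in sequentially. \<forall>G \<in> {simple_graphs n, path_unions n}. \<forall>b S tu tq.
       \<beta>1 * lg (real n) \<le> real b \<and> real b \<le> \<beta>2 * lg (real n) \<and> C n G b S \<and> amortized_expected_time n G b S tu tq \<longrightarrow>
       tq * lg (tu / tq) \<ge> \<delta> / 2 * lg (real n) \<and> tu * lg (tq / tu) \<ge> \<delta> / 2 * lg (real n)"
      using ev
    proof eventually_elim
      case (elim n)
      note tradeoff = elim[THEN conjunct2, THEN conjunct2, rule_format]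
      have main: "\<delta> / 2 * lg (real n) \<le> tq * lg (tu / tq) \<and> \<delta> / 2 * lg (real n) \<le> tu * lg (tq / tu)"
        if b: "\<beta>1 * lg (real n) \<le> real b" "real b \<le> \<beta>2 * lg (real n)"
          and correct: "nearly_correct n b (real n powr (- c)) S"
          and time: "amortized_expected_time n (path_unions n) b S tu tq"
        for b S tu tq
      proof -
        have ge1: "1 \<le> tu" "1 \<le> tq" using times_ge_1[OF _ _ correct time] elim by blast+
        have lgn: "lg (real n) \<ge> 0" using lg_ge_1[of "real n"] by simp
        show ?thesis
        proof (cases "tq \<le> tu")
          case True
          have "transfer_inequality b r D m tq (real n powr (- c))"
            if r: "r \<ge> 16" "r \<le> 2 ^ b" "(r ^ (D + 1) + 1) * m \<le> n" "m \<ge> 2" "tu / tq \<le> real r" for r D m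
          proof (rule slow_updates_bound[OF correct r(4,1,2)])
            have "(r ^ D + 1) * m \<le> (r ^ (D + 1) + 1) * m" using r(1) by (intro mult_right_mono) auto
            then show "(r ^ D + 1) * m \<le> n" using r(3) by linarith
            show "tu \<le> real r * tq" using r(5) ge1 by (simp add: field_simps)
          qed (use time ge1 in auto)
          then have "\<delta> * lg n \<le> tq * lg (tu / tq)" using b ge1 True
            by (intro tradeoff[of b tq "tu / tq"] conjI allI impI) (auto simp only: le_divide_eq_1_pos)
          moreover have "tq * lg (tu / tq) \<le> 2 * (tu * lg (tq / tu))" by (rule lg_swap_le[OF ge1(2) True])
          moreover have "0 \<le> \<delta> * lg (real n)" using \<delta> lgn by simp
          moreover have "\<delta> / 2 * lg (real n) = \<delta> * lg (real n) / 2" by simp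
          ultimately show ?thesis by linarith
        next
          case False
          have "transfer_inequality b r D m tu (real n powr (- c))"
            if r: "r \<ge> 16" "r \<le> 2 ^ b" "(r ^ (D + 1) + 1) * m \<le> n" "m \<ge> 2" "tq / tu \<le> real r" for r D m
          proof (rule slow_queries_bound[OF correct r(4,1,2,3)])
            show "tq \<le> real r * tu" using r(5) ge1 by (simp add: field_simps)
          qed (use time ge1 in auto)
          then have "\<delta> * lg n \<le> tu * lg (tq / tu)" using b ge1 False
            by (intro tradeoff[of b tu "tq / tu"] conjI allI impI) (auto simp only: le_divide_eq_1_pos)
          moreover have "tu * lg (tq / tu) \<le> 2 * (tq * lg (tu / tq))" using lg_swap_le[OF ge1(1)] False by simp
          moreover have "0 \<le> \<delta> * lg (real n)" using \<delta> lgn by simp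
          moreover have "\<delta> / 2 * lg (real n) = \<delta> * lg (real n) / 2" by simp
          ultimately show ?thesis by linarith
        qed
      qed
      show ?case
      proof (intro ballI allI impI, elim conjE)
        fix G b S tu tq
        assume G: "G \<in> {simple_graphs n, path_unions n}" and CG: "C n G b S"
          and time: "amortized_expected_time n G b S tu tq"
          and b: "\<beta>1 * lg (real n) \<le> real b" "real b \<le> \<beta>2 * lg (real n)"
        have "path_unions n \<subseteq> G" using G path_unions_subset_simple_graphs by auto
        then have "amortized_expected_time n (path_unions n) b S tu tq"
          using time admissible_mono unfolding amortized_expected_time_def by blast
        then show "\<delta> / 2 * lg (real n) \<le> tq * lg (tu / tq) \<and> \<delta> / 2 * lg (real n) \<le> tu * lg (tq / tu)"
          by (rule main[OF b C[OF CG G]])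
      qed
    qed
  qed
qed

lemma admissible_path_unions:
  "G \<in> {simple_graphs n, path_unions n} \<Longrightarrow> admissible n (path_unions n) {} xs \<Longrightarrow> admissible n G {} xs"
  using admissible_mono path_unions_subset_simple_graphs by blast

lemma las_vegas_nearly_correct:
  assumes lv: "las_vegas_connectivity n G b S" and G: "G \<in> {simple_graphs n, path_unions n}"
  shows "nearly_correct n b (real n powr (- c)) S"
  unfolding nearly_correct_def
proof (intro conjI allI impI ballI disjI2)
  show "wf_structure n b S" using lv by (simp add: las_vegas_connectivity_def)
  fix xs u v assume adm: "admissible n (path_unions n) {} (xs @ [Connected u v])"
  show ok: "query_ok S M xs u v" if "M \<in> set_pmf (initial_memory b S)" for M
    using lv that admissible_path_unions[OF G adm] unfolding las_vegas_connectivity_def query_ok_def by blast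
  then have "measure_pmf.prob (initial_memory b S) {M. \<not> query_ok S M xs u v} = 0"
    by (auto simp: measure_pmf_zero_iff)
  then show "measure_pmf.prob (initial_memory b S) {M. \<not> query_ok S M xs u v} \<le> real n powr (- c)" by simp
qed

lemma monte_carlo_nearly_correct:
  assumes mc: "monte_carlo_connectivity n G b err S" and G: "G \<in> {simple_graphs n, path_unions n}"
  shows "nearly_correct n b err S"
  unfolding nearly_correct_def
proof (intro conjI allI impI ballI disjI1)
  show "wf_structure n b S" using mc by (simp add: monte_carlo_connectivity_def)
  fix xs u v assume adm: "admissible n (path_unions n) {} (xs @ [Connected u v])"
  have "u < n" "v < n" using adm by (auto simp: admissible_append)
  then show det: "\<exists>p. connected_query S u v = Deterministic p"
    using mc unfolding monte_carlo_connectivity_def by blast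
  then have "{M. \<not> query_ok S M xs u v} = {M. answer (connected_query S u v) (fold (memory_step S) xs M) \<noteq>
      same_component (fold graph_step xs {}) u v}"
    by (auto simp: query_ok_def)
  then show "measure_pmf.prob (initial_memory b S) {M. \<not> query_ok S M xs u v} \<le> err"
    using mc admissible_path_unions[OF G adm] unfolding monte_carlo_connectivity_def by simp
qed

theorem theorem2p4:
  fixes \<beta>1 \<beta>2 :: real
  assumes "0 < \<beta>1" and "0 < \<beta>2"
  shows
    "(\<exists>\<delta>>0. \<forall>\<^sub>F n in sequentially. \<forall>\<G> \<in> {simple_graphs n, path_unions n}. \<forall>b D tu tq.
        \<beta>1 * lg (real n) \<le> real b \<and> real b \<le> \<beta>2 * lg (real n) \<and>
        las_vegas_connectivity n \<G> b D \<and>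
        amortized_expected_time n \<G> b D tu tq \<longrightarrow>
        tq * lg (tu / tq) \<ge> \<delta> * lg (real n) \<and> tu * lg (tq / tu) \<ge> \<delta> * lg (real n)) \<and>
     (\<forall>c>0. \<exists>\<delta>>0. \<forall>\<^sub>F n in sequentially. \<forall>\<G> \<in> {simple_graphs n, path_unions n}. \<forall>b D tu tq.
        \<beta>1 * lg (real n) \<le> real b \<and> real b \<le> \<beta>2 * lg (real n) \<and>
        monte_carlo_connectivity n \<G> b (real n powr (- c)) D \<and>
        amortized_expected_time n \<G> b D tu tq \<longrightarrow>
        tq * lg (tu / tq) \<ge> \<delta> * lg (real n) \<and> tu * lg (tq / tu) \<ge> \<delta> * lg (real n))"
proof (intro conjI allI impI)
  show "\<exists>\<delta>>0. \<forall>\<^sub>F n in sequentially. \<forall>\<G> \<in> {simple_graphs n, path_unions n}. \<forall>b D tu tq.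
        \<beta>1 * lg (real n) \<le> real b \<and> real b \<le> \<beta>2 * lg (real n) \<and>
        las_vegas_connectivity n \<G> b D \<and>
        amortized_expected_time n \<G> b D tu tq \<longrightarrow>
        tq * lg (tu / tq) \<ge> \<delta> * lg (real n) \<and> tu * lg (tq / tu) \<ge> \<delta> * lg (real n)"
    \<comment> \<open>The error probability is 0, so every exponent is admissible; 1 is
      taken.\<close>
    by (rule connectivity_tradeoff[OF assms zero_less_one]) (rule las_vegas_nearly_correct)
  show "\<exists>\<delta>>0. \<forall>\<^sub>F n in sequentially. \<forall>\<G> \<in> {simple_graphs n, path_unions n}. \<forall>b D tu tq.
        \<beta>1 * lg (real n) \<le> real b \<and> real b \<le> \<beta>2 * lg (real n) \<and>
        monte_carlo_connectivity n \<G> b (real n powr (- c)) D \<and>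
        amortized_expected_time n \<G> b D tu tq \<longrightarrow>
        tq * lg (tu / tq) \<ge> \<delta> * lg (real n) \<and> tu * lg (tq / tu) \<ge> \<delta> * lg (real n)" if "c > 0" for c
    by (rule connectivity_tradeoff[OF assms that]) (rule monte_carlo_nearly_correct)
qed

end
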